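(* Let $G$ be a compact Lie group with Lie algebra $\mathfrak{g}$, a bi-invariant Riemannian metric, and complexification $G_{\mathbb{C}}=G\cdot\exp(i\mathfrak{g})$, and let $S$ be a gauge-invariant action extending holomorphically to $G_{\mathbb{C}}^N$, with notation as in the context. Suppose $G$ is an Abelian group and the distance function is $$F(\{U\})=\frac12\sum_{x\in\mathcal{X}}\sum_{\mu=0}^d\langle Y_{x,\mu},Y_{x,\mu}\rangle_e,\qquad\{U\}\in G_{\mathbb{C}}^N,$$ where $Y_{x,\mu}\in i\mathfrak{g}$ is given by the Cartan decomposition $U_{x,\mu}=V_{x,\mu}\exp(Y_{x,\mu})$, $V_{x,\mu}\in G$. Let $$M=\Big\{\{U\}\in G_{\mathbb{C}}^N\,\Big|\,F(\{U\})\le F(\{\widetilde U\})\text{ for any }g_x\in G_{\mathbb{C}},\ x\in\mathcal{X}\Big\},\qquad\widetilde U_{x,\mu}=g_x^{-1}U_{x,\mu}g_{x+\hat\mu}.$$ Then the complex Langevin equation $$dU_{x,\mu}=\sum_{a=1}^m(dR_{U_{x,\mu}})_e\Big(\big[K^a_{x,\mu}(\{U\})\,dt+dw^a_{x,\mu}\big]X^a+\big[J^a_{x,\mu}(\{U\})\,dt\big]Y^a\Big),\qquad x\in\mathcal{X},\ \mu=0,1,\dots,d,$$ guarantees that $\{U(t)\}\in M$ for all $t$ if the initial condition satisfies $\{U(0)\}\in M$.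
   Context: Lattice: $\mathcal{X}=(\mathbb{Z}/N_0\mathbb{Z})\times\cdots\times(\mathbb{Z}/N_d\mathbb{Z})$ (periodic), $N=(d+1)N_0N_1\cdots N_d$, and $\hat\mu$ is the canonical unit vector in direction $\mu$. A field $\{U\}$ is a collection of link variables $U_{x,\mu}$, $x\in\mathcal{X}$, $\mu=0,\dots,d$; $\{U\}\in G_{\mathbb{C}}^N$ if all $U_{x,\mu}\in G_{\mathbb{C}}$. Group: $G$ has identity $e$ and bi-invariant metric $\langle\cdot,\cdot\rangle_g$; $\{X^1,\dots,X^m\}$ is an orthonormal basis of $\mathfrak{g}$ for $\langle\cdot,\cdot\rangle_e$ and $Y^a=iX^a$. $G_{\mathbb{C}}=G\cdot\exp(i\mathfrak{g})$ has Lie algebra $\mathfrak{g}\oplus i\mathfrak{g}$, with inner product $\langle X_1+iX_1',X_2+iX_2'\rangle_e=\langle X_1,X_2\rangle_e+\langle X_1',X_2'\rangle_e$ for $X_1,X_1',X_2,X_2'\in\mathfrak{g}$; every $U\in G_{\mathbb{C}}$ is uniquely $V\exp(Y)$ with $V\in G$, $Y\in i\mathfrak{g}$. $R_g:h\mapsto hg$ is right translation and $(dR_g)_e$ its differential at $e$. Gauge invariance: $S(\{\widetilde U\})=S(\{U\})$ for every $\{U\}\in G_{\mathbb{C}}^N$ and all $g_x\in G_{\mathbb{C}}$ ($x\in\mathcal{X}$), where $\widetilde U_{x,\mu}=g_x^{-1}U_{x,\mu}g_{x+\hat\mu}$. $\mathcal{L}_{X^a_{x,\mu}}$ is the Lie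 derivative with respect to $U_{x,\mu}$ along the right-invariant vector field generated by $X^a$; $K^a_{x,\mu}=-\mathcal{L}_{X^a_{x,\mu}}\operatorname{Re}S$ and $J^a_{x,\mu}=-\mathcal{L}_{X^a_{x,\mu}}\operatorname{Im}S$. The $w^a_{x,\mu}$ are independent Brownian motions normalized by $(dw^a_{x,\mu})^2=2\,dt$, and the equation is in the Stratonovich sense. *)

theory Defs
  imports "HOL-Probability.Probability" "HOL-Algebra.Group"
begin

section \<open>Smooth manifolds\<close>

fun Ck_on :: "nat \<Rightarrow> 'a::real_normed_vector set \<Rightarrow> ('a \<Rightarrow> 'b::real_normed_vector) \<Rightarrow> bool" where
  "Ck_on 0 S f \<longleftrightarrow> continuous_on S f"
| "Ck_on (Suc k) S f \<longleftrightarrow>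
     (\<forall>x\<in>S. f differentiable (at x)) \<and> (\<forall>v. Ck_on k S (\<lambda>x. frechet_derivative f (at x) v))"

text \<open>Both notions are only used on open sets.\<close>

definition smooth_on :: "'a::real_normed_vector set \<Rightarrow> ('a \<Rightarrow> 'b::real_normed_vector) \<Rightarrow> bool" where
  "smooth_on S f \<longleftrightarrow> (\<forall>k. Ck_on k S f)"

text \<open>A chart is a pair of its domain and its coordinate map; the values of the coordinate map
  outside the domain are irrelevant.\<close>

type_synonym ('p, 'e) chart = "'p set \<times> ('p \<Rightarrow> 'e)"

record ('p, 'e) mfd =
  mtop :: "'p topology"
  charts :: "('p, 'e) chart set"

definition chart_inv :: "('p, 'e) chart \<Rightarrow> 'e \<Rightarrow> 'p" where
  "chart_inv c = inv_into (fst c) (snd c)"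

definition is_chart :: "'p topology \<Rightarrow> ('p, 'e::euclidean_space) chart \<Rightarrow> bool" where
  "is_chart T c \<longleftrightarrow> openin T (fst c) \<and> open (snd c ` fst c) \<and>
     homeomorphic_map (subtopology T (fst c)) (top_of_set (snd c ` fst c)) (snd c)"

definition coord_rep ::
    "('p, 'e) chart \<Rightarrow> ('q, 'f) chart \<Rightarrow> ('p \<Rightarrow> 'q) \<Rightarrow> 'e \<Rightarrow> 'f" where
  "coord_rep c c' F = snd c' \<circ> F \<circ> chart_inv c"

definition coord_dom ::
    "('p, 'e) chart \<Rightarrow> ('q, 'f) chart \<Rightarrow> ('p \<Rightarrow> 'q) \<Rightarrow> 'e set" where
  "coord_dom c c' F = snd c ` (fst c \<inter> F -` fst c')"

definition smooth_map ::
    "('p, 'e::euclidean_space) mfd \<Rightarrow> ('q, 'f::euclidean_space) mfd \<Rightarrow> ('p \<Rightarrow> 'q) \<Rightarrow> bool" where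
  "smooth_map M M' F \<longleftrightarrow> continuous_map (mtop M) (mtop M') F \<and>
     (\<forall>c\<in>charts M. \<forall>c'\<in>charts M'. smooth_on (coord_dom c c' F) (coord_rep c c' F))"

text \<open>Smoothness of the identity map says that all transition maps are smooth.\<close>

definition smooth_manifold :: "('p, 'e::euclidean_space) mfd \<Rightarrow> bool" where
  "smooth_manifold M \<longleftrightarrow> Hausdorff_space (mtop M) \<and> second_countable (mtop M) \<and>
     (\<forall>c\<in>charts M. is_chart (mtop M) c) \<and> (\<Union>c\<in>charts M. fst c) = topspace (mtop M) \<and>
     smooth_map M M (\<lambda>p. p)"

definition prod_mfd :: "('p, 'e) mfd \<Rightarrow> ('q, 'f) mfd \<Rightarrow> ('p \<times> 'q, 'e \<times> 'f) mfd" where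
  "prod_mfd M M' = \<lparr>mtop = prod_topology (mtop M) (mtop M'),
     charts = {(fst c \<times> fst c', map_prod (snd c) (snd c')) |c c'. c \<in> charts M \<and> c' \<in> charts M'}\<rparr>"

definition real_mfd :: "(real, real) mfd" where
  "real_mfd = \<lparr>mtop = euclidean, charts = {(UNIV, \<lambda>t. t)}\<rparr>"

text \<open>\<open>J\<close> and \<open>J'\<close> are multiplication by the imaginary unit on the model spaces, so the last
  condition consists of the Cauchy--Riemann equations in charts.\<close>

definition holomorphic_map ::
    "('e \<Rightarrow> 'e) \<Rightarrow> ('f \<Rightarrow> 'f) \<Rightarrow> ('p, 'e::euclidean_space) mfd \<Rightarrow> ('q, 'f::euclidean_space) mfd
      \<Rightarrow> ('p \<Rightarrow> 'q) \<Rightarrow> bool" where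
  "holomorphic_map J J' M M' F \<longleftrightarrow> smooth_map M M' F \<and>
     (\<forall>c\<in>charts M. \<forall>c'\<in>charts M'. \<forall>u\<in>coord_dom c c' F. \<forall>\<xi>.
        frechet_derivative (coord_rep c c' F) (at u) (J \<xi>) =
        J' (frechet_derivative (coord_rep c c' F) (at u) \<xi>))"

subsection \<open>Tangent vectors\<close>

text \<open>A tangent vector at \<open>p\<close> is represented by the directional derivative it induces on
  the real functions that are differentiable at \<open>p\<close> (with value 0 on all other functions).
  The vector space operations are therefore the pointwise ones.\<close>

type_synonym 'p tvec = "('p \<Rightarrow> real) \<Rightarrow> real"

definition mdifferentiable_at :: "('p, 'e::euclidean_space) mfd \<Rightarrow> 'p \<Rightarrow> ('p \<Rightarrow> real) \<Rightarrow> bool" where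
  "mdifferentiable_at M p f \<longleftrightarrow>
     (\<forall>c\<in>charts M. p \<in> fst c \<longrightarrow> (f \<circ> chart_inv c) differentiable (at (snd c p)))"

definition tangent :: "('p, 'e::euclidean_space) mfd \<Rightarrow> ('p, 'e) chart \<Rightarrow> 'p \<Rightarrow> 'e \<Rightarrow> 'p tvec" where
  "tangent M c p \<xi> = (\<lambda>f. if mdifferentiable_at M p f
     then frechet_derivative (f \<circ> chart_inv c) (at (snd c p)) \<xi> else 0)"

definition tangent_space :: "('p, 'e::euclidean_space) mfd \<Rightarrow> 'p \<Rightarrow> 'p tvec set" where
  "tangent_space M p = {tangent M c p \<xi> |c \<xi>. c \<in> charts M \<and> p \<in> fst c}"

text \<open>The differential at \<open>p\<close> of a map \<open>F\<close> into \<open>M'\<close>.\<close>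

definition differential ::
    "('q, 'f::euclidean_space) mfd \<Rightarrow> ('p \<Rightarrow> 'q) \<Rightarrow> 'p \<Rightarrow> 'p tvec \<Rightarrow> 'q tvec" where
  "differential M' F p v = (\<lambda>f. if mdifferentiable_at M' (F p) f then v (f \<circ> F) else 0)"

definition tplus :: "'p tvec \<Rightarrow> 'p tvec \<Rightarrow> 'p tvec" where
  "tplus v w = (\<lambda>f. v f + w f)"

definition tscale :: "real \<Rightarrow> 'p tvec \<Rightarrow> 'p tvec" where
  "tscale r v = (\<lambda>f. r * v f)"

abbreviation cI :: "complex^'m \<Rightarrow> complex^'m" where
  "cI \<xi> \<equiv> \<i> *s \<xi>"

definition imult :: "('p, complex^'m) mfd \<Rightarrow> 'p \<Rightarrow> 'p tvec \<Rightarrow> 'p tvec" where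
  "imult M p v = (THE w. \<exists>c\<in>charts M. \<exists>\<xi>. p \<in> fst c \<and> v = tangent M c p \<xi> \<and> w = tangent M c p (cI \<xi>))"

section \<open>Lie groups\<close>

record ('g, 'e) lie_grp = "'g monoid" +
  mfd :: "('g, 'e) mfd"

definition lie_group :: "('g, 'e::euclidean_space) lie_grp \<Rightarrow> bool" where
  "lie_group L \<longleftrightarrow> group L \<and> smooth_manifold (mfd L) \<and> topspace (mtop (mfd L)) = carrier L \<and>
     smooth_map (prod_mfd (mfd L) (mfd L)) (mfd L) (\<lambda>(x, y). x \<otimes>\<^bsub>L\<^esub> y) \<and>
     smooth_map (mfd L) (mfd L) (\<lambda>x. inv\<^bsub>L\<^esub> x)"

definition compact_lie_group :: "('g, 'e::euclidean_space) lie_grp \<Rightarrow> bool" where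
  "compact_lie_group L \<longleftrightarrow> lie_group L \<and> compact_space (mtop (mfd L))"

definition complex_lie_group :: "('g, complex^'m) lie_grp \<Rightarrow> bool" where
  "complex_lie_group L \<longleftrightarrow> lie_group L \<and> holomorphic_map cI cI (mfd L) (mfd L) (\<lambda>x. x) \<and>
     holomorphic_map (map_prod cI cI) cI (prod_mfd (mfd L) (mfd L)) (mfd L) (\<lambda>(x, y). x \<otimes>\<^bsub>L\<^esub> y) \<and>
     holomorphic_map cI cI (mfd L) (mfd L) (\<lambda>x. inv\<^bsub>L\<^esub> x)"

definition lie_algebra :: "('g, 'e::euclidean_space) lie_grp \<Rightarrow> 'g tvec set" where
  "lie_algebra L = tangent_space (mfd L) \<one>\<^bsub>L\<^esub>"

definition one_parameter_subgroup ::
    "('g, 'e::euclidean_space) lie_grp \<Rightarrow> 'g tvec \<Rightarrow> (real \<Rightarrow> 'g) \<Rightarrow> bool" where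
  "one_parameter_subgroup L v \<gamma> \<longleftrightarrow> smooth_map real_mfd (mfd L) \<gamma> \<and>
     (\<forall>s t. \<gamma> (s + t) = \<gamma> s \<otimes>\<^bsub>L\<^esub> \<gamma> t) \<and> differential (mfd L) \<gamma> 0 (\<lambda>h. deriv h 0) = v"

definition lie_exp :: "('g, 'e::euclidean_space) lie_grp \<Rightarrow> 'g tvec \<Rightarrow> 'g" where
  "lie_exp L v = (THE g. \<exists>\<gamma>. one_parameter_subgroup L v \<gamma> \<and> g = \<gamma> 1)"

text \<open>The differential at the identity of the right translation by \<open>U\<close>.\<close>

definition dR :: "('g, 'e::euclidean_space) lie_grp \<Rightarrow> 'g \<Rightarrow> 'g tvec \<Rightarrow> 'g tvec" where
  "dR L U v = differential (mfd L) (\<lambda>h. h \<otimes>\<^bsub>L\<^esub> U) \<one>\<^bsub>L\<^esub> v"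

subsection \<open>Bi-invariant metrics\<close>

type_synonym 'p metric = "'p \<Rightarrow> 'p tvec \<Rightarrow> 'p tvec \<Rightarrow> real"

definition riemannian_metric :: "('p, 'e::euclidean_space) mfd \<Rightarrow> 'p metric \<Rightarrow> bool" where
  "riemannian_metric M \<kappa> \<longleftrightarrow>
     (\<forall>p\<in>topspace (mtop M). \<forall>u\<in>tangent_space M p. \<forall>v\<in>tangent_space M p.
        \<kappa> p u v = \<kappa> p v u \<and>
        (\<forall>w\<in>tangent_space M p. \<forall>r s.
           \<kappa> p (tplus (tscale r u) (tscale s v)) w = r * \<kappa> p u w + s * \<kappa> p v w) \<and>
        (u \<noteq> (\<lambda>f. 0) \<longrightarrow> \<kappa> p u u > 0)) \<and>
     (\<forall>c\<in>charts M. \<forall>\<xi> \<eta>. smooth_on (snd c ` fst c)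
        (\<lambda>z. let p = chart_inv c z in \<kappa> p (tangent M c p \<xi>) (tangent M c p \<eta>)))"

definition bi_invariant_metric :: "('g, 'e::euclidean_space) lie_grp \<Rightarrow> 'g metric \<Rightarrow> bool" where
  "bi_invariant_metric L \<kappa> \<longleftrightarrow> riemannian_metric (mfd L) \<kappa> \<and>
     (\<forall>g\<in>carrier L. \<forall>p\<in>carrier L. \<forall>u\<in>tangent_space (mfd L) p. \<forall>v\<in>tangent_space (mfd L) p.
        \<kappa> (g \<otimes>\<^bsub>L\<^esub> p) (differential (mfd L) (\<lambda>h. g \<otimes>\<^bsub>L\<^esub> h) p u)
                    (differential (mfd L) (\<lambda>h. g \<otimes>\<^bsub>L\<^esub> h) p v) = \<kappa> p u v \<and>
        \<kappa> (p \<otimes>\<^bsub>L\<^esub> g) (differential (mfd L) (\<lambda>h. h \<otimes>\<^bsub>L\<^esub> g) p u)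
                    (differential (mfd L) (\<lambda>h. h \<otimes>\<^bsub>L\<^esub> g) p v) = \<kappa> p u v)"

text \<open>An orthonormal basis indexed by \<open>'m\<close> of the Lie algebra of a group modelled on
  \<open>real^'m\<close>.\<close>

definition orthonormal_lie_basis :: "('g, real^'m) lie_grp \<Rightarrow> 'g metric \<Rightarrow> ('m \<Rightarrow> 'g tvec) \<Rightarrow> bool" where
  "orthonormal_lie_basis L \<kappa> X \<longleftrightarrow>
     (\<forall>a. X a \<in> lie_algebra L) \<and>
     (\<forall>a b. \<kappa> \<one>\<^bsub>L\<^esub> (X a) (X b) = (if a = b then 1 else 0)) \<and>
     (\<forall>v\<in>lie_algebra L. \<exists>r. v = (\<lambda>f. \<Sum>a\<in>UNIV. r a * X a f))"

subsection \<open>Complexification\<close>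

text \<open>\<open>G\<close> is a subset of \<open>GC\<close>; \<open>lie_incl\<close> is the differential of the inclusion at the
  identity, i.e. the embedding of the Lie algebra of \<open>G\<close> into that of \<open>GC\<close>.\<close>

definition lie_incl :: "('g, real^'m) lie_grp \<Rightarrow> ('g, complex^'m) lie_grp \<Rightarrow> 'g tvec \<Rightarrow> 'g tvec" where
  "lie_incl G GC v = differential (mfd GC) (\<lambda>x. x) \<one>\<^bsub>G\<^esub> v"

definition lie_I :: "('g, real^'m) lie_grp \<Rightarrow> ('g, complex^'m) lie_grp \<Rightarrow> 'g tvec \<Rightarrow> 'g tvec" where
  "lie_I G GC v = imult (mfd GC) \<one>\<^bsub>GC\<^esub> (lie_incl G GC v)"

definition i_lie_algebra :: "('g, real^'m) lie_grp \<Rightarrow> ('g, complex^'m) lie_grp \<Rightarrow> 'g tvec set" where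
  "i_lie_algebra G GC = lie_I G GC ` lie_algebra G"

definition complexification :: "('g, real^'m) lie_grp \<Rightarrow> ('g, complex^'m) lie_grp \<Rightarrow> bool" where
  "complexification G GC \<longleftrightarrow> complex_lie_group GC \<and> subgroup (carrier G) GC \<and>
     (\<forall>x\<in>carrier G. \<forall>y\<in>carrier G. x \<otimes>\<^bsub>G\<^esub> y = x \<otimes>\<^bsub>GC\<^esub> y) \<and>
     smooth_map (mfd G) (mfd GC) (\<lambda>x. x) \<and>
     bij_betw (\<lambda>(X, X'). tplus (lie_incl G GC X) (lie_I G GC X'))
       (lie_algebra G \<times> lie_algebra G) (lie_algebra GC) \<and>
     bij_betw (\<lambda>(V, Y). V \<otimes>\<^bsub>GC\<^esub> lie_exp GC Y) (carrier G \<times> i_lie_algebra G GC) (carrier GC)"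

definition polar_part :: "('g, real^'m) lie_grp \<Rightarrow> ('g, complex^'m) lie_grp \<Rightarrow> 'g \<Rightarrow> 'g tvec" where
  "polar_part G GC U =
     (THE Y. Y \<in> i_lie_algebra G GC \<and> (\<exists>V\<in>carrier G. U = V \<otimes>\<^bsub>GC\<^esub> lie_exp GC Y))"

text \<open>The extension of the inner product on the Lie algebra of \<open>G\<close> to that of \<open>GC\<close>.\<close>

definition complexified_inner ::
    "('g, real^'m) lie_grp \<Rightarrow> ('g, complex^'m) lie_grp \<Rightarrow> 'g metric \<Rightarrow> 'g tvec \<Rightarrow> 'g tvec \<Rightarrow> real" where
  "complexified_inner G GC \<kappa> v w = (THE r. \<exists>X1\<in>lie_algebra G. \<exists>X1'\<in>lie_algebra G.
     \<exists>X2\<in>lie_algebra G. \<exists>X2'\<in>lie_algebra G.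
       v = tplus (lie_incl G GC X1) (lie_I G GC X1') \<and>
       w = tplus (lie_incl G GC X2) (lie_I G GC X2') \<and>
       r = \<kappa> \<one>\<^bsub>G\<^esub> X1 X2 + \<kappa> \<one>\<^bsub>G\<^esub> X1' X2')"

section \<open>Lattice gauge fields\<close>

text \<open>The lattice has directions \<open>0, \<dots>, d\<close>; a site is represented by the reduced residues of
  its coordinates.\<close>

type_synonym site = "nat \<Rightarrow> nat"
type_synonym link = "site \<times> nat"
type_synonym 'g field = "link \<Rightarrow> 'g"

definition sites :: "nat \<Rightarrow> (nat \<Rightarrow> nat) \<Rightarrow> site set" where
  "sites d N = (\<Pi>\<^sub>E \<mu>\<in>{..d}. {..<N \<mu>})"

definition links :: "nat \<Rightarrow> (nat \<Rightarrow> nat) \<Rightarrow> link set" where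
  "links d N = sites d N \<times> {..d}"

definition shift :: "(nat \<Rightarrow> nat) \<Rightarrow> site \<Rightarrow> nat \<Rightarrow> site" where
  "shift N x \<mu> = x(\<mu> := (x \<mu> + 1) mod N \<mu>)"

definition fields :: "nat \<Rightarrow> (nat \<Rightarrow> nat) \<Rightarrow> ('g, 'e) lie_grp \<Rightarrow> 'g field set" where
  "fields d N L = (\<Pi>\<^sub>E l\<in>links d N. carrier L)"

definition gauge_transform ::
    "nat \<Rightarrow> (nat \<Rightarrow> nat) \<Rightarrow> ('g, 'e) lie_grp \<Rightarrow> (site \<Rightarrow> 'g) \<Rightarrow> 'g field \<Rightarrow> 'g field" where
  "gauge_transform d N L g U =
     (\<lambda>(x, \<mu>)\<in>links d N. inv\<^bsub>L\<^esub> (g x) \<otimes>\<^bsub>L\<^esub> U (x, \<mu>) \<otimes>\<^bsub>L\<^esub> g (shift N x \<mu>))"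

definition gauge_invariant ::
    "nat \<Rightarrow> (nat \<Rightarrow> nat) \<Rightarrow> ('g, 'e) lie_grp \<Rightarrow> ('g field \<Rightarrow> complex) \<Rightarrow> bool" where
  "gauge_invariant d N L S \<longleftrightarrow>
     (\<forall>U\<in>fields d N L. \<forall>g\<in>sites d N \<rightarrow> carrier L. S (gauge_transform d N L g U) = S U)"

text \<open>Holomorphy on the product of the copies of \<open>GC\<close> over all links: at every field, in
  any choice of a chart for each link, \<open>S\<close> has a total (Frechet) derivative that is
  complex linear. It is spelled out because the number of factors is not fixed by a type.\<close>

definition holomorphic_action ::
    "nat \<Rightarrow> (nat \<Rightarrow> nat) \<Rightarrow> ('g, complex^'m) lie_grp \<Rightarrow> ('g field \<Rightarrow> complex) \<Rightarrow> bool" where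
  "holomorphic_action d N GC S \<longleftrightarrow>
     (\<forall>U\<in>fields d N GC. \<forall>c. (\<forall>l\<in>links d N. c l \<in> charts (mfd GC) \<and> U l \<in> fst (c l)) \<longrightarrow>
       (\<exists>D. (\<forall>l\<in>links d N. Vector_Spaces.linear (*s) (*) (D l)) \<and>
         (\<forall>\<epsilon>>0. \<exists>\<delta>>0. \<forall>U'\<in>fields d N GC.
            (\<forall>l\<in>links d N. U' l \<in> fst (c l) \<and> norm (snd (c l) (U' l) - snd (c l) (U l)) < \<delta>) \<longrightarrow>
            norm (S U' - S U - (\<Sum>l\<in>links d N. D l (snd (c l) (U' l) - snd (c l) (U l))))
              \<le> \<epsilon> * (\<Sum>l\<in>links d N. norm (snd (c l) (U' l) - snd (c l) (U l))))))"

definition dist_fun ::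
    "nat \<Rightarrow> (nat \<Rightarrow> nat) \<Rightarrow> ('g, real^'m) lie_grp \<Rightarrow> ('g, complex^'m) lie_grp \<Rightarrow> 'g metric
      \<Rightarrow> 'g field \<Rightarrow> real" where
  "dist_fun d N G GC \<kappa> U = 1/2 * (\<Sum>x\<in>sites d N. \<Sum>\<mu>=0..d.
     complexified_inner G GC \<kappa> (polar_part G GC (U (x, \<mu>))) (polar_part G GC (U (x, \<mu>))))"

definition gauge_minimal ::
    "nat \<Rightarrow> (nat \<Rightarrow> nat) \<Rightarrow> ('g, real^'m) lie_grp \<Rightarrow> ('g, complex^'m) lie_grp \<Rightarrow> 'g metric
      \<Rightarrow> 'g field set" where
  "gauge_minimal d N G GC \<kappa> = {U \<in> fields d N GC. \<forall>g\<in>sites d N \<rightarrow> carrier GC.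
     dist_fun d N G GC \<kappa> U \<le> dist_fun d N G GC \<kappa> (gauge_transform d N GC g U)}"

text \<open>The Lie derivative of \<open>h\<close> with respect to the link variable \<open>l\<close> along the
  right-invariant vector field whose value at the identity is \<open>v\<close>.\<close>

definition lie_deriv ::
    "('g, 'e::euclidean_space) lie_grp \<Rightarrow> 'g tvec \<Rightarrow> link \<Rightarrow> ('g field \<Rightarrow> real) \<Rightarrow> 'g field \<Rightarrow> real" where
  "lie_deriv L v l h U = dR L (U l) v (\<lambda>W. h (U(l := W)))"

definition drift_K ::
    "('g, real^'m) lie_grp \<Rightarrow> ('g, complex^'m) lie_grp \<Rightarrow> ('g field \<Rightarrow> complex) \<Rightarrow> ('m \<Rightarrow> 'g tvec)
      \<Rightarrow> 'm \<Rightarrow> link \<Rightarrow> 'g field \<Rightarrow> real" where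
  "drift_K G GC S X a l U = - lie_deriv GC (lie_incl G GC (X a)) l (\<lambda>U. Re (S U)) U"

definition drift_J ::
    "('g, real^'m) lie_grp \<Rightarrow> ('g, complex^'m) lie_grp \<Rightarrow> ('g field \<Rightarrow> complex) \<Rightarrow> ('m \<Rightarrow> 'g tvec)
      \<Rightarrow> 'm \<Rightarrow> link \<Rightarrow> 'g field \<Rightarrow> real" where
  "drift_J G GC S X a l U = - lie_deriv GC (lie_incl G GC (X a)) l (\<lambda>U. Im (S U)) U"

section \<open>Stochastic differential equations\<close>

text \<open>A Brownian motion with respect to the filtration \<open>\<F>\<close>, normalized by
  \<open>(dw)\<^sup>2 = 2 dt\<close>: the increment over \<open>[s, t]\<close> has variance \<open>2 (t - s)\<close>.\<close>

definition brownian_motion ::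
    "'w measure \<Rightarrow> (real \<Rightarrow> 'w measure) \<Rightarrow> (real \<Rightarrow> 'w \<Rightarrow> real) \<Rightarrow> bool" where
  "brownian_motion P \<F> w \<longleftrightarrow>
     (\<forall>t\<ge>0. w t \<in> borel_measurable (\<F> t)) \<and> (AE \<omega> in P. w 0 \<omega> = 0) \<and>
     (\<forall>s t. 0 \<le> s \<and> s < t \<longrightarrow>
        distributed P lborel (\<lambda>\<omega>. w t \<omega> - w s \<omega>) (normal_density 0 (sqrt (2 * (t - s)))) \<and>
        prob_space.indep_set P (sets (\<F> s))
          (sets (vimage_algebra (space P) (\<lambda>\<omega>. w t \<omega> - w s \<omega>) borel))) \<and>
     (AE \<omega> in P. continuous_on {0..} (\<lambda>t. w t \<omega>))"

definition independent_processes ::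
    "'w measure \<Rightarrow> 'i set \<Rightarrow> ('i \<Rightarrow> real \<Rightarrow> 'w \<Rightarrow> real) \<Rightarrow> bool" where
  "independent_processes P I w \<longleftrightarrow> prob_space.indep_sets P
     (\<lambda>i. sigma_sets (space P) {w i t -` B \<inter> space P |t B. 0 \<le> t \<and> B \<in> sets borel}) I"

definition converges_in_probability :: "'w measure \<Rightarrow> (nat \<Rightarrow> 'w \<Rightarrow> real) \<Rightarrow> ('w \<Rightarrow> real) \<Rightarrow> bool" where
  "converges_in_probability P Z Z' \<longleftrightarrow>
     (\<forall>n. Z n \<in> borel_measurable P) \<and> Z' \<in> borel_measurable P \<and>
     (\<forall>\<epsilon>>0. (\<lambda>n. measure P {\<omega> \<in> space P. \<bar>Z n \<omega> - Z' \<omega>\<bar> > \<epsilon>}) \<longlonglongrightarrow> 0)"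

text \<open>Partitions \<open>0 = \<pi> n 0 \<le> \<dots> \<le> \<pi> n (k n) = t\<close> whose mesh tends to 0.\<close>

definition partition_seq :: "real \<Rightarrow> (nat \<Rightarrow> nat) \<Rightarrow> (nat \<Rightarrow> nat \<Rightarrow> real) \<Rightarrow> bool" where
  "partition_seq t k \<pi> \<longleftrightarrow>
     (\<forall>n. \<pi> n 0 = 0 \<and> \<pi> n (k n) = t \<and> (\<forall>i<k n. \<pi> n i \<le> \<pi> n (Suc i))) \<and>
     (\<forall>\<delta>>0. \<forall>\<^sub>F n in sequentially. \<forall>i<k n. \<pi> n (Suc i) - \<pi> n i < \<delta>)"

text \<open>\<open>I\<close> is the Stratonovich integral of \<open>H\<close> against \<open>w\<close> over \<open>[0, t]\<close>: the limit in
  probability of the trapezoidal sums.\<close>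

definition has_stratonovich_integral ::
    "'w measure \<Rightarrow> (real \<Rightarrow> 'w \<Rightarrow> real) \<Rightarrow> (real \<Rightarrow> 'w \<Rightarrow> real) \<Rightarrow> real \<Rightarrow> ('w \<Rightarrow> real) \<Rightarrow> bool" where
  "has_stratonovich_integral P H w t I \<longleftrightarrow> (\<forall>k \<pi>. partition_seq t k \<pi> \<longrightarrow>
     converges_in_probability P
       (\<lambda>n \<omega>. \<Sum>i<k n. (H (\<pi> n i) \<omega> + H (\<pi> n (Suc i)) \<omega>) / 2 * (w (\<pi> n (Suc i)) \<omega> - w (\<pi> n i) \<omega>)) I)"

text \<open>Solutions on the time interval \<open>[0, \<infinity>)\<close> of the complex Langevin equation. As usual for
  Stratonovich equations on manifolds, the equation for the link \<open>l\<close> is an identity of tangent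
  vectors at \<open>U\<^sub>l\<close> and means the corresponding integral equation for \<open>f(U\<^sub>l)\<close>, for every smooth
  real function \<open>f\<close>.\<close>

definition langevin_solution ::
    "nat \<Rightarrow> (nat \<Rightarrow> nat) \<Rightarrow> ('g, real^'m) lie_grp \<Rightarrow> ('g, complex^'m) lie_grp \<Rightarrow> ('m \<Rightarrow> 'g tvec)
      \<Rightarrow> ('g field \<Rightarrow> complex) \<Rightarrow> 'w measure \<Rightarrow> (real \<Rightarrow> 'w measure) \<Rightarrow> (link \<Rightarrow> 'm \<Rightarrow> real \<Rightarrow> 'w \<Rightarrow> real)
      \<Rightarrow> (real \<Rightarrow> 'w \<Rightarrow> 'g field) \<Rightarrow> bool" where
  "langevin_solution d N G GC X S P \<F> w U \<longleftrightarrow>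
     (\<forall>t\<ge>0. \<forall>\<omega>\<in>space P. U t \<omega> \<in> fields d N GC) \<and>
     (\<forall>t\<ge>0. \<forall>l\<in>links d N. \<forall>W. openin (mtop (mfd GC)) W \<longrightarrow>
        {\<omega> \<in> space P. U t \<omega> l \<in> W} \<in> sets (\<F> t)) \<and>
     (AE \<omega> in P. \<forall>l\<in>links d N. continuous_map (top_of_set {0..}) (mtop (mfd GC)) (\<lambda>t. U t \<omega> l)) \<and>
     (\<forall>l\<in>links d N. \<forall>f. smooth_map (mfd GC) real_mfd f \<longrightarrow> (\<forall>t\<ge>0. \<exists>I.
        (\<forall>a. has_stratonovich_integral P
           (\<lambda>s \<omega>. dR GC (U s \<omega> l) (lie_incl G GC (X a)) f) (w l a) t (I a)) \<and>
        (AE \<omega> in P. let b = (\<lambda>s. \<Sum>a\<in>UNIV.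
             drift_K G GC S X a l (U s \<omega>) * dR GC (U s \<omega> l) (lie_incl G GC (X a)) f +
             drift_J G GC S X a l (U s \<omega>) * dR GC (U s \<omega> l) (lie_I G GC (X a)) f) in
           set_integrable lborel {0..t} b \<and>
           f (U t \<omega> l) - f (U 0 \<omega> l) = (LINT s:{0..t}|lborel. b s) + (\<Sum>a\<in>UNIV. I a \<omega>))))"

end

theory Submission
  imports Defs
begin

text \<open>Since \<open>G\<close> is Abelian, so is \<open>GC\<close>: conjugation acts complex linearly on the Lie algebra of \<open>GC\<close>.
  Hence the polar part is a homomorphism \<open>y\<close> from \<open>GC\<close> to a vector space. It is smooth, it vanishes on
  \<open>G\<close>, and gauge transformations act on \<open>y(U)\<close> by adding a lattice gradient. So the distance function
  is a convex quadratic function on every gauge orbit, and a field is minimal if and only if \<open>y(U)\<close>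
  has vanishing lattice divergence. Along a solution only the drift \<open>J\<close> changes \<open>y(U)\<close>, and gauge
  invariance of \<open>Im S\<close> says that \<open>J\<close> has vanishing divergence. The divergence of \<open>y(U)\<close> is therefore
  conserved.\<close>

section \<open>Calculus of \<open>C\<^sup>k\<close> maps\<close>

text \<open>Solutions are tested only against smooth scalar functions, so the components of
  \<open>y\<close> have to be shown smooth on \<open>GC\<close>; but \<open>complexification\<close>
  supplies a mere bijection as polar map, and exponentials only through a definite description. The
  repair is algebraic. Homomorphisms are rigid: a derivative at the identity controls them
  everywhere by translation, so neither flows of vector fields nor regularity of the inverse polar
  map away from the identity have to be studied. Commutativity of \<open>GC\<close> must come early,
  since it is what makes \<open>y\<close> additive. The components of \<open>y\<close> serve as test
  functions because their derivatives along right-invariant fields are constants, 0 for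
  \<open>X^b\<close> and a Kronecker delta for \<open>Y^b\<close>; every Stratonovich integrand is
  then identically 0. What remains is an integral identity that holds almost surely for each fixed
  time; the exceptional sets are united over rational times, and path continuity supplies the other
  times.\<close>

lemma has_derivative_cong_open:
  assumes "open S" "x \<in> S" "\<And>y. y \<in> S \<Longrightarrow> f y = g y"
  shows "(f has_derivative f') (at x) \<longleftrightarrow> (g has_derivative f') (at x)"
  using has_derivative_transform_within_open[OF _ assms(1,2), of f f' UNIV g]
    has_derivative_transform_within_open[OF _ assms(1,2), of g f' UNIV f] assms(3)
  by auto

lemma frechet_derivative_cong_open:
  assumes "open S" "x \<in> S" "\<And>y. y \<in> S \<Longrightarrow> f y = g y"
  shows "frechet_derivative f (at x) = frechet_derivative g (at x)"
  unfolding frechet_derivative_def using has_derivative_cong_open[OF assms] by simp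

lemma differentiable_cong_open:
  assumes "open S" "x \<in> S" "\<And>y. y \<in> S \<Longrightarrow> f y = g y"
  shows "f differentiable (at x) \<longleftrightarrow> g differentiable (at x)"
  unfolding differentiable_def using has_derivative_cong_open[OF assms] by simp

lemma frechet_derivative_eq:
  "(f has_derivative f') (at x) \<Longrightarrow> frechet_derivative f (at x) = f'"
  by (metis frechet_derivative_at)

lemma Ck_on_cong:
  assumes "open S" "\<And>x. x \<in> S \<Longrightarrow> f x = g x"
  shows "Ck_on k S f \<longleftrightarrow> Ck_on k S g"
  using assms(2)
proof (induction k arbitrary: f g)
  case 0
  then show ?case by (simp cong: continuous_on_cong)
next
  case (Suc k)
  have "Ck_on k S (\<lambda>x. frechet_derivative f (at x) v) \<longleftrightarrow> Ck_on k S (\<lambda>x. frechet_derivative g (at x) v)" for v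
    by (intro Suc.IH frechet_derivative_cong_open[OF assms(1), THEN fun_cong] Suc.prems)
  moreover have "f differentiable (at x) \<longleftrightarrow> g differentiable (at x)" if "x \<in> S" for x
    using differentiable_cong_open[OF assms(1) that] Suc.prems by blast
  ultimately show ?case by simp
qed

lemma Ck_on_Suc_imp: "Ck_on (Suc k) S f \<Longrightarrow> Ck_on k S f"
proof (induction k arbitrary: f)
  case 0
  then show ?case
    by (auto intro!: continuous_at_imp_continuous_on differentiable_imp_continuous_within)
next
  case (Suc k)
  then show ?case by (metis Ck_on.simps(2))
qed

text \<open>Allows an explicit derivative formula in place of \<open>frechet_derivative\<close>.
  Openness of \<open>S\<close> matters: the two agree only on \<open>S\<close>, and higher
  derivatives look at neighbourhoods.\<close>

lemma Ck_on_SucI: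
  assumes "open S" "\<And>x. x \<in> S \<Longrightarrow> (f has_derivative f' x) (at x)"
    and "\<And>v. Ck_on k S (\<lambda>x. f' x v)"
  shows "Ck_on (Suc k) S f"
proof -
  have "Ck_on k S (\<lambda>x. frechet_derivative f (at x) v)" for v
    by (rule Ck_on_cong[OF assms(1), THEN iffD2, OF _ assms(3)])
      (simp add: frechet_derivative_eq[OF assms(2)])
  then show ?thesis
    using assms(2) by (auto simp: differentiable_def)
qed

lemma Ck_on_SucD:
  assumes "Ck_on (Suc k) S f" "x \<in> S"
  shows "(f has_derivative frechet_derivative f (at x)) (at x)"
  using assms by (auto simp: frechet_derivative_works)

text \<open>Needed because the derivative of the polar coordinates is given by a formula that
  depends on the choice of charts and is valid only locally.\<close>

lemma Ck_on_local:
  assumes "\<And>x. x \<in> S \<Longrightarrow> \<exists>T. open T \<and> x \<in> T \<and> Ck_on k T f"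
  shows "Ck_on k S f"
  using assms
proof (induction k arbitrary: f)
  case 0
  then have "isCont f x" if "x \<in> S" for x
    using that by (metis Ck_on.simps(1) continuous_on_eq_continuous_at)
  then show ?case
    by (simp add: continuous_at_imp_continuous_on)
next
  case (Suc k)
  have "f differentiable (at x)" if "x \<in> S" for x
    using Suc.prems[OF that] by auto
  moreover have "Ck_on k S (\<lambda>x. frechet_derivative f (at x) v)" for v
  proof (rule Suc.IH)
    fix x assume "x \<in> S"
    from Suc.prems[OF this] obtain T where "open T" "x \<in> T" "Ck_on (Suc k) T f" by blast
    then show "\<exists>T. open T \<and> x \<in> T \<and> Ck_on k T (\<lambda>x. frechet_derivative f (at x) v)"
      by auto
  qed
  ultimately show ?case by simp
qed

lemma Ck_on_const: "open S \<Longrightarrow> Ck_on k S (\<lambda>x. c)"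
  by (induction k arbitrary: c) (auto intro!: Ck_on_SucI[where f' = "\<lambda>x v. 0"])

lemma Ck_on_linear:
  assumes "open S" "bounded_linear f"
  shows "Ck_on k S f"
proof (cases k)
  case 0
  then show ?thesis using assms by (simp add: linear_continuous_on)
next
  case (Suc j)
  then show ?thesis
    using assms by (auto intro!: Ck_on_SucI[where f' = "\<lambda>x. f"] Ck_on_const bounded_linear_imp_has_derivative
        simp del: Ck_on.simps)
qed

lemma Ck_on_add:
  assumes "open S" "Ck_on k S f" "Ck_on k S g"
  shows "Ck_on k S (\<lambda>x. f x + g x)"
  using assms(2,3)
proof (induction k arbitrary: f g)
  case 0
  then show ?case by (simp add: continuous_on_add)
next
  case (Suc k)
  show ?case
  proof (rule Ck_on_SucI[OF assms(1)])
    show "((\<lambda>x. f x + g x) has_derivative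
        (\<lambda>v. frechet_derivative f (at x) v + frechet_derivative g (at x) v)) (at x)" if "x \<in> S" for x
      by (intro has_derivative_add Ck_on_SucD[OF Suc.prems(1) that] Ck_on_SucD[OF Suc.prems(2) that])
    show "Ck_on k S (\<lambda>x. frechet_derivative f (at x) v + frechet_derivative g (at x) v)" for v
      using Suc.prems by (intro Suc.IH) auto
  qed
qed

lemma Ck_on_sum:
  assumes "open S" "\<And>i. i \<in> I \<Longrightarrow> Ck_on k S (f i)"
  shows "Ck_on k S (\<lambda>x. \<Sum>i\<in>I. f i x)"
  using assms(2) by (induction I rule: infinite_finite_induct) (auto intro!: Ck_on_const Ck_on_add assms(1))

lemma Ck_on_scaleR:
  assumes "open S" "Ck_on k S r" "Ck_on k S f"
  shows "Ck_on k S (\<lambda>x. r x *\<^sub>R f x)"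
  using assms(2,3)
proof (induction k arbitrary: r f)
  case 0
  then show ?case by (simp add: continuous_on_scaleR)
next
  case (Suc k)
  show ?case
  proof (rule Ck_on_SucI[OF assms(1)])
    show "((\<lambda>x. r x *\<^sub>R f x) has_derivative
        (\<lambda>v. r x *\<^sub>R frechet_derivative f (at x) v + frechet_derivative r (at x) v *\<^sub>R f x)) (at x)"
      if "x \<in> S" for x
      by (intro has_derivative_scaleR Ck_on_SucD[OF Suc.prems(1) that] Ck_on_SucD[OF Suc.prems(2) that])
    show "Ck_on k S (\<lambda>x. r x *\<^sub>R frechet_derivative f (at x) v + frechet_derivative r (at x) v *\<^sub>R f x)" for v
      using Suc.prems Suc.prems[THEN Ck_on_Suc_imp] by (intro Ck_on_add assms(1) Suc.IH) auto
  qed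
qed

lemma Ck_on_bounded_linear_compose:
  assumes "open S" "bounded_linear L" "Ck_on k S f"
  shows "Ck_on k S (\<lambda>x. L (f x))"
  using assms(3)
proof (induction k arbitrary: f)
  case 0
  then show ?case by (simp add: bounded_linear.continuous_on[OF assms(2)])
next
  case (Suc k)
  show ?case
  proof (rule Ck_on_SucI[OF assms(1)])
    show "((\<lambda>x. L (f x)) has_derivative (\<lambda>v. L (frechet_derivative f (at x) v))) (at x)"
      if "x \<in> S" for x
      by (intro bounded_linear.has_derivative[OF assms(2)] Ck_on_SucD[OF Suc.prems that])
    show "Ck_on k S (\<lambda>x. L (frechet_derivative f (at x) v))" for v
      using Suc.prems by (intro Suc.IH) auto
  qed
qed

lemma Ck_on_Pair:
  assumes "open S" "Ck_on k S f" "Ck_on k S g"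
  shows "Ck_on k S (\<lambda>x. (f x, g x))"
proof -
  have "Ck_on k S (\<lambda>x. (f x, 0) + (0, g x))"
  proof (intro Ck_on_add assms(1))
    show "Ck_on k S (\<lambda>x. (f x, 0))"
      by (rule Ck_on_bounded_linear_compose[OF assms(1) _ assms(2), where L = "\<lambda>y. (y, 0)"])
        (intro bounded_linear_intros bounded_linear_Pair bounded_linear_ident bounded_linear_zero)
    show "Ck_on k S (\<lambda>x. (0, g x))"
      by (rule Ck_on_bounded_linear_compose[OF assms(1) _ assms(3), where L = "\<lambda>y. (0, y)"])
        (intro bounded_linear_intros bounded_linear_Pair bounded_linear_ident bounded_linear_zero)
  qed
  then show ?thesis by simp
qed

text \<open>In the chain rule the direction fed to the derivative of \<open>f\<close> moves with
  \<open>x\<close>, while \<open>Ck_on\<close> controls fixed directions only. Expanding the moving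
  direction in \<open>Basis\<close> leaves finitely many fixed ones; hence the Euclidean middle
  space.\<close>

lemma Ck_on_compose:
  fixes f :: "'b::euclidean_space \<Rightarrow> 'c::real_normed_vector" and g :: "'a::real_normed_vector \<Rightarrow> 'b"
  assumes S: "open S" and T: "g ` S \<subseteq> T" and "Ck_on k T f" "Ck_on k S g"
  shows "Ck_on k S (\<lambda>x. f (g x))"
  using assms(3,4)
proof (induction k arbitrary: f)
  case 0
  then show ?case using T by (auto intro: continuous_on_compose2)
next
  case (Suc k)
  define f' where "f' x = frechet_derivative f (at x)" for x
  define g' where "g' x = frechet_derivative g (at x)" for x
  have f': "(f has_derivative f' (g x)) (at (g x))" and g': "(g has_derivative g' x) (at x)" if "x \<in> S" for x
    unfolding f'_def g'_def using that T by (auto intro!: Ck_on_SucD Suc.prems)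
  have lin: "f' (g x) v = (\<Sum>i\<in>Basis. (v \<bullet> i) *\<^sub>R f' (g x) i)" if "x \<in> S" for x v
    using linear_sum[OF has_derivative_linear[OF f'[OF that]], of "\<lambda>i. (v \<bullet> i) *\<^sub>R i" Basis]
      linear_cmul[OF has_derivative_linear[OF f'[OF that]]]
    by (simp add: euclidean_representation)
  show ?case
  proof (rule Ck_on_SucI[OF S])
    show "((\<lambda>x. f (g x)) has_derivative (\<lambda>v. \<Sum>i\<in>Basis. (g' x v \<bullet> i) *\<^sub>R f' (g x) i)) (at x)"
      if "x \<in> S" for x
    proof -
      have "(\<lambda>v. f' (g x) (g' x v)) = (\<lambda>v. \<Sum>i\<in>Basis. (g' x v \<bullet> i) *\<^sub>R f' (g x) i)"
        by (rule ext, rule lin[OF that])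
      then show ?thesis
        using has_derivative_compose[OF g' f', OF that that] by simp
    qed
    show "Ck_on k S (\<lambda>x. \<Sum>i\<in>Basis. (g' x v \<bullet> i) *\<^sub>R f' (g x) i)" for v
    proof (intro Ck_on_sum Ck_on_scaleR S)
      fix i :: 'b
      show "Ck_on k S (\<lambda>x. g' x v \<bullet> i)"
        using Suc.prems(2)
        by (intro Ck_on_bounded_linear_compose[OF S bounded_linear_inner_left]) (simp add: g'_def)
      show "Ck_on k S (\<lambda>x. f' (g x) i)"
        using Suc.prems Suc.prems(2)[THEN Ck_on_Suc_imp] by (intro Suc.IH) (auto simp: f'_def)
    qed
  qed
qed

section \<open>Differentiation in charts\<close>

lemma has_derivative_cong_nhds:
  assumes "\<forall>\<^sub>F z in nhds x. f z = g z"
  shows "(f has_derivative f') (at x) \<longleftrightarrow> (g has_derivative f') (at x)"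
proof -
  obtain S where S: "open S" "x \<in> S" "\<And>z. z \<in> S \<Longrightarrow> f z = g z"
    using assms unfolding eventually_nhds by blast
  show ?thesis by (rule has_derivative_cong_open[OF S])
qed

lemma isCont_eventually_nhds:
  assumes "isCont f x" "open S" "f x \<in> S"
  shows "\<forall>\<^sub>F z in nhds x. f z \<in> S"
  using assms by (simp add: eventually_nhds_conv_at isCont_def topological_tendstoD)

lemma smooth_on_has_derivative:
  assumes "smooth_on S f" "x \<in> S"
  shows "(f has_derivative frechet_derivative f (at x)) (at x)"
  using assms Ck_on_SucD[of 0] unfolding smooth_on_def by blast

section \<open>Charts and their inverses\<close>

lemma chart_inv_snd:
  assumes "is_chart T c" "p \<in> fst c"
  shows "chart_inv c (snd c p) = p"
proof -
  have "homeomorphic_map (subtopology T (fst c)) (top_of_set (snd c ` fst c)) (snd c)" "openin T (fst c)"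
    using assms(1) by (auto simp: is_chart_def)
  then have "inj_on (snd c) (fst c)"
    by (auto simp: homeomorphic_map_def dest!: bijective_open_imp_homeomorphic_map
        homeomorphic_imp_injective_map[unfolded topspace_subtopology]
        simp: Int_absorb1 openin_subset)
  then show ?thesis
    using assms(2) by (simp add: chart_inv_def)
qed

lemma snd_chart_inv: "z \<in> snd c ` fst c \<Longrightarrow> snd c (chart_inv c z) = z"
  by (simp add: chart_inv_def f_inv_into_f)

lemma chart_inv_in: "z \<in> snd c ` fst c \<Longrightarrow> chart_inv c z \<in> fst c"
  by (simp add: chart_inv_def inv_into_into)

lemma open_chart_image: "is_chart T c \<Longrightarrow> open (snd c ` fst c)"
  by (simp add: is_chart_def)

lemma eventually_chart:
  assumes "is_chart T c" "p \<in> fst c"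
  shows "\<forall>\<^sub>F z in nhds (snd c p). z \<in> snd c ` fst c"
  using open_chart_image[OF assms(1)] assms(2) by (intro eventually_nhds_in_open) auto

lemma open_chart_image_Int:
  assumes "is_chart T c" "openin T W"
  shows "open (snd c ` (fst c \<inter> W))"
proof -
  have "open_map (subtopology T (fst c)) (top_of_set (snd c ` fst c)) (snd c)"
    using assms(1) by (simp add: is_chart_def homeomorphic_imp_open_map)
  moreover have "openin (subtopology T (fst c)) (fst c \<inter> W)"
    using assms(2) by (auto simp: openin_subtopology)
  ultimately have "openin (top_of_set (snd c ` fst c)) (snd c ` (fst c \<inter> W))"
    by (simp add: open_map_def)
  then show ?thesis
    using open_chart_image[OF assms(1)] by (simp add: openin_open_eq)
qed

lemma open_coord_dom:
  assumes "is_chart (mtop M) c" "is_chart (mtop M') c'" "continuous_map (mtop M) (mtop M') F"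
  shows "open (coord_dom c c' F)"
proof -
  have "fst c \<subseteq> topspace (mtop M)" "openin (mtop M') (fst c')"
    using assms(1,2) by (auto simp: is_chart_def dest: openin_subset)
  then have "fst c \<inter> F -` fst c' = fst c \<inter> {p \<in> topspace (mtop M). F p \<in> fst c'}"
    "openin (mtop M) {p \<in> topspace (mtop M). F p \<in> fst c'}"
    using assms(3) by (auto simp: continuous_map_def)
  then show ?thesis
    using open_chart_image_Int[OF assms(1)] by (simp add: coord_dom_def)
qed

lemma is_chart_prod:
  assumes "is_chart T c" "is_chart T' c'"
  shows "is_chart (prod_topology T T') (fst c \<times> fst c', map_prod (snd c) (snd c'))"
proof -
  have im: "map_prod (snd c) (snd c') ` (fst c \<times> fst c') = snd c ` fst c \<times> snd c' ` fst c'"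
    by auto
  obtain h h' where
    "homeomorphic_maps (subtopology T (fst c)) (top_of_set (snd c ` fst c)) (snd c) h"
    "homeomorphic_maps (subtopology T' (fst c')) (top_of_set (snd c' ` fst c')) (snd c') h'"
    using assms by (auto simp: is_chart_def homeomorphic_map_maps)
  then have "homeomorphic_maps (prod_topology (subtopology T (fst c)) (subtopology T' (fst c')))
      (prod_topology (top_of_set (snd c ` fst c)) (top_of_set (snd c' ` fst c')))
      (\<lambda>(x, y). (snd c x, snd c' y)) (\<lambda>(x, y). (h x, h' y))"
    by (simp only: homeomorphic_maps_prod simp_thms)
  then have "homeomorphic_map (subtopology (prod_topology T T') (fst c \<times> fst c'))
      (top_of_set (snd c ` fst c \<times> snd c' ` fst c')) (map_prod (snd c) (snd c'))"
    unfolding homeomorphic_map_maps map_prod_def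
    by (subst subtopology_Times) (auto intro!: exI)
  then show ?thesis
    using assms by (simp add: is_chart_def im openin_prod_Times_iff open_Times)
qed

lemma smooth_manifold_chart: "smooth_manifold M \<Longrightarrow> c \<in> charts M \<Longrightarrow> is_chart (mtop M) c"
  by (simp add: smooth_manifold_def)

lemma smooth_manifold_obtain_chart:
  assumes "smooth_manifold M" "p \<in> topspace (mtop M)"
  obtains c where "c \<in> charts M" "p \<in> fst c"
  using assms unfolding smooth_manifold_def by blast

lemma chart_in_topspace: "smooth_manifold M \<Longrightarrow> c \<in> charts M \<Longrightarrow> p \<in> fst c \<Longrightarrow> p \<in> topspace (mtop M)"
  by (auto simp: smooth_manifold_def)

text \<open>The condition on the chart domain, together with continuity of the coordinates, encodes
  continuity of \<open>H\<close> at \<open>x\<close>, so the topology of \<open>M\<close> need not be mentioned.\<close>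

definition has_mderiv ::
    "('p, 'e::euclidean_space) mfd \<Rightarrow> ('p, 'e) chart \<Rightarrow> ('a::real_normed_vector \<Rightarrow> 'p) \<Rightarrow> 'a \<Rightarrow> ('a \<Rightarrow> 'e) \<Rightarrow> bool" where
  "has_mderiv M c H x D \<longleftrightarrow> c \<in> charts M \<and> (\<forall>\<^sub>F z in nhds x. H z \<in> fst c) \<and>
     ((\<lambda>z. snd c (H z)) has_derivative D) (at x)"

section \<open>Calculus of manifold-valued maps\<close>

lemma has_mderiv_in: "has_mderiv M c H x D \<Longrightarrow> H x \<in> fst c"
  by (auto simp: has_mderiv_def dest: eventually_nhds_x_imp_x)

lemma has_mderiv_charts: "has_mderiv M c H x D \<Longrightarrow> c \<in> charts M"
  by (simp add: has_mderiv_def)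

lemma has_mderiv_cong:
  assumes "\<forall>\<^sub>F z in nhds x. H z = H' z"
  shows "has_mderiv M c H x D \<longleftrightarrow> has_mderiv M c H' x D"
proof -
  have "(\<forall>\<^sub>F z in nhds x. H z \<in> fst c) \<longleftrightarrow> (\<forall>\<^sub>F z in nhds x. H' z \<in> fst c)"
    by (rule eventually_cong[OF assms]) simp
  moreover have "((\<lambda>z. snd c (H z)) has_derivative D) (at x) \<longleftrightarrow> ((\<lambda>z. snd c (H' z)) has_derivative D) (at x)"
    by (rule has_derivative_cong_nhds, rule eventually_mono[OF assms]) simp
  ultimately show ?thesis
    by (simp add: has_mderiv_def)
qed

lemma has_mderiv_unique: "has_mderiv M c H x D \<Longrightarrow> has_mderiv M c H x D' \<Longrightarrow> D = D'"
  unfolding has_mderiv_def using has_derivative_unique by blast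

lemma has_mderiv_chart:
  assumes "is_chart (mtop M) c" "c \<in> charts M" "p \<in> fst c"
  shows "has_mderiv M c (chart_inv c) (snd c p) (\<lambda>\<xi>. \<xi>)"
proof -
  have ev: "\<forall>\<^sub>F z in nhds (snd c p). z \<in> snd c ` fst c"
    by (rule eventually_chart[OF assms(1,3)])
  have "\<forall>\<^sub>F z in nhds (snd c p). chart_inv c z \<in> fst c"
    using ev by eventually_elim (rule chart_inv_in)
  moreover have "\<forall>\<^sub>F z in nhds (snd c p). snd c (chart_inv c z) = z"
    using ev by eventually_elim (rule snd_chart_inv)
  ultimately show ?thesis
    using assms(2) by (simp add: has_mderiv_def has_derivative_cong_nhds)
qed

lemma manifold_chart:
  assumes "smooth_manifold M" "c \<in> charts M" "p \<in> fst c"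
  shows "chart_inv c (snd c p) = p" and "has_mderiv M c (chart_inv c) (snd c p) (\<lambda>\<xi>. \<xi>)"
  using assms by (auto intro!: chart_inv_snd has_mderiv_chart smooth_manifold_chart)

lemma has_mderiv_const: "c \<in> charts M \<Longrightarrow> p \<in> fst c \<Longrightarrow> has_mderiv M c (\<lambda>z. p) x (\<lambda>\<xi>. 0)"
  by (simp add: has_mderiv_def)

lemma has_mderiv_compose:
  assumes "has_mderiv M c H (g x) D" "(g has_derivative g') (at x)"
  shows "has_mderiv M c (\<lambda>z. H (g z)) x (\<lambda>\<xi>. D (g' \<xi>))"
proof -
  have "filterlim g (nhds (g x)) (nhds x)"
    using has_derivative_continuous[OF assms(2)]
    by (simp add: filterlim_iff eventually_nhds_conv_at isCont_def)
  then have "\<forall>\<^sub>F z in nhds x. H (g z) \<in> fst c"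
    using assms(1) unfolding has_mderiv_def filterlim_iff by blast
  then show ?thesis
    using assms has_derivative_compose[OF assms(2), of "\<lambda>z. snd c (H z)" D]
    by (simp add: has_mderiv_def)
qed

lemma has_mderiv_Pair:
  assumes "has_mderiv M c H x D" "has_mderiv M' c' H' x D'"
  shows "has_mderiv (prod_mfd M M') (fst c \<times> fst c', map_prod (snd c) (snd c'))
    (\<lambda>z. (H z, H' z)) x (\<lambda>\<xi>. (D \<xi>, D' \<xi>))"
proof -
  have "(fst c \<times> fst c', map_prod (snd c) (snd c')) \<in> charts (prod_mfd M M')"
    using assms unfolding prod_mfd_def has_mderiv_def mfd.simps by blast
  then show ?thesis
    using assms unfolding has_mderiv_def
    by (auto simp: eventually_conj_iff intro!: has_derivative_Pair)
qed

lemma coord_rep_has_derivative: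
  assumes "smooth_map M M' F" "c \<in> charts M" "c' \<in> charts M'" "is_chart (mtop M) c" "p \<in> fst c" "F p \<in> fst c'"
  shows "(coord_rep c c' F has_derivative frechet_derivative (coord_rep c c' F) (at (snd c p))) (at (snd c p))"
proof -
  have "snd c p \<in> coord_dom c c' F"
    using assms by (auto simp: coord_dom_def)
  then show ?thesis
    using assms smooth_on_has_derivative by (fastforce simp: smooth_map_def)
qed

text \<open>The ordinary chain rule, since near \<open>x\<close> the coordinates of
  \<open>F (H z)\<close> are \<open>coord_rep c c' F\<close> applied to those of
  \<open>H z\<close>.\<close>

lemma has_mderiv_map:
  assumes "is_chart (mtop M) c" "is_chart (mtop M') c'" "smooth_map M M' F"
    and H: "has_mderiv M c H x D" and "c' \<in> charts M'" "F (H x) \<in> fst c'"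
  shows "has_mderiv M' c' (\<lambda>z. F (H z)) x
    (\<lambda>\<xi>. frechet_derivative (coord_rep c c' F) (at (snd c (H x))) (D \<xi>))"
proof -
  have c: "c \<in> charts M" and Hx: "H x \<in> fst c" and ev: "\<forall>\<^sub>F z in nhds x. H z \<in> fst c"
    and der: "((\<lambda>z. snd c (H z)) has_derivative D) (at x)"
    using H has_mderiv_in[OF H] by (auto simp: has_mderiv_def)
  have op: "open (coord_dom c c' F)"
    using assms by (intro open_coord_dom) (auto simp: smooth_map_def)
  \<comment> \<open>Openness of \<open>coord_dom\<close> keeps \<open>F (H z)\<close> inside the
    target chart; injectivity of the chart then identifies \<open>H z\<close> with the point
    witnessing membership.\<close>
  have "\<forall>\<^sub>F z in nhds x. snd c (H z) \<in> coord_dom c c' F"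
    using has_derivative_continuous[OF der] op Hx assms(6)
    by (intro isCont_eventually_nhds) (auto simp: coord_dom_def)
  with ev have "\<forall>\<^sub>F z in nhds x. F (H z) \<in> fst c' \<and>
      coord_rep c c' F (snd c (H z)) = snd c' (F (H z))"
  proof eventually_elim
    case (elim z)
    then obtain q where "q \<in> fst c" "F q \<in> fst c'" "snd c (H z) = snd c q"
      by (auto simp: coord_dom_def)
    then have "H z = q"
      using elim chart_inv_snd[OF assms(1)] by metis
    then show ?case
      using \<open>F q \<in> fst c'\<close> elim chart_inv_snd[OF assms(1)] by (simp add: coord_rep_def)
  qed
  then have ev': "\<forall>\<^sub>F z in nhds x. F (H z) \<in> fst c'"
    "\<forall>\<^sub>F z in nhds x. coord_rep c c' F (snd c (H z)) = snd c' (F (H z))"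
    by (auto simp: eventually_conj_iff)
  have "((\<lambda>z. coord_rep c c' F (snd c (H z))) has_derivative
      (\<lambda>\<xi>. frechet_derivative (coord_rep c c' F) (at (snd c (H x))) (D \<xi>))) (at x)"
    using coord_rep_has_derivative[OF assms(3) c assms(5,1) Hx assms(6)]
    by (rule has_derivative_compose[OF der])
  then show ?thesis
    using ev' assms(5) by (simp add: has_mderiv_def has_derivative_cong_nhds)
qed

lemma has_mderiv_change:
  assumes "smooth_manifold M" "has_mderiv M c H x D" "c' \<in> charts M" "H x \<in> fst c'"
  shows "has_mderiv M c' H x (\<lambda>\<xi>. frechet_derivative (coord_rep c c' (\<lambda>p. p)) (at (snd c (H x))) (D \<xi>))"
  using assms has_mderiv_charts[OF assms(2)]
  by (intro has_mderiv_map[where F = "\<lambda>p. p"]) (auto simp: smooth_manifold_def)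

abbreviation prod_chart :: "('p, 'e) chart \<Rightarrow> ('q, 'f) chart \<Rightarrow> ('p \<times> 'q, 'e \<times> 'f) chart" where
  "prod_chart c c' \<equiv> (fst c \<times> fst c', map_prod (snd c) (snd c'))"

subsection \<open>Tangent vectors\<close>

lemma differentiable_chart_compose:
  assumes "is_chart (mtop M) c" "has_mderiv M c H x D" "(f \<circ> chart_inv c) differentiable (at (snd c (H x)))"
  shows "((\<lambda>z. f (H z)) has_derivative
    (\<lambda>\<xi>. frechet_derivative (f \<circ> chart_inv c) (at (snd c (H x))) (D \<xi>))) (at x)"
proof -
  have "((\<lambda>z. (f \<circ> chart_inv c) (snd c (H z))) has_derivative
      (\<lambda>\<xi>. frechet_derivative (f \<circ> chart_inv c) (at (snd c (H x))) (D \<xi>))) (at x)"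
    using has_derivative_compose[of "\<lambda>z. snd c (H z)" D x UNIV "f \<circ> chart_inv c"] assms(2,3)
    by (simp add: has_mderiv_def frechet_derivative_works)
  moreover have "\<forall>\<^sub>F z in nhds x. (f \<circ> chart_inv c) (snd c (H z)) = f (H z)"
    using assms(2) unfolding has_mderiv_def
    by (elim conjE eventually_mono) (simp add: chart_inv_snd[OF assms(1)])
  ultimately show ?thesis
    by (rule iffD1[OF has_derivative_cong_nhds, rotated])
qed

text \<open>Transition maps are differentiable, so the chain rule carries differentiability from one
  chart to every other.\<close>

lemma mdifferentiable_at_iff:
  assumes "smooth_manifold M" "c \<in> charts M" "p \<in> fst c"
  shows "mdifferentiable_at M p f \<longleftrightarrow> (f \<circ> chart_inv c) differentiable (at (snd c p))"
proof
  assume *: "(f \<circ> chart_inv c) differentiable (at (snd c p))"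
  show "mdifferentiable_at M p f"
    unfolding mdifferentiable_at_def
  proof (intro ballI impI)
    fix c' assume c': "c' \<in> charts M" "p \<in> fst c'"
    note p = manifold_chart(1)[OF assms(1) c'] and H = manifold_chart(2)[OF assms(1) c']
    obtain D where D: "has_mderiv M c (chart_inv c') (snd c' p) D"
      using has_mderiv_change[OF assms(1) H assms(2)] p assms(3) by auto
    show "(f \<circ> chart_inv c') differentiable (at (snd c' p))"
      using differentiable_chart_compose[OF smooth_manifold_chart[OF assms(1,2)] D, of f] * p
      by (auto simp: differentiable_def o_def)
  qed
qed (use assms in \<open>auto simp: mdifferentiable_at_def\<close>)

lemma tangent_apply:
  assumes "smooth_manifold M" "has_mderiv M c H x D" "mdifferentiable_at M (H x) f"
  shows "((\<lambda>z. f (H z)) has_derivative (\<lambda>\<xi>. tangent M c (H x) (D \<xi>) f)) (at x)"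
  using differentiable_chart_compose[OF smooth_manifold_chart[OF assms(1)] assms(2)] assms
    has_mderiv_charts[OF assms(2)] has_mderiv_in[OF assms(2)]
  by (simp add: tangent_def mdifferentiable_at_iff)

text \<open>Coordinate functions are the test functions that recover the components of a tangent
  vector, which makes its representation as a functional faithful.\<close>

lemma mdifferentiable_at_coordinate:
  assumes "smooth_manifold M" "c \<in> charts M" "p \<in> fst c"
  shows "mdifferentiable_at M p (\<lambda>q. snd c q \<bullet> b)"
    and "tangent M c p \<xi> (\<lambda>q. snd c q \<bullet> b) = \<xi> \<bullet> b"
proof -
  have "has_mderiv M c (chart_inv c) (snd c p) (\<lambda>\<xi>. \<xi>)"
    using assms by (intro has_mderiv_chart smooth_manifold_chart)
  then have "((\<lambda>z. snd c (chart_inv c z)) has_derivative (\<lambda>\<xi>. \<xi>)) (at (snd c p))"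
    by (simp add: has_mderiv_def)
  then have *: "(((\<lambda>q. snd c q \<bullet> b) \<circ> chart_inv c) has_derivative (\<lambda>\<xi>. \<xi> \<bullet> b)) (at (snd c p))"
    unfolding o_def by (rule has_derivative_inner_left)
  then show 1: "mdifferentiable_at M p (\<lambda>q. snd c q \<bullet> b)"
    using mdifferentiable_at_iff[OF assms] by (auto simp: differentiable_def)
  show "tangent M c p \<xi> (\<lambda>q. snd c q \<bullet> b) = \<xi> \<bullet> b"
    using 1 frechet_derivative_eq[OF *] by (simp add: tangent_def)
qed

lemma tangent_inject:
  assumes "smooth_manifold M" "c \<in> charts M" "p \<in> fst c"
  shows "tangent M c p \<xi> = tangent M c p \<eta> \<longleftrightarrow> \<xi> = \<eta>"
  using mdifferentiable_at_coordinate(2)[OF assms] by (metis euclidean_eqI)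

lemma tangent_linear:
  assumes "smooth_manifold M" "c \<in> charts M" "p \<in> fst c"
  shows "linear (\<lambda>\<xi>. tangent M c p \<xi> f)"
proof (cases "mdifferentiable_at M p f")
  case True
  then have "linear (frechet_derivative (f \<circ> chart_inv c) (at (snd c p)))"
    using mdifferentiable_at_iff[OF assms] linear_frechet_derivative by blast
  then show ?thesis using True by (simp add: tangent_def eta_contract_eq)
qed (simp add: tangent_def linear_zero)

lemma tangent_tplus:
  assumes "smooth_manifold M" "c \<in> charts M" "p \<in> fst c"
  shows "tplus (tangent M c p \<xi>) (tangent M c p \<eta>) = tangent M c p (\<xi> + \<eta>)"
  by (rule ext) (simp add: tplus_def linear_add[OF tangent_linear[OF assms]])

lemma tangent_tscale:
  assumes "smooth_manifold M" "c \<in> charts M" "p \<in> fst c"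
  shows "tscale r (tangent M c p \<xi>) = tangent M c p (r *\<^sub>R \<xi>)"
  by (rule ext) (simp add: tscale_def linear_cmul[OF tangent_linear[OF assms]])

text \<open>Both sides are derivatives of the same function \<open>f\<close> along \<open>H\<close>,
  so uniqueness of derivatives replaces a transition formula.\<close>

lemma tangent_change:
  assumes "smooth_manifold M" "has_mderiv M c H x D" "has_mderiv M c' H x D'"
  shows "tangent M c (H x) (D \<xi>) = tangent M c' (H x) (D' \<xi>)"
proof
  fix f
  show "tangent M c (H x) (D \<xi>) f = tangent M c' (H x) (D' \<xi>) f"
  proof (cases "mdifferentiable_at M (H x) f")
    case True
    show ?thesis
      using has_derivative_unique[OF tangent_apply[OF assms(1,2) True] tangent_apply[OF assms(1,3) True]]
      by (rule fun_cong)
  qed (simp add: tangent_def)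
qed

lemma tangent_space_eq:
  assumes "smooth_manifold M" "c \<in> charts M" "p \<in> fst c"
  shows "tangent_space M p = range (tangent M c p)"
proof
  show "tangent_space M p \<subseteq> range (tangent M c p)"
  proof
    fix v assume "v \<in> tangent_space M p"
    then obtain c' \<xi> where c': "c' \<in> charts M" "p \<in> fst c'" "v = tangent M c' p \<xi>"
      by (auto simp: tangent_space_def)
    have p: "chart_inv c' (snd c' p) = p" and H: "has_mderiv M c' (chart_inv c') (snd c' p) (\<lambda>\<xi>. \<xi>)"
      using manifold_chart[OF assms(1) c'(1,2)] by auto
    obtain D where D: "has_mderiv M c (chart_inv c') (snd c' p) D"
      using has_mderiv_change[OF assms(1) H assms(2)] p assms(3) by auto
    show "v \<in> range (tangent M c p)"
      using tangent_change[OF assms(1) H D, of \<xi>] p c'(3) by auto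
  qed
  show "range (tangent M c p) \<subseteq> tangent_space M p"
    unfolding tangent_space_def using assms(2,3) by blast
qed

lemma differential_tangent:
  assumes M: "smooth_manifold M" and M': "smooth_manifold M'" and c: "c \<in> charts M" "p \<in> fst c"
    and F: "has_mderiv M' c' (\<lambda>z. F (chart_inv c z)) (snd c p) D"
  shows "differential M' F p (tangent M c p \<xi>) = tangent M' c' (F p) (D \<xi>)"
proof
  fix f
  note p = manifold_chart(1)[OF M c]
  show "differential M' F p (tangent M c p \<xi>) f = tangent M' c' (F p) (D \<xi>) f"
  proof (cases "mdifferentiable_at M' (F p) f")
    case True
    then have der: "((f \<circ> F \<circ> chart_inv c) has_derivative (\<lambda>\<xi>. tangent M' c' (F p) (D \<xi>) f)) (at (snd c p))"
      using tangent_apply[OF M' F] p by (simp add: o_def)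
    then have "mdifferentiable_at M p (f \<circ> F)"
      by (auto simp: mdifferentiable_at_iff[OF M c] differentiable_def)
    then show ?thesis
      using True frechet_derivative_eq[OF der] by (simp add: differential_def tangent_def)
  qed (simp add: differential_def tangent_def)
qed

text \<open>The functional \<open>\<lambda>h. deriv h 0\<close> is the unit tangent vector of the
  real line at 0, so its image under the differential is the velocity of the curve.\<close>

lemma differential_curve:
  assumes M: "smooth_manifold M" and \<gamma>: "has_mderiv M c \<gamma> 0 (\<lambda>h. h *\<^sub>R \<xi>)"
  shows "differential M \<gamma> (0 :: real) (\<lambda>h. deriv h 0) = tangent M c (\<gamma> 0) \<xi>"
proof
  fix f
  show "differential M \<gamma> 0 (\<lambda>h. deriv h 0) f = tangent M c (\<gamma> 0) \<xi> f"
  proof (cases "mdifferentiable_at M (\<gamma> 0) f")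
    case True
    have "((\<lambda>t. f (\<gamma> t)) has_derivative (\<lambda>h. tangent M c (\<gamma> 0) (h *\<^sub>R \<xi>) f)) (at 0)"
      using tangent_apply[OF M \<gamma> True] .
    then have "((\<lambda>t. f (\<gamma> t)) has_derivative (*) (tangent M c (\<gamma> 0) \<xi> f)) (at 0)"
      by (rule has_derivative_eq_rhs)
        (simp add: linear_cmul[OF tangent_linear[OF M has_mderiv_charts[OF \<gamma>] has_mderiv_in[OF \<gamma>]]] fun_eq_iff)
    then have "deriv (\<lambda>t. f (\<gamma> t)) 0 = tangent M c (\<gamma> 0) \<xi> f"
      by (intro DERIV_imp_deriv) (simp add: has_field_derivative_def)
    then show ?thesis using True by (simp add: differential_def o_def)
  qed (simp add: differential_def tangent_def)
qed

text \<open>The definite description is independent of the chart because the Cauchy-Riemann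
  equations for the identity map make coordinate changes commute with \<open>cI\<close>.\<close>

lemma imult_tangent:
  assumes M: "smooth_manifold M" and hol: "holomorphic_map cI cI M M (\<lambda>x. x)"
    and c: "c \<in> charts M" "p \<in> fst c"
  shows "imult M p (tangent M c p \<xi>) = tangent M c p (cI \<xi>)"
  unfolding imult_def
proof (rule the_equality)
  fix w assume "\<exists>c'\<in>charts M. \<exists>\<xi>'. p \<in> fst c' \<and> tangent M c p \<xi> = tangent M c' p \<xi>' \<and> w = tangent M c' p (cI \<xi>')"
  then obtain c' \<xi>' where c': "c' \<in> charts M" "p \<in> fst c'"
    and eq: "tangent M c p \<xi> = tangent M c' p \<xi>'" and w: "w = tangent M c' p (cI \<xi>')"
    by blast
  define A where "A = frechet_derivative (coord_rep c' c (\<lambda>p. p)) (at (snd c' p))"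
  have p: "chart_inv c' (snd c' p) = p" and H: "has_mderiv M c' (chart_inv c') (snd c' p) (\<lambda>\<xi>. \<xi>)"
    using manifold_chart[OF M c'] by auto
  have H': "has_mderiv M c (chart_inv c') (snd c' p) A"
    using has_mderiv_change[OF M H c(1)] p c(2) by (simp add: A_def)
  have tan: "tangent M c' p \<eta> = tangent M c p (A \<eta>)" for \<eta>
    using tangent_change[OF M H H'] p by simp
  have "snd c' p \<in> coord_dom c' c (\<lambda>p. p)"
    using c c' by (auto simp: coord_dom_def)
  then have "A (cI \<xi>') = cI (A \<xi>')"
    using hol c(1) c'(1) by (simp add: holomorphic_map_def A_def)
  moreover have "\<xi> = A \<xi>'"
    using eq tan tangent_inject[OF M c] by simp
  ultimately show "w = tangent M c p (cI \<xi>)"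
    using w tan by simp
qed (use c in blast)

section \<open>Lie groups\<close>

text \<open>The differential of the multiplication at \<open>(p, q)\<close> in coordinates. Three
  charts occur because \<open>p\<close>, \<open>q\<close> and their product need not share
  one.\<close>

definition mult_deriv ::
    "('g, 'e::euclidean_space) lie_grp \<Rightarrow> ('g, 'e) chart \<Rightarrow> 'g \<Rightarrow> ('g, 'e) chart \<Rightarrow> 'g \<Rightarrow> ('g, 'e) chart
      \<Rightarrow> 'e \<times> 'e \<Rightarrow> 'e" where
  "mult_deriv L c1 p c2 q c =
     frechet_derivative (coord_rep (prod_chart c1 c2) c (\<lambda>(x, y). x \<otimes>\<^bsub>L\<^esub> y)) (at (snd c1 p, snd c2 q))"

locale lie = group L for L :: "('g, 'e::euclidean_space) lie_grp" (structure) +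
  assumes lie_group: "lie_group L"
begin

lemma manifold: "smooth_manifold (mfd L)"
  using lie_group by (simp add: lie_group_def)

lemma topspace_eq: "topspace (mtop (mfd L)) = carrier L"
  using lie_group by (simp add: lie_group_def)

lemma chart_carrier: "c \<in> charts (mfd L) \<Longrightarrow> p \<in> fst c \<Longrightarrow> p \<in> carrier L"
  using chart_in_topspace[OF manifold] by (simp add: topspace_eq)

lemma chart_inv_carrier: "c \<in> charts (mfd L) \<Longrightarrow> z \<in> snd c ` fst c \<Longrightarrow> chart_inv c z \<in> carrier L"
  by (rule chart_carrier) (auto intro: chart_inv_in)

lemma is_chart: "c \<in> charts (mfd L) \<Longrightarrow> is_chart (mtop (mfd L)) c"
  by (rule smooth_manifold_chart[OF manifold])

lemma obtain_chart:
  assumes "p \<in> carrier L"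
  obtains c where "c \<in> charts (mfd L)" "p \<in> fst c"
  by (rule smooth_manifold_obtain_chart[OF manifold, of p]) (use assms topspace_eq in auto)

lemma prod_chart_in:
  "c1 \<in> charts (mfd L) \<Longrightarrow> c2 \<in> charts (mfd L) \<Longrightarrow> prod_chart c1 c2 \<in> charts (prod_mfd (mfd L) (mfd L))"
  unfolding prod_mfd_def mfd.simps by blast

lemma is_prod_chart:
  "c1 \<in> charts (mfd L) \<Longrightarrow> c2 \<in> charts (mfd L) \<Longrightarrow> is_chart (mtop (prod_mfd (mfd L) (mfd L))) (prod_chart c1 c2)"
  by (simp add: prod_mfd_def is_chart_prod is_chart)

section \<open>Derivatives of products and inverses\<close>

lemma has_mderiv_mult:
  assumes H1: "has_mderiv (mfd L) c1 H1 x D1" and H2: "has_mderiv (mfd L) c2 H2 x D2"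
    and c: "c \<in> charts (mfd L)" "H1 x \<otimes> H2 x \<in> fst c"
  shows "has_mderiv (mfd L) c (\<lambda>z. H1 z \<otimes> H2 z) x (\<lambda>\<xi>. mult_deriv L c1 (H1 x) c2 (H2 x) c (D1 \<xi>, D2 \<xi>))"
proof -
  have "smooth_map (prod_mfd (mfd L) (mfd L)) (mfd L) (\<lambda>(x, y). x \<otimes> y)"
    using lie_group by (simp add: lie_group_def)
  from has_mderiv_map[OF is_prod_chart is_chart this has_mderiv_Pair[OF H1 H2]]
  show ?thesis
    using c has_mderiv_charts[OF H1] has_mderiv_charts[OF H2] by (simp add: mult_deriv_def)
qed

lemma mult_deriv_linear:
  assumes "c1 \<in> charts (mfd L)" "c2 \<in> charts (mfd L)" "c \<in> charts (mfd L)"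
    and "p \<in> fst c1" "q \<in> fst c2" "p \<otimes> q \<in> fst c"
  shows "linear (mult_deriv L c1 p c2 q c)"
proof -
  have "smooth_map (prod_mfd (mfd L) (mfd L)) (mfd L) (\<lambda>(x, y). x \<otimes> y)"
    using lie_group by (simp add: lie_group_def)
  from coord_rep_has_derivative[OF this prod_chart_in[OF assms(1,2)] assms(3) is_prod_chart[OF assms(1,2)],
      of "(p, q)"] assms
  show ?thesis
    unfolding mult_deriv_def by (auto dest: has_derivative_linear)
qed

text \<open>Multiplying by the neutral element on either side is the identity map, which gives both
  partial derivatives; linearity adds them.\<close>

lemma mult_deriv_one:
  assumes c: "c \<in> charts (mfd L)" "\<one> \<in> fst c"
  shows "mult_deriv L c \<one> c \<one> c (\<xi>, \<eta>) = \<xi> + \<eta>"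
proof -
  note H = manifold_chart(2)[OF manifold c] and K = has_mderiv_const[OF c, of "snd c \<one>"]
  note p = manifold_chart(1)[OF manifold c]
  have "\<forall>\<^sub>F z in nhds (snd c \<one>). z \<in> snd c ` fst c"
    using eventually_chart[OF is_chart[OF c(1)] c(2)] .
  then have "\<forall>\<^sub>F z in nhds (snd c \<one>). chart_inv c z \<in> carrier L"
    by (rule eventually_mono) (rule chart_inv_carrier[OF c(1)])
  then have ev: "\<forall>\<^sub>F z in nhds (snd c \<one>). chart_inv c z \<otimes> \<one> = chart_inv c z"
    "\<forall>\<^sub>F z in nhds (snd c \<one>). \<one> \<otimes> chart_inv c z = chart_inv c z"
    by (auto elim: eventually_mono)
  have "has_mderiv (mfd L) c (chart_inv c) (snd c \<one>) (\<lambda>\<xi>. mult_deriv L c \<one> c \<one> c (\<xi>, 0))"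
    using has_mderiv_mult[OF H K c(1)] c(2) p by (simp add: has_mderiv_cong[OF ev(1)])
  from has_mderiv_unique[OF this H] have 1: "mult_deriv L c \<one> c \<one> c (\<xi>, 0) = \<xi>" by meson
  have "has_mderiv (mfd L) c (chart_inv c) (snd c \<one>) (\<lambda>\<xi>. mult_deriv L c \<one> c \<one> c (0, \<xi>))"
    using has_mderiv_mult[OF K H c(1)] c(2) p by (simp add: has_mderiv_cong[OF ev(2)])
  from has_mderiv_unique[OF this H] have 2: "mult_deriv L c \<one> c \<one> c (0, \<eta>) = \<eta>" by meson
  have "linear (mult_deriv L c \<one> c \<one> c)"
    using c by (intro mult_deriv_linear) auto
  from linear_add[OF this, of "(\<xi>, 0)" "(0, \<eta>)"] show ?thesis
    by (simp add: 1 2)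
qed

lemma has_mderiv_mult_one:
  assumes "has_mderiv (mfd L) c H1 x D1" "has_mderiv (mfd L) c H2 x D2" "H1 x = \<one>" "H2 x = \<one>"
  shows "has_mderiv (mfd L) c (\<lambda>z. H1 z \<otimes> H2 z) x (\<lambda>\<xi>. D1 \<xi> + D2 \<xi>)"
  using has_mderiv_mult[OF assms(1,2), of c] assms(3,4) mult_deriv_one[of c]
    has_mderiv_charts[OF assms(1)] has_mderiv_in[OF assms(1)] by simp

lemma has_mderiv_inv:
  assumes "has_mderiv (mfd L) c H x D" "c' \<in> charts (mfd L)" "inv (H x) \<in> fst c'"
  shows "\<exists>D'. has_mderiv (mfd L) c' (\<lambda>z. inv (H z)) x D'"
proof -
  have "smooth_map (mfd L) (mfd L) (\<lambda>x. inv x)"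
    using lie_group by (simp add: lie_group_def)
  from has_mderiv_map[OF is_chart is_chart this assms(1)] show ?thesis
    using assms(2,3) has_mderiv_charts[OF assms(1)] by blast
qed

lemma eventually_carrier:
  assumes "has_mderiv (mfd L) c H x D"
  shows "\<forall>\<^sub>F z in nhds x. H z \<in> carrier L"
proof -
  have "\<forall>\<^sub>F z in nhds x. H z \<in> fst c"
    using assms by (simp add: has_mderiv_def)
  then show ?thesis
    by (rule eventually_mono) (rule chart_carrier[OF has_mderiv_charts[OF assms]])
qed

text \<open>Smoothness of inversion gives a derivative; differentiating the constant product of
  \<open>H z\<close> and its inverse determines which one.\<close>

lemma has_mderiv_inv_one:
  assumes H: "has_mderiv (mfd L) c H x D" and 1: "H x = \<one>"
  shows "has_mderiv (mfd L) c (\<lambda>z. inv (H z)) x (\<lambda>\<xi>. - D \<xi>)"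
proof -
  have c: "c \<in> charts (mfd L)" "\<one> \<in> fst c"
    using has_mderiv_charts[OF H] has_mderiv_in[OF H] 1 by auto
  obtain D' where D': "has_mderiv (mfd L) c (\<lambda>z. inv (H z)) x D'"
    using has_mderiv_inv[OF H c(1)] c(2) 1 by auto
  have "has_mderiv (mfd L) c (\<lambda>z. H z \<otimes> inv (H z)) x (\<lambda>\<xi>. D \<xi> + D' \<xi>)"
    using has_mderiv_mult_one[OF H D'] 1 by simp
  moreover have "\<forall>\<^sub>F z in nhds x. H z \<otimes> inv (H z) = \<one>"
    using eventually_carrier[OF H] by (rule eventually_mono) simp
  ultimately have "has_mderiv (mfd L) c (\<lambda>z. \<one>) x (\<lambda>\<xi>. D \<xi> + D' \<xi>)"
    by (simp add: has_mderiv_cong)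
  from has_mderiv_unique[OF this has_mderiv_const[OF c]]
  have "D' = (\<lambda>\<xi>. - D \<xi>)"
    by (auto simp: fun_eq_iff eq_neg_iff_add_eq_0 add.commute)
  then show ?thesis using D' by simp
qed

section \<open>One-parameter subgroups and the exponential map\<close>

lemma hom_zero_one:
  assumes "\<And>s t :: real. \<gamma> (s + t) = \<gamma> s \<otimes> \<gamma> t" "\<And>t. \<gamma> t \<in> carrier L"
  shows "\<gamma> 0 = \<one>" and "\<gamma> (- t) = inv (\<gamma> t)"
proof -
  have "\<gamma> 0 = \<gamma> 0 \<otimes> \<gamma> 0"
    using assms(1)[of 0 0] by simp
  then show 0: "\<gamma> 0 = \<one>"
    using assms(2) by (metis l_cancel_one')
  have "\<gamma> (- t) \<otimes> \<gamma> t = \<one>"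
    using assms(1)[of "- t" t] 0 by simp
  then show "\<gamma> (- t) = inv (\<gamma> t)"
    using assms(2) inv_equality by metis
qed

text \<open>The quotient \<open>\<gamma>\<^sub>1(t) \<gamma>\<^sub>2(-t)\<close> has derivative 0 at \<open>t = 0\<close> and, by the homomorphism property,
  everywhere, so no uniqueness theorem for differential equations is needed.\<close>

lemma one_parameter_unique:
  assumes hom1: "\<And>s t :: real. \<gamma>1 (s + t) = \<gamma>1 s \<otimes> \<gamma>1 t" and car1: "\<And>t. \<gamma>1 t \<in> carrier L"
    and hom2: "\<And>s t :: real. \<gamma>2 (s + t) = \<gamma>2 s \<otimes> \<gamma>2 t" and car2: "\<And>t. \<gamma>2 t \<in> carrier L"
    and D1: "has_mderiv (mfd L) c \<gamma>1 0 D" and D2: "has_mderiv (mfd L) c \<gamma>2 0 D"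
  shows "\<gamma>1 = \<gamma>2"
proof
  fix t :: real
  note z1 = hom_zero_one[of \<gamma>1, OF hom1 car1] and z2 = hom_zero_one[of \<gamma>2, OF hom2 car2]
  \<comment> \<open>\<open>k\<close> and \<open>C\<close> are the same function under two names:
    \<open>k\<close> is the increment, known near 0, and \<open>C\<close> is the function to be
    proved constant.\<close>
  define k where "k h = \<gamma>1 h \<otimes> \<gamma>2 (- h)" for h
  define C where "C s = \<gamma>1 s \<otimes> \<gamma>2 (- s)" for s
  have lin: "linear D"
    using D1 by (auto simp: has_mderiv_def dest: has_derivative_linear)
  have "has_mderiv (mfd L) c (\<lambda>h. \<gamma>2 (- h)) 0 (\<lambda>h. D (- h))"
    by (rule has_mderiv_compose[where g = uminus]) (use D2 in \<open>auto intro!: derivative_eq_intros\<close>)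
  from has_mderiv_mult_one[OF D1 this] have k: "has_mderiv (mfd L) c k 0 (\<lambda>h. 0)"
    using z1 z2 by (simp add: k_def[abs_def] linear_neg[OF lin])
  have zero: "has_mderiv (mfd L) c' C s (\<lambda>h. 0)" if c': "c' \<in> charts (mfd L)" "C s \<in> fst c'" for c' s
  proof -
    obtain c1 where c1: "c1 \<in> charts (mfd L)" "\<gamma>1 s \<in> fst c1"
      by (rule obtain_chart[OF car1])
    obtain c2 where c2: "c2 \<in> charts (mfd L)" "\<gamma>2 (- s) \<in> fst c2"
      by (rule obtain_chart[OF car2])
    have k0: "k 0 = \<one>" using z1 z2 by (simp add: k_def)
    have cc: "c \<in> charts (mfd L)" "\<one> \<in> fst c"
      using has_mderiv_charts[OF k] has_mderiv_in[OF k] k0 by auto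
    have "mult_deriv L c1 (\<gamma>1 s) c \<one> c1 (0, 0) = 0"
      using linear_0[OF mult_deriv_linear[OF c1(1) cc(1) c1(1) c1(2) cc(2)]] c1 car1 by (simp add: zero_prod_def)
    then have 1: "has_mderiv (mfd L) c1 (\<lambda>h. \<gamma>1 s \<otimes> k h) 0 (\<lambda>h. 0)"
      using has_mderiv_mult[OF has_mderiv_const[OF c1] k c1(1)] c1 car1 k0 by simp
    have "mult_deriv L c1 (\<gamma>1 s) c2 (\<gamma>2 (- s)) c' (0, 0) = 0"
      using linear_0[OF mult_deriv_linear[OF c1(1) c2(1) c'(1) c1(2) c2(2)]] c'(2) by (simp add: zero_prod_def C_def)
    then have 2: "has_mderiv (mfd L) c' (\<lambda>h. \<gamma>1 s \<otimes> k h \<otimes> \<gamma>2 (- s)) 0 (\<lambda>h. 0)"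
      using has_mderiv_mult[OF 1 has_mderiv_const[OF c2] c'(1)] c' car1 k0 by (simp add: C_def)
    have "has_mderiv (mfd L) c' (\<lambda>r. \<gamma>1 s \<otimes> k (r - s) \<otimes> \<gamma>2 (- s)) s (\<lambda>h. 0)"
      by (rule has_mderiv_compose[where g = "\<lambda>r. r - s" and D = "\<lambda>h. 0" and g' = "\<lambda>h. h"])
        (use 2 in \<open>auto intro!: derivative_eq_intros\<close>)
    moreover have "\<gamma>1 s \<otimes> k (r - s) \<otimes> \<gamma>2 (- s) = C r" for r
    proof -
      have "C r = \<gamma>1 (s + (r - s)) \<otimes> \<gamma>2 (- (r - s) + - s)" by (simp add: C_def)
      also have "\<dots> = \<gamma>1 s \<otimes> k (r - s) \<otimes> \<gamma>2 (- s)"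
        unfolding hom1 hom2 k_def using car1 car2 by (simp add: m_assoc)
      finally show ?thesis ..
    qed
    ultimately show ?thesis by simp
  qed
  \<comment> \<open>A vanishing derivative is visible only as long as \<open>C\<close> stays in one
    chart, so it gives local constancy; connectedness of the line does the rest.\<close>
  have "C t = C 0"
  proof (rule connected_local_const[where A = UNIV])
    show "\<forall>s\<in>UNIV. \<forall>\<^sub>F r in at s within UNIV. C s = C r"
    proof
      fix s :: real
      obtain c' where c': "c' \<in> charts (mfd L)" "C s \<in> fst c'"
        by (rule obtain_chart[of "C s"]) (simp_all add: C_def car1 car2)
      obtain e where e: "e > 0" "\<And>r. r \<in> ball s e \<Longrightarrow> C r \<in> fst c'"
        using zero[OF c'] unfolding has_mderiv_def eventually_nhds_metric by (auto simp: dist_commute)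
      have "((\<lambda>r. snd c' (C r)) has_derivative (\<lambda>h. 0)) (at r within ball s e)" if "r \<in> ball s e" for r
        using zero[OF c'(1) e(2)[OF that]] by (auto simp: has_mderiv_def intro: has_derivative_at_withinI)
      then obtain a where a: "\<And>r. r \<in> ball s e \<Longrightarrow> snd c' (C r) = a"
        using has_derivative_zero_constant[of "ball s e" "\<lambda>r. snd c' (C r)"] by auto
      have "C s = C r" if "r \<in> ball s e" for r
        using a[OF that] a[of s] e manifold_chart(1)[OF manifold c'(1)] that by (metis centre_in_ball)
      then show "\<forall>\<^sub>F r in at s within UNIV. C s = C r"
        using e(1) by (auto simp: eventually_at dist_commute intro!: exI[of _ e])
    qed
  qed auto
  then have "\<gamma>1 t \<otimes> inv (\<gamma>2 t) = \<one>"
    using z1 z2 by (simp add: C_def)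
  then show "\<gamma>1 t = \<gamma>2 t"
    using car1 car2 by (metis inv_equality inv_inv inv_closed)
qed

lemma one_parameter_subgroup_carrier: "one_parameter_subgroup L v \<gamma> \<Longrightarrow> \<gamma> t \<in> carrier L"
  by (auto simp: one_parameter_subgroup_def smooth_map_def continuous_map_def real_mfd_def topspace_eq)

lemma one_parameter_subgroup_has_mderiv:
  assumes \<gamma>: "one_parameter_subgroup L v \<gamma>" and c: "c \<in> charts (mfd L)" "\<one> \<in> fst c"
  obtains \<xi> where "v = tangent (mfd L) c \<one> \<xi>" "has_mderiv (mfd L) c \<gamma> 0 (\<lambda>h. h *\<^sub>R \<xi>)"
proof -
  have \<gamma>0: "\<gamma> 0 = \<one>"
    using \<gamma> one_parameter_subgroup_carrier[OF \<gamma>] by (intro hom_zero_one) (auto simp: one_parameter_subgroup_def)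
  have "is_chart (mtop real_mfd) (UNIV, \<lambda>t. t)"
    using homeomorphic_map_id[of euclidean "euclidean :: real topology"]
    by (simp add: is_chart_def real_mfd_def id_def)
  moreover have "smooth_map real_mfd (mfd L) \<gamma>"
    using \<gamma> by (simp add: one_parameter_subgroup_def)
  moreover have "has_mderiv real_mfd (UNIV, \<lambda>t. t) (\<lambda>t. t) 0 (\<lambda>h. h)"
    by (simp add: has_mderiv_def real_mfd_def)
  ultimately obtain D where D: "has_mderiv (mfd L) c \<gamma> 0 D"
    using has_mderiv_map[of real_mfd "(UNIV, \<lambda>t. t)" "mfd L" c \<gamma> "\<lambda>t. t" 0 "\<lambda>h. h"] c \<gamma>0 is_chart by auto
  have lin: "linear D"
    using D by (auto simp: has_mderiv_def dest: has_derivative_linear)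
  have D1: "D h = h *\<^sub>R D 1" for h
    using linear_cmul[OF lin, of h 1] by simp
  have "D = (\<lambda>h. h *\<^sub>R D 1)"
    by (rule ext) (rule D1)
  then have D': "has_mderiv (mfd L) c \<gamma> 0 (\<lambda>h. h *\<^sub>R D 1)"
    using D by simp
  have "v = tangent (mfd L) c \<one> (D 1)"
    using differential_curve[OF manifold D'] \<gamma> \<gamma>0 by (simp add: one_parameter_subgroup_def)
  then show ?thesis using D' that by blast
qed

text \<open>The generator fixes the velocity at 0 in a chart and thereby the whole subgroup, so the
  definite description has a unique solution.\<close>

lemma lie_exp_eq:
  assumes \<gamma>: "one_parameter_subgroup L v \<gamma>"
  shows "lie_exp L v = \<gamma> 1"
  unfolding lie_exp_def
proof (rule the_equality)
  fix g assume "\<exists>\<gamma>'. one_parameter_subgroup L v \<gamma>' \<and> g = \<gamma>' 1"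
  then obtain \<gamma>' where \<gamma>': "one_parameter_subgroup L v \<gamma>'" and g: "g = \<gamma>' 1" by blast
  obtain c where c: "c \<in> charts (mfd L)" "\<one> \<in> fst c"
    by (rule obtain_chart[OF one_closed])
  obtain \<xi> where \<xi>: "v = tangent (mfd L) c \<one> \<xi>" "has_mderiv (mfd L) c \<gamma> 0 (\<lambda>h. h *\<^sub>R \<xi>)"
    using one_parameter_subgroup_has_mderiv[OF \<gamma> c] .
  obtain \<xi>' where \<xi>': "v = tangent (mfd L) c \<one> \<xi>'" "has_mderiv (mfd L) c \<gamma>' 0 (\<lambda>h. h *\<^sub>R \<xi>')"
    using one_parameter_subgroup_has_mderiv[OF \<gamma>' c] .
  have "\<xi>' = \<xi>"
    using \<xi>(1) \<xi>'(1) tangent_inject[OF manifold c] by simp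
  then have "\<gamma>' = \<gamma>"
    using \<gamma> \<gamma>' \<xi>(2) \<xi>'(2) one_parameter_subgroup_carrier
    by (intro one_parameter_unique[of \<gamma>' \<gamma> c "\<lambda>h. h *\<^sub>R \<xi>"]) (auto simp: one_parameter_subgroup_def)
  then show "g = \<gamma> 1" using g by simp
qed (use \<gamma> in blast)

section \<open>Right translations and derivatives along right-invariant fields\<close>

lemma has_mderiv_mult_right:
  assumes "has_mderiv (mfd L) c H x D" "H x = \<one>" "c' \<in> charts (mfd L)" "U \<in> fst c'"
  shows "has_mderiv (mfd L) c' (\<lambda>z. H z \<otimes> U) x (\<lambda>\<xi>. mult_deriv L c \<one> c' U c' (D \<xi>, 0))"
  using has_mderiv_mult[OF assms(1) has_mderiv_const[OF assms(3,4)] assms(3)] assms chart_carrier[OF assms(3,4)]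
  by simp

lemma dR_tangent:
  assumes c: "c \<in> charts (mfd L)" "\<one> \<in> fst c" and c': "c' \<in> charts (mfd L)" "U \<in> fst c'"
  shows "dR L U (tangent (mfd L) c \<one> \<xi>) = tangent (mfd L) c' U (mult_deriv L c \<one> c' U c' (\<xi>, 0))"
  using differential_tangent[OF manifold manifold c
      has_mderiv_mult_right[OF manifold_chart(2)[OF manifold c] manifold_chart(1)[OF manifold c] c']]
    chart_carrier[OF c'] by (simp add: dR_def)

text \<open>The family \<open>H\<close> through the identity is left free: a chart of
  \<open>G\<close>, an exponential curve and a chart of \<open>GC\<close> are inserted later,
  whichever makes the differentiated function computable.\<close>

lemma dR_apply:
  assumes H: "has_mderiv (mfd L) c H x D" "H x = \<one>" and U: "U \<in> carrier L"
    and f: "mdifferentiable_at (mfd L) U f"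
  shows "((\<lambda>z. f (H z \<otimes> U)) has_derivative (\<lambda>\<xi>. dR L U (tangent (mfd L) c \<one> (D \<xi>)) f)) (at x)"
proof -
  obtain c' where c': "c' \<in> charts (mfd L)" "U \<in> fst c'"
    by (rule obtain_chart[OF U])
  have c: "c \<in> charts (mfd L)" "\<one> \<in> fst c"
    using has_mderiv_charts[OF H(1)] has_mderiv_in[OF H(1)] H(2) by auto
  show ?thesis
    using tangent_apply[OF manifold has_mderiv_mult_right[OF H c'], of f] f H(2) U
    by (simp add: dR_tangent[OF c c'])
qed

end

section \<open>Complexifications of Abelian groups\<close>

lemma linear_cI: "linear cI"
  by (rule linearI) (simp_all add: vec_eq_iff algebra_simps scaleR_conv_of_real)

locale abelian_complexification = G: lie G + GC: lie GC
  for G :: "('g, real^'m) lie_grp" and GC :: "('g, complex^'m) lie_grp" (structure) +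
  fixes \<kappa> :: "'g metric" and X :: "'m \<Rightarrow> 'g tvec"
  assumes comm_G: "comm_group G" and complexification: "complexification G GC"
    and metric: "riemannian_metric (mfd G) \<kappa>" and basis: "orthonormal_lie_basis G \<kappa> X"
begin

section \<open>The embedding of \<open>G\<close> and of its Lie algebra\<close>

lemma subgroup_G: "subgroup (carrier G) GC"
  using complexification by (simp add: complexification_def)

lemma G_subset: "x \<in> carrier G \<Longrightarrow> x \<in> carrier GC"
  using subgroup.subset[OF subgroup_G] by blast

lemma mult_G: "x \<in> carrier G \<Longrightarrow> y \<in> carrier G \<Longrightarrow> x \<otimes>\<^bsub>G\<^esub> y = x \<otimes> y"
  using complexification by (simp add: complexification_def)

text \<open>An idempotent of the group \<open>GC\<close> is its identity.\<close>

lemma one_G: "\<one>\<^bsub>G\<^esub> = \<one>"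
proof -
  have "\<one>\<^bsub>G\<^esub> \<otimes> \<one>\<^bsub>G\<^esub> = \<one>\<^bsub>G\<^esub>"
    using mult_G[of "\<one>\<^bsub>G\<^esub>" "\<one>\<^bsub>G\<^esub>"] by simp
  then show ?thesis
    using GC.l_cancel_one'[of "\<one>\<^bsub>G\<^esub>" "\<one>\<^bsub>G\<^esub>"] G_subset[OF G.one_closed] by auto
qed

lemma complex_lie_group: "complex_lie_group GC"
  using complexification by (simp add: complexification_def)

lemma mult_deriv_cI:
  assumes "c1 \<in> charts (mfd GC)" "c2 \<in> charts (mfd GC)" "c \<in> charts (mfd GC)"
    and "p \<in> fst c1" "q \<in> fst c2" "p \<otimes> q \<in> fst c"
  shows "mult_deriv GC c1 p c2 q c (cI \<xi>, cI \<eta>) = cI (mult_deriv GC c1 p c2 q c (\<xi>, \<eta>))"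
proof -
  have hol: "holomorphic_map (map_prod cI cI) cI (prod_mfd (mfd GC) (mfd GC)) (mfd GC) (\<lambda>(x, y). x \<otimes> y)"
    using complex_lie_group by (simp add: complex_lie_group_def)
  have dom: "(snd c1 p, snd c2 q) \<in> coord_dom (prod_chart c1 c2) c (\<lambda>(x, y). x \<otimes> y)"
    using assms by (force simp: coord_dom_def)
  from hol[unfolded holomorphic_map_def, THEN conjunct2, rule_format,
      OF GC.prod_chart_in[OF assms(1,2)] assms(3) dom, of "(\<xi>, \<eta>)"]
  show ?thesis by (simp add: mult_deriv_def)
qed

text \<open>Fixing one chart at the identity turns vectors of the Lie algebra into vectors of the
  model space. Here \<open>\<one>\<close> is the identity of \<open>GC\<close>.\<close>

definition cG :: "('g, real^'m) chart" where
  "cG = (SOME c. c \<in> charts (mfd G) \<and> \<one> \<in> fst c)"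

definition cC :: "('g, complex^'m) chart" where
  "cC = (SOME c. c \<in> charts (mfd GC) \<and> \<one> \<in> fst c)"

lemma cG: "cG \<in> charts (mfd G)" "\<one> \<in> fst cG"
proof -
  have "\<exists>c. c \<in> charts (mfd G) \<and> \<one> \<in> fst c"
    by (rule G.obtain_chart[OF G.one_closed]) (rule exI, simp add: one_G)
  from someI_ex[OF this] show "cG \<in> charts (mfd G)" "\<one> \<in> fst cG"
    by (simp_all only: cG_def)
qed

lemma cC: "cC \<in> charts (mfd GC)" "\<one> \<in> fst cC"
proof -
  have "\<exists>c. c \<in> charts (mfd GC) \<and> \<one> \<in> fst c"
    by (rule GC.obtain_chart[OF GC.one_closed]) (rule exI, simp)
  from someI_ex[OF this] show "cC \<in> charts (mfd GC)" "\<one> \<in> fst cC"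
    by (simp_all only: cC_def)
qed

abbreviation tG :: "real^'m \<Rightarrow> 'g tvec" where
  "tG \<equiv> tangent (mfd G) cG \<one>"

abbreviation tC :: "complex^'m \<Rightarrow> 'g tvec" where
  "tC \<equiv> tangent (mfd GC) cC \<one>"

lemmas tG_inject = tangent_inject[OF G.manifold cG]
  and tC_inject = tangent_inject[OF GC.manifold cC]

lemma lie_algebra_G: "lie_algebra G = range tG"
  using tangent_space_eq[OF G.manifold cG] by (simp add: lie_algebra_def one_G)

lemma lie_algebra_GC: "lie_algebra GC = range tC"
  using tangent_space_eq[OF GC.manifold cC] by (simp add: lie_algebra_def)

definition incl_deriv :: "real^'m \<Rightarrow> complex^'m" where
  "incl_deriv = frechet_derivative (coord_rep cG cC (\<lambda>x. x)) (at (snd cG \<one>))"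

lemma incl_has_mderiv: "has_mderiv (mfd GC) cC (chart_inv cG) (snd cG \<one>) incl_deriv"
proof -
  have "smooth_map (mfd G) (mfd GC) (\<lambda>x. x)"
    using complexification by (simp add: complexification_def)
  from has_mderiv_map[OF G.is_chart[OF cG(1)] GC.is_chart[OF cC(1)] this
      manifold_chart(2)[OF G.manifold cG] cC(1)]
  show ?thesis
    using manifold_chart(1)[OF G.manifold cG] cC(2) by (simp add: incl_deriv_def)
qed

lemma linear_incl_deriv: "linear incl_deriv"
  using incl_has_mderiv by (auto simp: has_mderiv_def dest: has_derivative_linear)

lemma lie_incl_tangent: "lie_incl G GC (tG \<zeta>) = tC (incl_deriv \<zeta>)"
  using differential_tangent[OF G.manifold GC.manifold cG, where F = "\<lambda>x. x" and D = incl_deriv and c' = cC]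
    incl_has_mderiv by (simp add: lie_incl_def one_G)

lemma lie_I_tangent: "lie_I G GC (tG \<zeta>) = tC (cI (incl_deriv \<zeta>))"
  using complex_lie_group imult_tangent[OF GC.manifold _ cC]
  by (simp add: lie_I_def lie_incl_tangent complex_lie_group_def)

lemma complexified_eq:
  "tplus (lie_incl G GC (tG \<zeta>)) (lie_I G GC (tG \<zeta>')) = tC (incl_deriv \<zeta> + cI (incl_deriv \<zeta>'))"
  by (simp add: lie_incl_tangent lie_I_tangent tangent_tplus[OF GC.manifold cC])

text \<open>The splitting of the Lie algebra of \<open>GC\<close> into real and imaginary part, read
  in coordinates: the image of \<open>incl_deriv\<close> is a totally real subspace of full
  dimension.\<close>

lemma bij_complexified: "bij (\<lambda>(\<zeta>, \<zeta>'). incl_deriv \<zeta> + cI (incl_deriv \<zeta>'))"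
proof -
  have b: "bij_betw (\<lambda>(X, X'). tplus (lie_incl G GC X) (lie_I G GC X'))
      (range tG \<times> range tG) (range tC)"
    using complexification lie_algebra_G lie_algebra_GC by (simp add: complexification_def)
  show ?thesis
  proof (rule bijI)
    show "inj (\<lambda>(\<zeta>, \<zeta>'). incl_deriv \<zeta> + cI (incl_deriv \<zeta>'))"
    proof (rule injI, clarify)
      fix \<zeta> \<zeta>' \<eta> \<eta>' assume "incl_deriv \<zeta> + cI (incl_deriv \<zeta>') = incl_deriv \<eta> + cI (incl_deriv \<eta>')"
      then have "(\<lambda>(X, X'). tplus (lie_incl G GC X) (lie_I G GC X')) (tG \<zeta>, tG \<zeta>') =
          (\<lambda>(X, X'). tplus (lie_incl G GC X) (lie_I G GC X')) (tG \<eta>, tG \<eta>')"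
        by (simp add: complexified_eq)
      from inj_onD[OF bij_betw_imp_inj_on[OF b] this] show "\<zeta> = \<eta> \<and> \<zeta>' = \<eta>'"
        by (simp add: tG_inject)
    qed
    show "surj (\<lambda>(\<zeta>, \<zeta>'). incl_deriv \<zeta> + cI (incl_deriv \<zeta>'))"
    proof (unfold surj_def, rule allI)
      fix \<xi>
      have "tC \<xi> \<in> (\<lambda>(X, X'). tplus (lie_incl G GC X) (lie_I G GC X')) ` (range tG \<times> range tG)"
        using bij_betw_imp_surj_on[OF b] by simp
      then obtain \<zeta> \<zeta>' where "tC \<xi> = tplus (lie_incl G GC (tG \<zeta>)) (lie_I G GC (tG \<zeta>'))"
        by auto
      then have "\<xi> = (case (\<zeta>, \<zeta>') of (\<zeta>, \<zeta>') \<Rightarrow> incl_deriv \<zeta> + cI (incl_deriv \<zeta>'))"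
        by (simp add: complexified_eq tC_inject)
      then show "\<exists>z. \<xi> = (case z of (\<zeta>, \<zeta>') \<Rightarrow> incl_deriv \<zeta> + cI (incl_deriv \<zeta>'))"
        by blast
    qed
  qed
qed

subsection \<open>Commutativity\<close>

text \<open>The derivative of the conjugation with \<open>h\<close> is complex linear and fixes the Lie algebra of
  \<open>G\<close>, hence also its multiple by the imaginary unit.\<close>

lemma centralizer_one_parameter:
  assumes h: "h \<in> carrier GC" and comm: "\<And>x. x \<in> carrier G \<Longrightarrow> h \<otimes> x = x \<otimes> h"
    and \<gamma>: "one_parameter_subgroup GC (lie_I G GC (tG \<zeta>)) \<gamma>"
  shows "h \<otimes> \<gamma> t = \<gamma> t \<otimes> h"
proof -
  obtain c1 where c1: "c1 \<in> charts (mfd GC)" "h \<in> fst c1"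
    by (rule GC.obtain_chart[OF h])
  obtain c2 where c2: "c2 \<in> charts (mfd GC)" "inv h \<in> fst c2"
    by (rule GC.obtain_chart[OF GC.inv_closed[OF h]])
  \<comment> \<open>\<open>A\<close> is the adjoint action of \<open>h\<close> in coordinates,
    factored into left multiplication by \<open>h\<close> (\<open>M1\<close>) and right
    multiplication by its inverse (\<open>M2\<close>).\<close>
  define M1 where "M1 = mult_deriv GC c1 h cC \<one> c1"
  define M2 where "M2 = mult_deriv GC c1 h c2 (inv h) cC"
  define A where "A \<xi> = M2 (M1 (0, \<xi>), 0)" for \<xi>
  have "linear M1" "linear M2"
    unfolding M1_def M2_def using c1 c2 cC h by (auto intro!: GC.mult_deriv_linear)
  moreover have "linear (Pair (0 :: complex^'m) :: complex^'m \<Rightarrow> _)"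
    "linear ((\<lambda>\<xi>. (\<xi>, 0 :: complex^'m)) :: complex^'m \<Rightarrow> _)"
    by (auto intro!: linearI)
  ultimately have "linear (M2 \<circ> ((\<lambda>\<xi>. (\<xi>, 0)) \<circ> (M1 \<circ> Pair 0)))"
    by (intro linear_compose)
  then have lin: "linear A"
    by (simp add: A_def[abs_def] o_def)
  have cI0: "cI (0 :: complex^'m) = 0"
    by (simp add: vec_eq_iff)
  have A_cI: "A (cI \<xi>) = cI (A \<xi>)" for \<xi>
  proof -
    have "M1 (0, cI \<xi>) = cI (M1 (0, \<xi>))"
      using mult_deriv_cI[OF c1(1) cC(1) c1(1,2) cC(2), of 0 \<xi>] c1 h unfolding cI0 M1_def by simp
    moreover have "M2 (cI \<eta>, 0) = cI (M2 (\<eta>, 0))" for \<eta>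
      using mult_deriv_cI[OF c1(1) c2(1) cC(1) c1(2) c2(2), of \<eta> 0] cC h unfolding cI0 M2_def by simp
    ultimately show ?thesis by (simp add: A_def)
  qed
  have conj: "has_mderiv (mfd GC) cC (\<lambda>z. h \<otimes> H z \<otimes> inv h) x (\<lambda>\<xi>. A (D \<xi>))"
    if H: "has_mderiv (mfd GC) cC H x D" "H x = \<one>" for H :: "'a::real_normed_vector \<Rightarrow> 'g" and x D
  proof -
    have 1: "has_mderiv (mfd GC) c1 (\<lambda>z. h \<otimes> H z) x (\<lambda>\<xi>. M1 (0, D \<xi>))"
      using GC.has_mderiv_mult[OF has_mderiv_const[OF c1] H(1) c1(1)] c1 H(2) h by (simp add: M1_def)
    from GC.has_mderiv_mult[OF 1 has_mderiv_const[OF c2] cC(1)]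
    show ?thesis using cC(2) H(2) h by (simp add: M2_def A_def)
  qed
  \<comment> \<open>On \<open>G\<close> conjugation with \<open>h\<close> is the identity map;
    differentiating it through the chart of \<open>G\<close> shows that \<open>A\<close> fixes the
    image of \<open>incl_deriv\<close>.\<close>
  have one: "chart_inv cG (snd cG \<one>) = \<one>"
    by (rule manifold_chart(1)[OF G.manifold cG])
  have "\<forall>\<^sub>F z in nhds (snd cG \<one>). z \<in> snd cG ` fst cG"
    using eventually_chart[OF G.is_chart[OF cG(1)] cG(2)] .
  then have "\<forall>\<^sub>F z in nhds (snd cG \<one>). h \<otimes> chart_inv cG z \<otimes> inv h = chart_inv cG z"
  proof eventually_elim
    case (elim z)
    then have "chart_inv cG z \<in> carrier G"
      using G.chart_inv_carrier cG(1) by blast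
    then show ?case
      using comm h G_subset GC.m_assoc GC.r_inv GC.r_one GC.inv_closed by metis
  qed
  then have "has_mderiv (mfd GC) cC (chart_inv cG) (snd cG \<one>) (\<lambda>\<xi>. A (incl_deriv \<xi>))"
    by (rule iffD1[OF has_mderiv_cong]) (rule conj[OF incl_has_mderiv one])
  from has_mderiv_unique[OF this incl_has_mderiv] have A_incl: "A (incl_deriv \<zeta>) = incl_deriv \<zeta>"
    by (rule fun_cong)
  obtain \<xi> where "lie_I G GC (tG \<zeta>) = tC \<xi>" and D: "has_mderiv (mfd GC) cC \<gamma> 0 (\<lambda>s. s *\<^sub>R \<xi>)"
    using GC.one_parameter_subgroup_has_mderiv[OF \<gamma> cC] .
  then have "\<xi> = cI (incl_deriv \<zeta>)"
    by (simp add: lie_I_tangent tC_inject)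
  then have A\<xi>: "A (s *\<^sub>R \<xi>) = s *\<^sub>R \<xi>" for s
    by (simp add: linear_cmul[OF lin] A_cI A_incl)
  have hom: "\<gamma> (s + r) = \<gamma> s \<otimes> \<gamma> r" and car: "\<gamma> s \<in> carrier GC" for s r
    using \<gamma> GC.one_parameter_subgroup_carrier[OF \<gamma>] by (auto simp: one_parameter_subgroup_def)
  have "\<gamma> 0 = \<one>"
    by (rule GC.hom_zero_one[OF hom car])
  \<comment> \<open>Both curves are homomorphisms with velocity \<open>\<xi>\<close> at 0, because
    \<open>A\<close> fixes \<open>\<xi>\<close>.\<close>
  have "(\<lambda>s. h \<otimes> \<gamma> s \<otimes> inv h) = \<gamma>"
  proof (rule GC.one_parameter_unique[OF _ _ hom car _ D])
    show "has_mderiv (mfd GC) cC (\<lambda>s. h \<otimes> \<gamma> s \<otimes> inv h) 0 (\<lambda>s. s *\<^sub>R \<xi>)"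
      using conj[OF D \<open>\<gamma> 0 = \<one>\<close>] by (simp add: A\<xi>)
    show "h \<otimes> \<gamma> (s + r) \<otimes> inv h = h \<otimes> \<gamma> s \<otimes> inv h \<otimes> (h \<otimes> \<gamma> r \<otimes> inv h)" for s r
      using h car by (simp add: hom GC.m_assoc GC.inv_solve_left GC.l_inv_ex flip: GC.m_assoc[of "inv h" h])
  qed (use h car in auto)
  then have "h \<otimes> \<gamma> t \<otimes> inv h = \<gamma> t"
    by (rule fun_cong)
  then show ?thesis
    using h car by (metis GC.inv_solve_right GC.m_closed)
qed

text \<open>Halving the speed passes from a subgroup generated by \<open>2Y\<close> to one generated
  by \<open>Y\<close>; general \<open>r\<close> later identifies the exponential on a line with a
  single subgroup.\<close>

lemma one_parameter_scale:
  assumes \<gamma>: "one_parameter_subgroup GC (tC \<xi>) \<gamma>"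
  shows "one_parameter_subgroup GC (tC (r *\<^sub>R \<xi>)) (\<lambda>t. \<gamma> (r * t))"
  unfolding one_parameter_subgroup_def
proof (intro conjI allI)
  have sm: "smooth_map real_mfd (mfd GC) \<gamma>"
    using \<gamma> by (simp add: one_parameter_subgroup_def)
  have hom: "\<gamma> (s + t) = \<gamma> s \<otimes> \<gamma> t" for s t
    using \<gamma> by (simp add: one_parameter_subgroup_def)
  note car = GC.one_parameter_subgroup_carrier[OF \<gamma>]
  show "smooth_map real_mfd (mfd GC) (\<lambda>t. \<gamma> (r * t))"
    unfolding smooth_map_def
  proof (intro conjI ballI)
    have "continuous_map euclidean (mtop (mfd GC)) \<gamma>"
      using sm by (simp add: smooth_map_def real_mfd_def)
    moreover have "continuous_map euclidean euclidean ((*) r)"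
      by (simp add: continuous_on_mult_left)
    ultimately show "continuous_map (mtop real_mfd) (mtop (mfd GC)) (\<lambda>t. \<gamma> (r * t))"
      using continuous_map_compose[of euclidean euclidean "(*) r" "mtop (mfd GC)" \<gamma>]
      by (simp add: real_mfd_def o_def)
    fix c c' assume c: "c \<in> charts real_mfd" and c': "c' \<in> charts (mfd GC)"
    have c_eq: "c = (UNIV, \<lambda>t. t)"
      using c by (simp add: real_mfd_def)
    have inv: "chart_inv c t = t" for t
      by (simp add: c_eq chart_inv_def inv_into_def)
    have dom: "coord_dom c c' F = F -` fst c'" and rep: "coord_rep c c' F = (\<lambda>t. snd c' (F t))" for F :: "real \<Rightarrow> 'g"
      by (auto simp: coord_dom_def coord_rep_def c_eq inv[unfolded c_eq])
    have "is_chart (mtop real_mfd) c"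
      using homeomorphic_map_id[of euclidean "euclidean :: real topology"]
      by (simp add: is_chart_def real_mfd_def id_def c_eq)
    then have op: "open (\<gamma> -` fst c')"
      using open_coord_dom[OF _ GC.is_chart[OF c'], of real_mfd c \<gamma>] sm by (simp add: dom smooth_map_def)
    have S: "open ((\<lambda>t. \<gamma> (r * t)) -` fst c')"
      using open_vimage[OF op, of "(*) r"] by (simp add: continuous_on_mult_left vimage_def)
    have "smooth_on (\<gamma> -` fst c') (\<lambda>t. snd c' (\<gamma> t))"
      using sm c c' by (auto simp: smooth_map_def dom[symmetric] rep[symmetric])
    then have "Ck_on k ((\<lambda>t. \<gamma> (r * t)) -` fst c') (\<lambda>t. snd c' (\<gamma> (r * t)))" for k
      using S by (intro Ck_on_compose[where g = "(*) r" and f = "\<lambda>t. snd c' (\<gamma> t)" and T = "\<gamma> -` fst c'"])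
        (auto simp: smooth_on_def intro!: Ck_on_linear bounded_linear_mult_right)
    then show "smooth_on (coord_dom c c' (\<lambda>t. \<gamma> (r * t))) (coord_rep c c' (\<lambda>t. \<gamma> (r * t)))"
      by (simp add: smooth_on_def dom rep)
  qed
  show "\<gamma> (r * (s + t)) = \<gamma> (r * s) \<otimes> \<gamma> (r * t)" for s t
    by (simp add: distrib_left hom)
  obtain \<xi>' where "tC \<xi> = tC \<xi>'" and D: "has_mderiv (mfd GC) cC \<gamma> 0 (\<lambda>s. s *\<^sub>R \<xi>')"
    using GC.one_parameter_subgroup_has_mderiv[OF \<gamma> cC] .
  then have \<xi>: "\<xi>' = \<xi>"
    by (simp add: tC_inject)
  have "has_mderiv (mfd GC) cC (\<lambda>t. \<gamma> (r * t)) 0 (\<lambda>h. (r * h) *\<^sub>R \<xi>)"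
    by (rule has_mderiv_compose[where g = "(*) r" and D = "\<lambda>s. s *\<^sub>R \<xi>"])
      (use D \<xi> in \<open>auto intro!: derivative_eq_intros\<close>)
  then have "has_mderiv (mfd GC) cC (\<lambda>t. \<gamma> (r * t)) 0 (\<lambda>h. h *\<^sub>R (r *\<^sub>R \<xi>))"
    by (simp add: mult.commute)
  from differential_curve[OF GC.manifold this]
  show "differential (mfd GC) (\<lambda>t. \<gamma> (r * t)) 0 (\<lambda>h. deriv h 0) = tC (r *\<^sub>R \<xi>)"
    using GC.hom_zero_one(1)[of \<gamma>, OF hom car] by simp
qed

text \<open>Covers the degenerate generator \<open>Y = 0\<close>, for which \<open>2Y = Y\<close> is
  no contradiction.\<close>

lemma one_parameter_zero: "one_parameter_subgroup GC (tC 0) (\<lambda>t. \<one>)"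
  unfolding one_parameter_subgroup_def
proof (intro conjI allI)
  show "smooth_map real_mfd (mfd GC) (\<lambda>t. \<one>)"
    unfolding smooth_map_def
  proof (intro conjI ballI)
    show "continuous_map (mtop real_mfd) (mtop (mfd GC)) (\<lambda>t. \<one>)"
      by (simp add: GC.topspace_eq)
    fix c and c' :: "('g, complex^'m) chart" assume "c \<in> charts real_mfd"
    then have "coord_dom c c' (\<lambda>t. \<one>) = (if \<one> \<in> fst c' then UNIV else {})"
      by (simp add: real_mfd_def coord_dom_def)
    then show "smooth_on (coord_dom c c' (\<lambda>t. \<one>)) (coord_rep c c' (\<lambda>t. \<one>))"
      by (simp add: smooth_on_def coord_rep_def o_def Ck_on_const)
  qed
  have "has_mderiv (mfd GC) cC (\<lambda>t. \<one>) 0 (\<lambda>h. h *\<^sub>R 0)"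
    using has_mderiv_const[OF cC, of "0 :: real"] by simp
  from differential_curve[OF GC.manifold this]
  show "differential (mfd GC) (\<lambda>t. \<one>) 0 (\<lambda>h. deriv h 0) = tC 0" .
qed simp

text \<open>If \<open>Y\<close> generated no one-parameter subgroup, neither would \<open>2Y\<close>. Both would have the same
  junk value of \<^const>\<open>lie_exp\<close>, against the uniqueness of the polar decomposition.\<close>

lemma one_parameter_exists:
  "\<exists>\<gamma>. one_parameter_subgroup GC (tC (cI (incl_deriv \<zeta>))) \<gamma>"
proof (rule ccontr)
  assume none: "\<nexists>\<gamma>. one_parameter_subgroup GC (tC (cI (incl_deriv \<zeta>))) \<gamma>"
  have none2: "\<nexists>\<gamma>. one_parameter_subgroup GC (tC (cI (incl_deriv (2 *\<^sub>R \<zeta>)))) \<gamma>"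
  proof
    assume "\<exists>\<gamma>. one_parameter_subgroup GC (tC (cI (incl_deriv (2 *\<^sub>R \<zeta>)))) \<gamma>"
    then obtain \<gamma> where "one_parameter_subgroup GC (tC (cI (incl_deriv (2 *\<^sub>R \<zeta>)))) \<gamma>" by blast
    from one_parameter_scale[OF this, of "1/2"] none show False
      by (auto simp: linear_cmul[OF linear_incl_deriv] linear_cmul[OF linear_cI])
  qed
  have eq: "lie_exp GC (tC (cI (incl_deriv \<zeta>))) = lie_exp GC (tC (cI (incl_deriv (2 *\<^sub>R \<zeta>))))"
    unfolding lie_exp_def using none none2 by simp
  have inj: "inj_on (\<lambda>(V, Y). V \<otimes> lie_exp GC Y) (carrier G \<times> i_lie_algebra G GC)"
    using complexification by (auto simp: complexification_def dest: bij_betw_imp_inj_on)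
  have "tC (cI (incl_deriv \<eta>)) \<in> i_lie_algebra G GC" for \<eta>
    unfolding i_lie_algebra_def lie_algebra_G lie_I_tangent[symmetric] by blast
  then have "(\<one>\<^bsub>G\<^esub>, tC (cI (incl_deriv \<zeta>))) = (\<one>\<^bsub>G\<^esub>, tC (cI (incl_deriv (2 *\<^sub>R \<zeta>))))"
    using eq by (intro inj_onD[OF inj]) auto
  then have "cI (incl_deriv \<zeta>) = 2 *\<^sub>R cI (incl_deriv \<zeta>)"
    by (simp add: tC_inject linear_cmul[OF linear_incl_deriv] linear_cmul[OF linear_cI])
  then have "cI (incl_deriv \<zeta>) = 0"
    by (metis add_cancel_right_right scaleR_2)
  then show False
    using none one_parameter_zero by auto
qed

end

subsection \<open>Polar coordinates\<close>

context abelian_complexification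
begin

section \<open>Orthonormal coordinates on the Lie algebra\<close>

lemma metric_sym: "\<kappa> \<one> (tG \<zeta>) (tG \<eta>) = \<kappa> \<one> (tG \<eta>) (tG \<zeta>)"
  and metric_linear: "linear (\<lambda>\<zeta>. \<kappa> \<one> (tG \<zeta>) (tG \<eta>))"
proof -
  have sp: "\<one> \<in> topspace (mtop (mfd G))" "tG \<zeta> \<in> tangent_space (mfd G) \<one>" for \<zeta>
    using chart_in_topspace[OF G.manifold cG] tangent_space_eq[OF G.manifold cG] by auto
  note m = metric[unfolded riemannian_metric_def, THEN conjunct1, rule_format, OF sp(1,2,2)]
  show "\<kappa> \<one> (tG \<zeta>) (tG \<eta>) = \<kappa> \<one> (tG \<eta>) (tG \<zeta>)"
    using m by blast
  have lin: "\<kappa> \<one> (tG (r *\<^sub>R \<zeta> + s *\<^sub>R \<zeta>')) (tG \<eta>) = r * \<kappa> \<one> (tG \<zeta>) (tG \<eta>) + s * \<kappa> \<one> (tG \<zeta>') (tG \<eta>)"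
    for r s \<zeta> \<zeta>'
    using m[of \<zeta> \<zeta>'] sp(2)[of \<eta>]
    by (simp add: tangent_tplus[OF G.manifold cG] tangent_tscale[OF G.manifold cG])
  show "linear (\<lambda>\<zeta>. \<kappa> \<one> (tG \<zeta>) (tG \<eta>))"
  proof (rule linearI)
    show "\<kappa> \<one> (tG (\<zeta> + \<zeta>')) (tG \<eta>) = \<kappa> \<one> (tG \<zeta>) (tG \<eta>) + \<kappa> \<one> (tG \<zeta>') (tG \<eta>)" for \<zeta> \<zeta>'
      using lin[of 1 \<zeta> 1 \<zeta>'] by simp
    show "\<kappa> \<one> (tG (r *\<^sub>R \<zeta>)) (tG \<eta>) = r *\<^sub>R \<kappa> \<one> (tG \<zeta>) (tG \<eta>)" for r \<zeta>
      using lin[of r \<zeta> 0 \<zeta>] by simp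
  qed
qed

definition basis_vec :: "'m \<Rightarrow> real^'m" where
  "basis_vec a = (SOME \<zeta>. X a = tG \<zeta>)"

lemma X_eq: "X a = tG (basis_vec a)"
proof -
  have "\<exists>\<zeta>. X a = tG \<zeta>"
    using basis lie_algebra_G by (auto simp: orthonormal_lie_basis_def)
  from someI_ex[OF this] show ?thesis by (simp only: basis_vec_def)
qed

definition combination :: "real^'m \<Rightarrow> real^'m" where
  "combination r = (\<Sum>a\<in>UNIV. r $ a *\<^sub>R basis_vec a)"

lemma linear_combination: "linear combination"
  by (rule linearI)
    (simp_all add: combination_def sum.distrib scaleR_add_left scaleR_sum_right)

lemma metric_basis_vec: "\<kappa> \<one> (tG (basis_vec a)) (tG (basis_vec b)) = (if a = b then 1 else 0)"
  using basis by (simp add: orthonormal_lie_basis_def one_G X_eq)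

text \<open>Orthonormality makes \<open>combination\<close> an isometry from Euclidean coefficients,
  so the distance function becomes an ordinary sum of squares.\<close>

lemma metric_combination: "\<kappa> \<one> (tG (combination r)) (tG (combination s)) = r \<bullet> s"
proof -
  have 1: "\<kappa> \<one> (tG (combination r)) (tG \<eta>) = (\<Sum>a\<in>UNIV. r $ a * \<kappa> \<one> (tG (basis_vec a)) (tG \<eta>))" for r \<eta>
    unfolding combination_def
    by (simp add: linear_sum[OF metric_linear] linear_cmul[OF metric_linear])
  have "\<kappa> \<one> (tG (combination r)) (tG (basis_vec b)) = r $ b" for r b
    by (simp add: 1 metric_basis_vec if_distrib[where f = "\<lambda>x. _ * x"] cong: if_cong)
  then have "\<kappa> \<one> (tG (basis_vec b)) (tG (combination r)) = r $ b" for r b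
    using metric_sym[of "basis_vec b" "combination r"] by simp
  then show ?thesis by (simp add: 1 inner_vec_def)
qed

lemma combination_inject: "combination r = combination s \<longleftrightarrow> r = s"
proof
  assume "combination r = combination s"
  then have "combination (r - s) = combination 0"
    by (simp add: linear_diff[OF linear_combination] linear_0[OF linear_combination])
  then have "(r - s) \<bullet> (r - s) = (r - s) \<bullet> 0"
    by (metis metric_combination)
  then show "r = s" by simp
qed simp

lemma combination_surj: "\<exists>r. combination r = \<zeta>"
proof -
  obtain r where r: "tG \<zeta> = (\<lambda>f. \<Sum>a\<in>UNIV. r a * X a f)"
    using basis lie_algebra_G unfolding orthonormal_lie_basis_def by blast
  have "(\<Sum>a\<in>UNIV. r a * X a f) = tG (\<Sum>a\<in>UNIV. r a *\<^sub>R basis_vec a) f" for f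
    by (simp add: X_eq linear_sum[OF tangent_linear[OF G.manifold cG]]
        linear_cmul[OF tangent_linear[OF G.manifold cG]])
  then have "tG (combination (\<chi> a. r a)) = tG \<zeta>"
    unfolding r by (simp add: combination_def)
  then show ?thesis
    by (auto simp: tG_inject)
qed

lemma lie_algebra_combination: "lie_algebra G = range (\<lambda>r. tG (combination r))"
  unfolding lie_algebra_G using combination_surj by (auto simp: image_iff) (metis rangeI)

text \<open>The chart coordinates of the vector with coefficients \<open>r\<close> in the basis
  \<open>Y^a\<close>.\<close>

definition polar_vec :: "real^'m \<Rightarrow> complex^'m" where
  "polar_vec r = cI (incl_deriv (combination r))"

lemma linear_polar_vec: "linear polar_vec"
  using linear_compose[OF linear_combination linear_compose[OF linear_incl_deriv linear_cI]]
  by (simp add: polar_vec_def[abs_def] o_def)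

lemma polar_vec_inject: "polar_vec r = polar_vec s \<longleftrightarrow> r = s"
proof
  assume "polar_vec r = polar_vec s"
  then have "(\<lambda>(\<zeta>, \<zeta>'). incl_deriv \<zeta> + cI (incl_deriv \<zeta>')) (0, combination r) =
      (\<lambda>(\<zeta>, \<zeta>'). incl_deriv \<zeta> + cI (incl_deriv \<zeta>')) (0, combination s)"
    by (simp add: polar_vec_def)
  from injD[OF bij_is_inj[OF bij_complexified] this] show "r = s"
    by (simp add: combination_inject)
qed simp

lemma i_lie_algebra_eq: "i_lie_algebra G GC = range (\<lambda>r. tC (polar_vec r))"
  unfolding i_lie_algebra_def lie_algebra_combination
  by (simp add: image_image lie_I_tangent polar_vec_def)

section \<open>The exponential on the imaginary part of the Lie algebra\<close>

definition pexp :: "real^'m \<Rightarrow> 'g" where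
  "pexp r = lie_exp GC (tC (polar_vec r))"

text \<open>The exponential of a multiple is the time-1 value of a rescaled subgroup, that is, a
  value of the original subgroup; existence comes from the polar decomposition.\<close>

lemma one_parameter_pexp: "one_parameter_subgroup GC (tC (polar_vec r)) (\<lambda>t. pexp (t *\<^sub>R r))"
proof -
  obtain \<gamma> where \<gamma>: "one_parameter_subgroup GC (tC (polar_vec r)) \<gamma>"
    using one_parameter_exists by (auto simp: polar_vec_def)
  have "pexp (t *\<^sub>R r) = \<gamma> t" for t
    using GC.lie_exp_eq[OF one_parameter_scale[OF \<gamma>, of t]]
    by (simp add: pexp_def linear_cmul[OF linear_polar_vec])
  then show ?thesis using \<gamma> by simp
qed

lemma pexp_carrier: "pexp r \<in> carrier GC"
  using GC.one_parameter_subgroup_carrier[OF one_parameter_pexp[of r], of 1] by simp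

lemma pexp_curve: "has_mderiv (mfd GC) cC (\<lambda>t. pexp (t *\<^sub>R r)) 0 (\<lambda>t. t *\<^sub>R polar_vec r)"
proof -
  obtain \<xi> where \<xi>: "tC (polar_vec r) = tC \<xi>" and D: "has_mderiv (mfd GC) cC (\<lambda>t. pexp (t *\<^sub>R r)) 0 (\<lambda>t. t *\<^sub>R \<xi>)"
    using GC.one_parameter_subgroup_has_mderiv[OF one_parameter_pexp cC] .
  have "\<xi> = polar_vec r" using \<xi> by (simp add: tC_inject)
  then show ?thesis using D by simp
qed

lemma pexp_scale_add: "pexp ((s + t) *\<^sub>R r) = pexp (s *\<^sub>R r) \<otimes> pexp (t *\<^sub>R r)"
  using one_parameter_pexp[of r] by (simp add: one_parameter_subgroup_def)

lemma pexp_zero: "pexp 0 = \<one>"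
  using GC.hom_zero_one(1)[of "\<lambda>t. pexp (t *\<^sub>R 0)", OF pexp_scale_add pexp_carrier] by simp

lemma bij_polar: "bij_betw (\<lambda>(V, r). V \<otimes> pexp r) (carrier G \<times> UNIV) (carrier GC)"
proof -
  have b: "bij_betw (\<lambda>(V, Y). V \<otimes> lie_exp GC Y) (carrier G \<times> i_lie_algebra G GC) (carrier GC)"
    using complexification by (simp add: complexification_def)
  have "bij_betw (map_prod (\<lambda>V. V) (\<lambda>r. tC (polar_vec r))) (carrier G \<times> UNIV) (carrier G \<times> i_lie_algebra G GC)"
    unfolding i_lie_algebra_eq
    by (intro bij_betw_map_prod bij_betw_imageI) (auto simp: inj_on_def tC_inject polar_vec_inject)
  from bij_betw_trans[OF this b] show ?thesis
    by (simp add: o_def case_prod_beta' pexp_def)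
qed

lemma polar_inject:
  assumes "V \<in> carrier G" "V' \<in> carrier G" "V \<otimes> pexp r = V' \<otimes> pexp r'"
  shows "V = V' \<and> r = r'"
  using inj_onD[OF bij_betw_imp_inj_on[OF bij_polar], of "(V, r)" "(V', r')"] assms by simp

lemma polar_obtain:
  assumes "W \<in> carrier GC"
  obtains V r where "V \<in> carrier G" "W = V \<otimes> pexp r"
proof -
  have "W \<in> (\<lambda>(V, r). V \<otimes> pexp r) ` (carrier G \<times> UNIV)"
    using bij_betw_imp_surj_on[OF bij_polar] assms by simp
  then show ?thesis using that by auto
qed

lemma G_comm: "x \<in> carrier G \<Longrightarrow> y \<in> carrier G \<Longrightarrow> x \<otimes> y = y \<otimes> x"
  using comm_monoid.m_comm[OF comm_group.axioms(1)[OF comm_G]] mult_G by metis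

lemma centralizer_pexp:
  assumes "h \<in> carrier GC" "\<And>x. x \<in> carrier G \<Longrightarrow> h \<otimes> x = x \<otimes> h"
  shows "h \<otimes> pexp r = pexp r \<otimes> h"
  using centralizer_one_parameter[OF assms, of "combination r" "\<lambda>t. pexp (t *\<^sub>R r)" 1]
    one_parameter_pexp[of r] by (simp add: lie_I_tangent polar_vec_def)

lemma comm_GC: "comm_group GC"
proof (rule GC.group_comm_groupI)
  \<comment> \<open>The centralizer argument is applied twice: to elements of \<open>G\<close>,
    which commute with \<open>G\<close> by hypothesis, and then to exponentials, which commute with
    \<open>G\<close> by the first application.\<close>
  have 1: "V \<otimes> pexp r = pexp r \<otimes> V" if "V \<in> carrier G" for V r
    using centralizer_pexp G_subset G_comm that by blast
  have 2: "pexp r \<otimes> pexp s = pexp s \<otimes> pexp r" for r s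
    using centralizer_pexp[OF pexp_carrier] 1 by metis
  fix x y assume "x \<in> carrier GC" "y \<in> carrier GC"
  then obtain V r V' r' where V: "V \<in> carrier G" "V' \<in> carrier G" and xy: "x = V \<otimes> pexp r" "y = V' \<otimes> pexp r'"
    by (metis polar_obtain)
  have c: "V \<in> carrier GC" "V' \<in> carrier GC" "pexp r \<in> carrier GC" "pexp r' \<in> carrier GC"
    using V G_subset pexp_carrier by auto
  have "x \<otimes> y = V \<otimes> (pexp r \<otimes> V') \<otimes> pexp r'"
    using c by (simp add: xy GC.m_assoc)
  also have "\<dots> = V \<otimes> V' \<otimes> (pexp r \<otimes> pexp r')"
    using c by (simp add: 1[OF V(2), symmetric] GC.m_assoc)
  also have "\<dots> = V' \<otimes> (V \<otimes> pexp r') \<otimes> pexp r"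
    using c by (simp add: G_comm[OF V] 2[of r] GC.m_assoc)
  also have "\<dots> = y \<otimes> x"
    using c by (simp add: xy 1[OF V(1)] GC.m_assoc)
  finally show "x \<otimes> y = y \<otimes> x" .
qed

sublocale GC: comm_group GC
  by (rule comm_GC)

text \<open>In a commutative group the product of two one-parameter subgroups is again a
  homomorphism, and its velocity is the sum; uniqueness concludes.\<close>

lemma pexp_add: "pexp (r + s) = pexp r \<otimes> pexp s"
proof -
  have "(\<lambda>t. pexp (t *\<^sub>R (r + s))) = (\<lambda>t. pexp (t *\<^sub>R r) \<otimes> pexp (t *\<^sub>R s))"
  proof (rule GC.one_parameter_unique[OF pexp_scale_add pexp_carrier _ _ pexp_curve])
    show "pexp ((u + t) *\<^sub>R r) \<otimes> pexp ((u + t) *\<^sub>R s) =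
        pexp (u *\<^sub>R r) \<otimes> pexp (u *\<^sub>R s) \<otimes> (pexp (t *\<^sub>R r) \<otimes> pexp (t *\<^sub>R s))" for u t
      unfolding pexp_scale_add by (simp add: pexp_carrier GC.m_ac)
    have "has_mderiv (mfd GC) cC (\<lambda>t. pexp (t *\<^sub>R r) \<otimes> pexp (t *\<^sub>R s)) 0
        (\<lambda>t. t *\<^sub>R polar_vec r + t *\<^sub>R polar_vec s)"
      by (rule GC.has_mderiv_mult_one[OF pexp_curve pexp_curve]) (simp_all add: pexp_zero)
    then show "has_mderiv (mfd GC) cC (\<lambda>t. pexp (t *\<^sub>R r) \<otimes> pexp (t *\<^sub>R s)) 0
        (\<lambda>t. t *\<^sub>R polar_vec (r + s))"
      by (simp add: linear_add[OF linear_polar_vec] scaleR_add_right)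
  qed (simp add: pexp_carrier)
  from fun_cong[OF this, of 1] show ?thesis by simp
qed

section \<open>The homomorphism \<open>y\<close>, as coefficients with respect to the
  \<open>Y^a\<close>\<close>

definition coord :: "'g \<Rightarrow> real^'m" where
  "coord W = (THE r. \<exists>V\<in>carrier G. W = V \<otimes> pexp r)"

lemma coord_polar: "V \<in> carrier G \<Longrightarrow> coord (V \<otimes> pexp r) = r"
  unfolding coord_def by (rule the_equality) (auto dest: polar_inject)

lemma polar_decomposition:
  assumes "W \<in> carrier GC"
  obtains V where "V \<in> carrier G" "W = V \<otimes> pexp (coord W)"
  using assms by (metis polar_obtain coord_polar)

text \<open>Commutativity rearranges the product of two polar decompositions into one,
  \<open>pexp_add\<close> adds the exponents, and uniqueness of the decomposition reads off the
  sum.\<close>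

lemma coord_mult:
  assumes "W \<in> carrier GC" "W' \<in> carrier GC"
  shows "coord (W \<otimes> W') = coord W + coord W'"
proof -
  obtain V where V: "V \<in> carrier G" "W = V \<otimes> pexp (coord W)"
    using polar_decomposition[OF assms(1)] .
  obtain V' where V': "V' \<in> carrier G" "W' = V' \<otimes> pexp (coord W')"
    using polar_decomposition[OF assms(2)] .
  have "W \<otimes> W' = V \<otimes> pexp (coord W) \<otimes> (V' \<otimes> pexp (coord W'))"
    using V(2) V'(2) by simp
  also have "\<dots> = V \<otimes> V' \<otimes> pexp (coord W + coord W')"
    using V(1) V'(1) by (simp add: pexp_add pexp_carrier G_subset GC.m_ac)
  finally show ?thesis
    using V(1) V'(1) coord_polar subgroup.m_closed[OF subgroup_G] by metis
qed

lemma coord_G: "V \<in> carrier G \<Longrightarrow> coord V = 0"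
  using coord_polar[of V 0] by (simp add: pexp_zero G_subset)

lemma coord_pexp: "coord (pexp r) = r"
  using coord_polar[of \<one> r] G.one_closed by (simp add: pexp_carrier one_G)

lemma coord_one: "coord \<one> = 0"
  using coord_pexp[of 0] by (simp add: pexp_zero)

lemma coord_inv: "W \<in> carrier GC \<Longrightarrow> coord (inv W) = - coord W"
  using coord_mult[of "inv W" W] by (simp add: coord_one eq_neg_iff_add_eq_0)

lemma polar_part_eq:
  assumes "W \<in> carrier GC"
  shows "polar_part G GC W = tC (polar_vec (coord W))"
proof -
  obtain V where V: "V \<in> carrier G" "W = V \<otimes> pexp (coord W)"
    using polar_decomposition[OF assms] .
  show ?thesis
    unfolding polar_part_def i_lie_algebra_eq
  proof (rule the_equality)
    show "tC (polar_vec (coord W)) \<in> range (\<lambda>r. tC (polar_vec r)) \<and>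
        (\<exists>V\<in>carrier G. W = V \<otimes> lie_exp GC (tC (polar_vec (coord W))))"
      using V unfolding pexp_def by blast
  qed (auto simp: coord_polar simp flip: pexp_def)
qed

text \<open>By uniqueness of real and imaginary parts the only admissible decomposition has real
  part 0, so the definite description reduces to the metric on the imaginary parts.\<close>

lemma complexified_inner_polar_vec:
  "complexified_inner G GC \<kappa> (tC (polar_vec r)) (tC (polar_vec s)) = r \<bullet> s"
proof -
  have eq: "tC (polar_vec r) = tplus (lie_incl G GC (tG \<zeta>)) (lie_I G GC (tG \<zeta>')) \<longleftrightarrow>
      \<zeta> = 0 \<and> \<zeta>' = combination r" for r \<zeta> \<zeta>'
  proof -
    have "incl_deriv 0 = 0" by (rule linear_0[OF linear_incl_deriv])
    then show ?thesis
      using injD[OF bij_is_inj[OF bij_complexified], of "(\<zeta>, \<zeta>')" "(0, combination r)"]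
      by (auto simp: complexified_eq tC_inject polar_vec_def)
  qed
  have "\<kappa> \<one> (tG 0) (tG 0) = 0" by (rule linear_0[OF metric_linear])
  then show ?thesis
    unfolding complexified_inner_def lie_algebra_G Set.bex_simps(7) eq one_G
    by (simp add: eq metric_combination)
qed

end

subsection \<open>Smoothness of the polar coordinates\<close>

context abelian_complexification
begin

text \<open>Differentiability along lines does not by itself give a total derivative. Additivity
  writes \<open>pexp\<close> as a product of curves, one per coordinate, and the product rule yields
  the total derivative.\<close>

lemma pexp_has_mderiv_zero: "has_mderiv (mfd GC) cC pexp 0 polar_vec"
proof -
  \<comment> \<open>\<open>R A\<close> keeps the coordinates in \<open>A\<close>; the induction on
    \<open>A\<close> adds one curve to the product at a time.\<close>
  define R where "R A r = (\<chi> a. if a \<in> A then r $ a else 0)" for A and r :: "real^'m"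
  have "has_mderiv (mfd GC) cC (\<lambda>r. pexp (R A r)) 0 (\<lambda>r. polar_vec (R A r))" if "finite A" for A
    using that
  proof (induction A)
    case empty
    have "R {} r = 0" for r by (simp add: R_def vec_eq_iff)
    then show ?case
      using has_mderiv_const[OF cC] by (simp add: pexp_zero linear_0[OF linear_polar_vec])
  next
    case (insert a A)
    have R: "R (insert a A) r = R A r + r $ a *\<^sub>R axis a 1" for r
      using insert(2) by (auto simp: R_def vec_eq_iff axis_def)
    have R0: "R A 0 = 0"
      by (simp add: R_def vec_eq_iff)
    have "has_mderiv (mfd GC) cC (\<lambda>r. pexp (r $ a *\<^sub>R axis a 1)) 0 (\<lambda>r. r $ a *\<^sub>R polar_vec (axis a 1))"
      by (rule has_mderiv_compose[where g = "\<lambda>r. r $ a" and H = "\<lambda>t. pexp (t *\<^sub>R axis a 1)"])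
        (auto intro!: bounded_linear_imp_has_derivative bounded_linear_vec_nth simp: pexp_curve)
    from GC.has_mderiv_mult_one[OF insert(3) this] R0
    show ?case
      by (simp add: R pexp_add linear_add[OF linear_polar_vec] linear_cmul[OF linear_polar_vec] pexp_zero)
  qed
  from this[of UNIV] show ?thesis by (simp add: R_def vec_nth_inverse)
qed

text \<open>\<open>pexp s\<close> is \<open>pexp (s - r)\<close> times \<open>pexp r\<close>, which
  moves the question at \<open>r\<close> to the known derivative at 0.\<close>

lemma pexp_has_mderiv:
  assumes "c \<in> charts (mfd GC)" "pexp r \<in> fst c"
  shows "\<exists>D. has_mderiv (mfd GC) c pexp r D"
proof -
  have "has_mderiv (mfd GC) cC (\<lambda>s. pexp (s - r)) r polar_vec"
    by (rule has_mderiv_compose[where g = "\<lambda>s. s - r" and D = polar_vec and g' = "\<lambda>h. h"])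
      (auto simp: pexp_has_mderiv_zero intro!: derivative_eq_intros)
  from GC.has_mderiv_mult_right[OF this _ assms] show ?thesis
    by (auto simp: pexp_zero simp flip: pexp_add)
qed

lemma incl_has_mderiv_at:
  assumes "p \<in> fst cG" "c \<in> charts (mfd GC)" "p \<in> fst c"
  shows "\<exists>D. has_mderiv (mfd GC) c (chart_inv cG) (snd cG p) D"
proof -
  have "smooth_map (mfd G) (mfd GC) (\<lambda>x. x)"
    using complexification by (simp add: complexification_def)
  from has_mderiv_map[OF G.is_chart[OF cG(1)] GC.is_chart[OF assms(2)] this
      manifold_chart(2)[OF G.manifold cG(1) assms(1)] assms(2)]
  show ?thesis
    using manifold_chart(1)[OF G.manifold cG(1) assms(1)] assms(3) by auto
qed

text \<open>The differential of the polar map, in coordinates, at the identity of \<open>G\<close>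
  and exponent 0.\<close>

definition polar_deriv :: "(real^'m) \<times> (real^'m) \<Rightarrow> complex^'m" where
  "polar_deriv x = incl_deriv (fst x) + polar_vec (snd x)"

lemma linear_polar_deriv: "linear polar_deriv"
  by (rule linearI) (simp_all add: polar_deriv_def linear_add[OF linear_incl_deriv]
      linear_add[OF linear_polar_vec] linear_cmul[OF linear_incl_deriv] linear_cmul[OF linear_polar_vec]
      scaleR_add_right)

lemma bij_polar_deriv: "bij polar_deriv"
proof -
  have "bij combination"
    using combination_surj by (auto simp: bij_def inj_def combination_inject surj_def) metis
  then have "bij (map_prod (\<lambda>\<zeta> :: real^'m. \<zeta>) combination)"
    using bij_betw_map_prod[of "\<lambda>\<zeta> :: real^'m. \<zeta>" UNIV UNIV combination UNIV UNIV]
    by (simp add: bij_id[unfolded id_def])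
  from bij_comp[OF this bij_complexified] show ?thesis
    by (simp add: polar_deriv_def[abs_def] polar_vec_def o_def case_prod_beta')
qed

text \<open>The polar map is differentiable with invertible derivative at the identity. Its inverse is
  known to exist, so differentiability of the inverse needs no derivative away from the identity.\<close>

lemma coord_differentiable_one: "(coord \<circ> chart_inv cC) differentiable (at (snd cC \<one>))"
proof -
  define \<Psi> where "\<Psi> x = chart_inv cG (fst x) \<otimes> pexp (snd x)" for x
  define S where "S = {x. fst x \<in> snd cG ` fst cG \<and> \<Psi> x \<in> fst cC}"
  define L where "L = inv_into UNIV polar_deriv"
  define x0 where "x0 = (snd cG \<one>, 0 :: real^'m)"
  \<comment> \<open>\<open>f\<close> is the polar map in coordinates followed by the inverse
    \<open>L\<close> of its derivative: source and target become the same space, as the inverse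
    function theorem demands, and the derivative at \<open>x0\<close> is the identity.
    \<open>g\<close> is its left inverse, read off from the polar decomposition.\<close>
  define f where "f x = L (snd cC (\<Psi> x))" for x
  define g where "g y = (let W = chart_inv cC (polar_deriv y)
    in (snd cG (W \<otimes> inv (pexp (coord W))), coord W))" for y
  have L: "polar_deriv (L u) = u" "L (polar_deriv x) = x" for u x
    using bij_polar_deriv by (simp_all add: L_def bij_is_surj surj_f_inv_f bij_is_inj)
  have "L (u + v) = L u + L v" "L (r *\<^sub>R u) = r *\<^sub>R L u" for u v r
    using L(2)[of "L u + L v"] L(2)[of "r *\<^sub>R L u"]
    by (simp_all add: linear_add[OF linear_polar_deriv] linear_cmul[OF linear_polar_deriv] L(1))
  then have linL: "bounded_linear L"
    by (simp add: linear_conv_bounded_linear[symmetric] linearI)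
  \<comment> \<open>Derivatives away from \<open>x0\<close> serve to make \<open>S\<close> open and
    \<open>f\<close> continuous; their invertibility is not at issue.\<close>
  have der: "\<exists>D. has_mderiv (mfd GC) cC \<Psi> x D" if "x \<in> S" for x
  proof -
    from that obtain p where p: "p \<in> fst cG" "fst x = snd cG p"
      by (auto simp: S_def)
    have inv: "chart_inv cG (fst x) = p"
      using manifold_chart(1)[OF G.manifold cG(1) p(1)] p(2) by simp
    have "p \<in> carrier GC"
      using G.chart_carrier[OF cG(1) p(1)] G_subset by blast
    then obtain c1 where c1: "c1 \<in> charts (mfd GC)" "p \<in> fst c1"
      by (rule GC.obtain_chart)
    obtain c2 where c2: "c2 \<in> charts (mfd GC)" "pexp (snd x) \<in> fst c2"
      by (rule GC.obtain_chart[OF pexp_carrier])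
    obtain D1 where "has_mderiv (mfd GC) c1 (chart_inv cG) (fst x) D1"
      using incl_has_mderiv_at[OF p(1) c1] p(2) by auto
    from has_mderiv_compose[OF this has_derivative_fst[OF has_derivative_ident]]
    have 1: "has_mderiv (mfd GC) c1 (\<lambda>x. chart_inv cG (fst x)) x (\<lambda>\<xi>. D1 (fst \<xi>))" .
    obtain D2 where "has_mderiv (mfd GC) c2 pexp (snd x) D2"
      using pexp_has_mderiv[OF c2] by auto
    from has_mderiv_compose[OF this has_derivative_snd[OF has_derivative_ident]]
    have 2: "has_mderiv (mfd GC) c2 (\<lambda>x. pexp (snd x)) x (\<lambda>\<xi>. D2 (snd \<xi>))" .
    show ?thesis
      using GC.has_mderiv_mult[OF 1 2 cC(1)] that unfolding S_def \<Psi>_def[abs_def] by blast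
  qed
  have one: "chart_inv cG (snd cG \<one>) = \<one>"
    by (rule manifold_chart(1)[OF G.manifold cG])
  have x0: "x0 \<in> S" and \<Psi>0: "\<Psi> x0 = \<one>"
    using cG(2) cC(2) by (auto simp: S_def x0_def \<Psi>_def one pexp_zero)
  have opS: "open S"
    unfolding open_subopen[of S]
  proof
    fix x assume x: "x \<in> S"
    then obtain D where "has_mderiv (mfd GC) cC \<Psi> x D" using der by blast
    then obtain T where T: "open T" "x \<in> T" "\<And>y. y \<in> T \<Longrightarrow> \<Psi> y \<in> fst cC"
      unfolding has_mderiv_def eventually_nhds by blast
    have "open (T \<inter> fst -` (snd cG ` fst cG))"
      using T(1) open_chart_image[OF G.is_chart[OF cG(1)]] by (intro open_Int open_vimage_fst)
    moreover have "T \<inter> fst -` (snd cG ` fst cG) \<subseteq> S"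
      using T(3) by (auto simp: S_def)
    ultimately show "\<exists>T. open T \<and> x \<in> T \<and> T \<subseteq> S"
      using T(2) x by (intro exI[of _ "T \<inter> fst -` (snd cG ` fst cG)"]) (auto simp: S_def)
  qed
  have contf: "continuous_on S f"
  proof (rule continuous_at_imp_continuous_on, rule ballI)
    fix x assume "x \<in> S"
    then obtain D where "((\<lambda>x. snd cC (\<Psi> x)) has_derivative D) (at x)"
      using der unfolding has_mderiv_def by blast
    from bounded_linear.has_derivative[OF linL this] show "isCont f x"
      unfolding f_def[abs_def] by (rule has_derivative_continuous)
  qed
  have gf: "g (f x) = x" if x: "x \<in> S" for x
  proof -
    from x obtain p where p: "p \<in> fst cG" "fst x = snd cG p"
      by (auto simp: S_def)
    have inv: "chart_inv cG (fst x) = p"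
      using manifold_chart(1)[OF G.manifold cG(1) p(1)] p(2) by simp
    have pG: "p \<in> carrier G"
      by (rule G.chart_carrier[OF cG(1) p(1)])
    have "chart_inv cC (polar_deriv (f x)) = p \<otimes> pexp (snd x)"
      using manifold_chart(1)[OF GC.manifold cC(1), of "\<Psi> x"] x by (simp add: f_def L S_def \<Psi>_def inv)
    moreover have "p \<otimes> pexp (snd x) \<otimes> inv (pexp (snd x)) = p"
      using pG by (simp add: GC.m_assoc pexp_carrier G_subset)
    ultimately show ?thesis
      using pG p(2) by (simp add: g_def coord_polar prod_eq_iff)
  qed
  have derf: "(f has_derivative id) (at x0)"
  proof -
    have "has_mderiv (mfd GC) cC (\<lambda>x. chart_inv cG (fst x)) x0 (\<lambda>\<xi>. incl_deriv (fst \<xi>))"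
      by (rule has_mderiv_compose[OF _ has_derivative_fst[OF has_derivative_ident]])
        (simp add: x0_def incl_has_mderiv)
    moreover have "has_mderiv (mfd GC) cC (\<lambda>x. pexp (snd x)) x0 (\<lambda>\<xi>. polar_vec (snd \<xi>))"
      by (rule has_mderiv_compose[OF _ has_derivative_snd[OF has_derivative_ident]])
        (simp add: x0_def pexp_has_mderiv_zero)
    ultimately have "has_mderiv (mfd GC) cC \<Psi> x0 polar_deriv"
      unfolding \<Psi>_def[abs_def] polar_deriv_def[abs_def]
      by (rule GC.has_mderiv_mult_one) (simp_all add: x0_def one pexp_zero)
    then have "((\<lambda>x. snd cC (\<Psi> x)) has_derivative polar_deriv) (at x0)"
      by (simp add: has_mderiv_def)
    from bounded_linear.has_derivative[OF linL this] show ?thesis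
      by (simp add: f_def[abs_def] L id_def)
  qed
  have "(g has_derivative id) (at (f x0))"
    by (rule has_derivative_inverse_strong[OF opS x0 contf gf derf]) simp_all
  then have "(g has_derivative id) (at (L (snd cC \<one>)))"
    by (simp add: f_def \<Psi>0)
  from has_derivative_compose[OF bounded_linear_imp_has_derivative[OF linL] this]
  have "((\<lambda>u. g (L u)) has_derivative L) (at (snd cC \<one>))"
    by simp
  from has_derivative_snd[OF this]
  have "((coord \<circ> chart_inv cC) has_derivative (\<lambda>v. snd (L v))) (at (snd cC \<one>))"
    by (simp add: g_def L Let_def o_def)
  then show ?thesis by (auto simp: differentiable_def)
qed

text \<open>Near \<open>p\<close> the homomorphism property reads \<open>coord q = coord p + coord (p\<inverse> q)\<close>. So the derivative at
  \<open>p\<close> is the one at the identity composed with derivatives of the group operations, which depend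
  smoothly on \<open>p\<close>.\<close>

lemma coord_Ck_on:
  assumes c: "c \<in> charts (mfd GC)"
  shows "Ck_on k (snd c ` fst c) (\<lambda>z. coord (chart_inv c z))"
proof -
  define D1 where "D1 = frechet_derivative (coord \<circ> chart_inv cC) (at (snd cC \<one>))"
  have D1: "bounded_linear D1"
    unfolding D1_def using coord_differentiable_one frechet_derivative_works has_derivative_bounded_linear by blast
  \<comment> \<open>One order more than required is proved: the derivative is an explicit formula in
    the smooth group operations and no longer involves \<open>coord\<close>, so no induction on
    \<open>k\<close> is needed.\<close>
  have "\<exists>T. open T \<and> z0 \<in> T \<and> Ck_on (Suc k) T (\<lambda>z. coord (chart_inv c z))" if "z0 \<in> snd c ` fst c" for z0
  proof -
    from that obtain p0 where p0: "p0 \<in> fst c" "z0 = snd c p0" by blast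
    obtain ci where ci: "ci \<in> charts (mfd GC)" "inv p0 \<in> fst ci"
      by (rule GC.obtain_chart[of "inv p0"]) (simp add: GC.chart_carrier[OF c p0(1)])
    have sinv: "smooth_map (mfd GC) (mfd GC) (\<lambda>x. inv x)"
      and smul: "smooth_map (prod_mfd (mfd GC) (mfd GC)) (mfd GC) (\<lambda>(x, y). x \<otimes> y)"
      using GC.lie_group by (simp_all add: lie_group_def)
    define T where "T = coord_dom c ci (\<lambda>x. inv x)"
    define \<iota> where "\<iota> = coord_rep c ci (\<lambda>x. inv x)"
    define P where "P = coord_rep (prod_chart ci c) cC (\<lambda>(x, y). x \<otimes> y)"
    define Q where "Q = coord_dom (prod_chart ci c) cC (\<lambda>(x, y). x \<otimes> y)"
    have T: "open T"
      unfolding T_def using sinv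
      by (intro open_coord_dom[OF GC.is_chart[OF c] GC.is_chart[OF ci(1)]]) (simp add: smooth_map_def)
    have T_dest: "\<exists>p. p \<in> fst c \<and> inv p \<in> fst ci \<and> z = snd c p \<and> chart_inv c z = p \<and> \<iota> z = snd ci (inv p)"
      if z: "z \<in> T" for z
    proof -
      from z obtain p where p: "p \<in> fst c" "inv p \<in> fst ci" "z = snd c p"
        by (auto simp: T_def coord_dom_def)
      have "chart_inv c z = p"
        using manifold_chart(1)[OF GC.manifold c p(1)] p(3) by simp
      then show ?thesis
        using p by (auto simp: \<iota>_def coord_rep_def)
    qed
    have "Ck_on (Suc k) T (\<lambda>z. coord (chart_inv c z))"
    proof (rule Ck_on_SucI[OF T])
      fix z assume "z \<in> T"
      from T_dest[OF this] obtain p where p: "p \<in> fst c" "inv p \<in> fst ci" "z = snd c p"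
        "chart_inv c z = p" "\<iota> z = snd ci (inv p)" by blast
      have pc: "p \<in> carrier GC" by (rule GC.chart_carrier[OF c p(1)])
      have "has_mderiv (mfd GC) cC (\<lambda>z'. inv p \<otimes> chart_inv c z') z (\<lambda>v. mult_deriv GC ci (inv p) c p cC (0, v))"
        using GC.has_mderiv_mult[OF has_mderiv_const[OF ci(1) p(2)] manifold_chart(2)[OF GC.manifold c p(1)] cC(1)]
          p pc cC(2) by simp
      from differentiable_chart_compose[OF GC.is_chart[OF cC(1)] this, of coord] coord_differentiable_one
      have "((\<lambda>z'. coord (inv p \<otimes> chart_inv c z')) has_derivative
          (\<lambda>v. D1 (frechet_derivative P (at (\<iota> z, z)) (0, v)))) (at z)"
        using p pc by (simp add: D1_def P_def mult_deriv_def)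
      from has_derivative_add[OF has_derivative_const[of "coord p"] this]
      have "((\<lambda>z'. coord p + coord (inv p \<otimes> chart_inv c z')) has_derivative
          (\<lambda>v. D1 (frechet_derivative P (at (\<iota> z, z)) (0, v)))) (at z)"
        by simp
      moreover have "\<forall>\<^sub>F z' in nhds z. z' \<in> snd c ` fst c"
        using eventually_chart[OF GC.is_chart[OF c] p(1)] p(3) by simp
      then have "\<forall>\<^sub>F z' in nhds z. coord p + coord (inv p \<otimes> chart_inv c z') = coord (chart_inv c z')"
        by (rule eventually_mono)
          (use pc in \<open>simp add: coord_mult coord_inv GC.chart_inv_carrier[OF c]\<close>)
      ultimately show "((\<lambda>z. coord (chart_inv c z)) has_derivative
          (\<lambda>v. D1 (frechet_derivative P (at (\<iota> z, z)) (0, v)))) (at z)"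
        by (rule iffD1[OF has_derivative_cong_nhds, rotated])
    next
      fix v
      have "Ck_on (Suc k) Q P" and \<iota>: "Ck_on k T \<iota>"
        using smul sinv GC.prod_chart_in[OF ci(1) c] cC(1) c ci(1)
        unfolding smooth_map_def smooth_on_def P_def Q_def T_def \<iota>_def by blast+
      then have P: "Ck_on k Q (\<lambda>y. frechet_derivative P (at y) (0, v))"
        by simp
      have "(\<iota> z, z) \<in> Q" if z: "z \<in> T" for z
      proof -
        from T_dest[OF z] obtain p where p: "p \<in> fst c" "inv p \<in> fst ci" "z = snd c p"
          "\<iota> z = snd ci (inv p)" by blast
        have "p \<in> carrier GC" by (rule GC.chart_carrier[OF c p(1)])
        then show ?thesis
          unfolding Q_def coord_dom_def using p cC(2)
          by (intro image_eqI[where x = "(inv p, p)"]) auto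
      qed
      then show "Ck_on k T (\<lambda>z. D1 (frechet_derivative P (at (\<iota> z, z)) (0, v)))"
        by (intro Ck_on_bounded_linear_compose[OF T D1] Ck_on_compose[OF T _ P] Ck_on_Pair[OF T \<iota>]
            Ck_on_linear[OF T] bounded_linear_ident) auto
    qed
    moreover have "z0 \<in> T"
      using p0 ci(2) by (auto simp: T_def coord_dom_def)
    ultimately show ?thesis using T by blast
  qed
  then show ?thesis
    by (rule Ck_on_Suc_imp[OF Ck_on_local])
qed

section \<open>Polar coordinates as test functions\<close>

lemma coord_continuous_map: "continuous_map (mtop (mfd GC)) euclidean coord"
proof (rule pasting_lemma[where I = "charts (mfd GC)" and T = fst and f = "\<lambda>c. coord"])
  fix c assume c: "c \<in> charts (mfd GC)"
  note ch = GC.is_chart[OF c]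
  show "openin (mtop (mfd GC)) (fst c)"
    using ch by (simp add: is_chart_def)
  have "continuous_map (subtopology (mtop (mfd GC)) (fst c)) (top_of_set (snd c ` fst c)) (snd c)"
    using ch by (simp add: is_chart_def homeomorphic_imp_continuous_map)
  moreover have "continuous_map (top_of_set (snd c ` fst c)) euclidean (\<lambda>z. coord (chart_inv c z))"
    using coord_Ck_on[OF c, of 0] by simp
  ultimately have "continuous_map (subtopology (mtop (mfd GC)) (fst c)) euclidean
      ((\<lambda>z. coord (chart_inv c z)) \<circ> snd c)"
    by (rule continuous_map_compose)
  then show "continuous_map (subtopology (mtop (mfd GC)) (fst c)) euclidean coord"
    by (rule continuous_map_eq) (simp add: chart_inv_snd[OF ch])
next
  fix W assume "W \<in> topspace (mtop (mfd GC))"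
  then show "\<exists>c. c \<in> charts (mfd GC) \<and> W \<in> fst c \<and> coord W = coord W"
    using GC.manifold unfolding smooth_manifold_def by blast
qed simp

lemma coord_smooth_map: "smooth_map (mfd GC) real_mfd (\<lambda>W. coord W $ a)"
  unfolding smooth_map_def
proof (intro conjI ballI)
  have "continuous_map euclidean euclidean (\<lambda>r :: real^'m. r $ a)"
    by (simp add: continuous_on_component)
  from continuous_map_compose[OF coord_continuous_map this]
  show "continuous_map (mtop (mfd GC)) (mtop real_mfd) (\<lambda>W. coord W $ a)"
    by (simp add: real_mfd_def o_def)
  fix c c' assume c: "c \<in> charts (mfd GC)" and c': "c' \<in> charts real_mfd"
  have "Ck_on k (snd c ` fst c) (\<lambda>z. coord (chart_inv c z) $ a)" for k
    using open_chart_image[OF GC.is_chart[OF c]] coord_Ck_on[OF c]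
    by (rule Ck_on_bounded_linear_compose[OF _ bounded_linear_vec_nth])
  then show "smooth_on (coord_dom c c' (\<lambda>W. coord W $ a)) (coord_rep c c' (\<lambda>W. coord W $ a))"
    using c' by (simp add: real_mfd_def coord_dom_def coord_rep_def smooth_on_def o_def)
qed

lemma coord_mdifferentiable:
  assumes "W \<in> carrier GC"
  shows "mdifferentiable_at (mfd GC) W (\<lambda>W. coord W $ a)"
proof -
  obtain c where c: "c \<in> charts (mfd GC)" "W \<in> fst c"
    by (rule GC.obtain_chart[OF assms])
  have "Ck_on (Suc 0) (snd c ` fst c) (\<lambda>z. coord (chart_inv c z) $ a)"
    using open_chart_image[OF GC.is_chart[OF c(1)]] coord_Ck_on[OF c(1)]
    by (rule Ck_on_bounded_linear_compose[OF _ bounded_linear_vec_nth])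
  then show ?thesis
    using c(2) by (simp add: mdifferentiable_at_iff[OF GC.manifold c] o_def)
qed

text \<open>The chart of \<open>G\<close> represents \<open>X a\<close> by a family inside
  \<open>G\<close>, where \<open>coord\<close> vanishes; by additivity the differentiated function
  is constant.\<close>

lemma dR_incl_coord:
  assumes U: "U \<in> carrier GC"
  shows "dR GC U (lie_incl G GC (X a)) (\<lambda>W. coord W $ b) = 0"
proof -
  have "((\<lambda>z. coord (chart_inv cG z \<otimes> U) $ b) has_derivative
      (\<lambda>\<zeta>. dR GC U (tC (incl_deriv \<zeta>)) (\<lambda>W. coord W $ b))) (at (snd cG \<one>))"
    by (rule GC.dR_apply[OF incl_has_mderiv manifold_chart(1)[OF G.manifold cG] U coord_mdifferentiable[OF U]])
  moreover have "((\<lambda>z. coord (chart_inv cG z \<otimes> U) $ b) has_derivative (\<lambda>\<zeta>. 0)) (at (snd cG \<one>))"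
  proof (rule iffD2[OF has_derivative_cong_nhds])
    have "\<forall>\<^sub>F z in nhds (snd cG \<one>). z \<in> snd cG ` fst cG"
      using eventually_chart[OF G.is_chart[OF cG(1)] cG(2)] .
    then show "\<forall>\<^sub>F z in nhds (snd cG \<one>). coord (chart_inv cG z \<otimes> U) $ b = coord U $ b"
      by (rule eventually_mono)
        (simp add: coord_mult G_subset U coord_G G.chart_inv_carrier[OF cG(1)])
  qed simp
  ultimately have "(\<lambda>\<zeta>. dR GC U (tC (incl_deriv \<zeta>)) (\<lambda>W. coord W $ b)) = (\<lambda>\<zeta>. 0)"
    by (rule has_derivative_unique)
  from fun_cong[OF this] show ?thesis
    by (simp add: X_eq lie_incl_tangent)
qed

lemma X_eq_combination: "X a = tG (combination (axis a 1))"
proof -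
  have "combination (axis a 1) = (\<Sum>b\<in>UNIV. if b = a then basis_vec b else 0)"
    unfolding combination_def by (intro sum.cong) (auto simp: axis_def)
  then show ?thesis by (simp add: X_eq)
qed

text \<open>Along the exponential curve of \<open>Y^a\<close> additivity makes \<open>coord\<close>
  affine in time, with a slope that does not depend on \<open>U\<close>.\<close>

lemma dR_I_coord:
  assumes U: "U \<in> carrier GC"
  shows "dR GC U (lie_I G GC (X a)) (\<lambda>W. coord W $ b) = (if a = b then 1 else 0)"
proof -
  define r where "r = (axis a 1 :: real^'m)"
  have "((\<lambda>t. coord (pexp (t *\<^sub>R r) \<otimes> U) $ b) has_derivative
      (\<lambda>t. dR GC U (tC (t *\<^sub>R polar_vec r)) (\<lambda>W. coord W $ b))) (at 0)"
    by (rule GC.dR_apply[OF pexp_curve _ U coord_mdifferentiable[OF U]]) (simp add: pexp_zero)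
  moreover have "((\<lambda>t. coord (pexp (t *\<^sub>R r) \<otimes> U) $ b) has_derivative (\<lambda>t. t * r $ b)) (at 0)"
    by (auto simp: coord_mult pexp_carrier U coord_pexp intro!: derivative_eq_intros)
  ultimately have "(\<lambda>t. dR GC U (tC (t *\<^sub>R polar_vec r)) (\<lambda>W. coord W $ b)) = (\<lambda>t. t * r $ b)"
    by (rule has_derivative_unique)
  from fun_cong[OF this, of 1] show ?thesis
    by (simp add: X_eq_combination lie_I_tangent polar_vec_def r_def axis_def)
qed

end

section \<open>Gauge invariance\<close>

lemma has_derivative_zeroI:
  assumes "R x = 0" "\<And>e. e > 0 \<Longrightarrow> \<forall>\<^sub>F z in nhds x. norm (R z) \<le> e * norm (z - x)"
  shows "(R has_derivative (\<lambda>h. 0)) (at x)"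
  unfolding has_derivative_at_alt
proof (intro conjI allI impI)
  fix e :: real assume "e > 0"
  from assms(2)[OF this] show "\<exists>d>0. \<forall>y. norm (y - x) < d \<longrightarrow> norm (R y - R x - 0) \<le> e * norm (y - x)"
    by (simp add: eventually_nhds_metric dist_norm assms(1))
qed simp

text \<open>Converts an error bound in the chart displacements into one in the parameter
  \<open>z\<close>.\<close>

lemma has_derivative_lipschitz:
  assumes "(f has_derivative f') (at x)"
  shows "\<exists>C>0. \<forall>\<^sub>F z in nhds x. norm (f z - f x) \<le> C * norm (z - x)"
proof -
  have lin: "bounded_linear f'" using assms by (rule has_derivative_bounded_linear)
  obtain K where K: "K > 0" "\<And>h. norm (f' h) \<le> norm h * K"
    using bounded_linear.pos_bounded[OF lin] by blast
  have "\<exists>d>0. \<forall>y. norm (y - x) < d \<longrightarrow> norm (f y - f x - f' (y - x)) \<le> 1 * norm (y - x)"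
    using assms unfolding has_derivative_at_alt by (metis zero_less_one)
  then have "\<forall>\<^sub>F z in nhds x. norm (f z - f x - f' (z - x)) \<le> norm (z - x)"
    by (simp add: eventually_nhds_metric dist_norm)
  then have "\<forall>\<^sub>F z in nhds x. norm (f z - f x) \<le> (K + 1) * norm (z - x)"
  proof eventually_elim
    case (elim z)
    have "norm (f z - f x) \<le> norm (f z - f x - f' (z - x)) + norm (f' (z - x))"
      using norm_triangle_ineq[of "f z - f x - f' (z - x)" "f' (z - x)"] by simp
    then show ?case
      using elim K(2)[of "z - x"] by (simp add: algebra_simps)
  qed
  then show ?thesis
    using K(1) by (intro exI[of _ "K + 1"]) simp
qed

lemma finite_links: "finite (links d N)"
  by (simp add: links_def sites_def finite_PiE)

lemma linear_complex_vec:
  assumes "Vector_Spaces.linear (*s) (*) (D :: complex^'m \<Rightarrow> complex)"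
  shows "bounded_linear D"
proof -
  interpret D: Vector_Spaces.linear "(*s) :: complex \<Rightarrow> complex^'m \<Rightarrow> complex^'m" "(*)" D
    by (rule assms)
  have "D (r *\<^sub>R v) = r *\<^sub>R D v" for r v
  proof -
    have "r *\<^sub>R v = complex_of_real r *s v"
      by (simp add: vec_eq_iff) (simp add: scaleR_conv_of_real)
    then show ?thesis
      by (simp add: D.scale scaleR_conv_of_real)
  qed
  then show ?thesis
    by (simp add: linear_conv_bounded_linear[symmetric] linearI D.add)
qed

text \<open>Fields over a variable link set form no normed space, so the chain rule is proved from
  the remainder \<open>R\<close>: holomorphy bounds it by the chart displacements, and these are
  bounded linearly in \<open>z - x\<close>.\<close>

lemma holomorphic_action_chain:
  fixes GC :: "('g, complex^'m) lie_grp" and H :: "link \<Rightarrow> 'a::real_normed_vector \<Rightarrow> 'g"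
  assumes GC: "lie_group GC" and D: "\<And>l. l \<in> links d N \<Longrightarrow> bounded_linear (D l)"
    and eps: "\<And>e. e > 0 \<Longrightarrow> \<exists>\<delta>>0. \<forall>U'\<in>fields d N GC.
            (\<forall>l\<in>links d N. U' l \<in> fst (c l) \<and> norm (snd (c l) (U' l) - snd (c l) (U l)) < \<delta>) \<longrightarrow>
            norm (S U' - S U - (\<Sum>l\<in>links d N. D l (snd (c l) (U' l) - snd (c l) (U l))))
              \<le> e * (\<Sum>l\<in>links d N. norm (snd (c l) (U' l) - snd (c l) (U l)))"
    and U: "U \<in> fields d N GC"
    and H: "\<And>l. l \<in> links d N \<Longrightarrow> has_mderiv (mfd GC) (c l) (H l) x (B l)"
    and Hx: "\<And>l. l \<in> links d N \<Longrightarrow> H l x = U l"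
  shows "((\<lambda>z. S (\<lambda>l\<in>links d N. H l z)) has_derivative (\<lambda>\<xi>. \<Sum>l\<in>links d N. D l (B l \<xi>))) (at x)"
proof -
  interpret lie GC
    using GC by (simp add: lie_def lie_axioms_def lie_group_def)
  define \<Delta> where "\<Delta> l z = snd (c l) (H l z) - snd (c l) (U l)" for l z
  define R where "R z = S (\<lambda>l\<in>links d N. H l z) - S U - (\<Sum>l\<in>links d N. D l (\<Delta> l z))" for z
  have der: "(\<Delta> l has_derivative B l) (at x)" if "l \<in> links d N" for l
  proof -
    have "((\<lambda>z. snd (c l) (H l z)) has_derivative B l) (at x)"
      using H[OF that] by (simp add: has_mderiv_def)
    from has_derivative_diff[OF this has_derivative_const[of "snd (c l) (U l)"]] show ?thesis
      by (simp add: \<Delta>_def[abs_def])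
  qed
  have \<Delta>0: "\<Delta> l x = 0" if "l \<in> links d N" for l
    using that by (simp add: \<Delta>_def Hx)
  have "\<exists>C. \<forall>l\<in>links d N. C l > 0 \<and> (\<forall>\<^sub>F z in nhds x. norm (\<Delta> l z) \<le> C l * norm (z - x))"
    using has_derivative_lipschitz[OF der] \<Delta>0 by (intro bchoice) auto
  then obtain C where C: "\<And>l. l \<in> links d N \<Longrightarrow> C l > 0"
    "\<And>l. l \<in> links d N \<Longrightarrow> \<forall>\<^sub>F z in nhds x. norm (\<Delta> l z) \<le> C l * norm (z - x)" by blast
  have field: "\<forall>\<^sub>F z in nhds x. \<forall>l\<in>links d N. H l z \<in> fst (c l)"
    using H by (intro eventually_ball_finite finite_links) (auto simp: has_mderiv_def)
  have "\<forall>\<^sub>F z in nhds x. \<forall>l\<in>links d N. norm (\<Delta> l z) \<le> C l * norm (z - x)"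
    using C(2) by (intro eventually_ball_finite finite_links) auto
  then have bound: "\<forall>\<^sub>F z in nhds x. (\<Sum>l\<in>links d N. norm (\<Delta> l z)) \<le> (\<Sum>l\<in>links d N. C l) * norm (z - x)"
    by eventually_elim (simp add: sum_distrib_right sum_mono)
  have "(R has_derivative (\<lambda>h. 0)) (at x)"
  proof (rule has_derivative_zeroI)
    have "(\<lambda>l\<in>links d N. H l x) = U"
      using U Hx by (auto simp: fields_def PiE_iff extensional_def)
    moreover have "(\<Sum>l\<in>links d N. D l (\<Delta> l x)) = 0"
      using D by (intro sum.neutral) (auto simp: \<Delta>0 dest: bounded_linear.linear linear_0)
    ultimately show "R x = 0" by (simp add: R_def)
    fix e :: real assume e: "e > 0"
    \<comment> \<open>Compensates the total Lipschitz constant of the displacements; the added 1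
      keeps the denominator positive even without links.\<close>
    define e' where "e' = e / (1 + (\<Sum>l\<in>links d N. C l))"
    have C0: "(\<Sum>l\<in>links d N. C l) \<ge> 0"
      using C(1) by (intro sum_nonneg) (auto intro: less_imp_le)
    then have e': "e' > 0" using e by (simp add: e'_def add_pos_nonneg)
    obtain \<delta> where \<delta>: "\<delta> > 0" "\<And>U'. U' \<in> fields d N GC \<Longrightarrow>
            (\<forall>l\<in>links d N. U' l \<in> fst (c l) \<and> norm (snd (c l) (U' l) - snd (c l) (U l)) < \<delta>) \<Longrightarrow>
            norm (S U' - S U - (\<Sum>l\<in>links d N. D l (snd (c l) (U' l) - snd (c l) (U l))))
              \<le> e' * (\<Sum>l\<in>links d N. norm (snd (c l) (U' l) - snd (c l) (U l)))"
      using eps[OF e'] by blast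
    have small: "\<forall>\<^sub>F z in nhds x. \<forall>l\<in>links d N. norm (\<Delta> l z) < \<delta>"
    proof (intro eventually_ball_finite finite_links ballI)
      fix l assume l: "l \<in> links d N"
      have "\<forall>\<^sub>F z in nhds x. \<Delta> l z \<in> ball 0 \<delta>"
        using has_derivative_continuous[OF der[OF l]] \<delta>(1) \<Delta>0[OF l]
        by (intro isCont_eventually_nhds) auto
      then show "\<forall>\<^sub>F z in nhds x. norm (\<Delta> l z) < \<delta>"
        by (rule eventually_mono) (simp add: dist_norm)
    qed
    show "\<forall>\<^sub>F z in nhds x. norm (R z) \<le> e * norm (z - x)"
      using field small bound
    proof eventually_elim
      case (elim z)
      have "c l \<in> charts (mfd GC)" if "l \<in> links d N" for l
        using has_mderiv_charts[OF H[OF that]] .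
      then have "(\<lambda>l\<in>links d N. H l z) \<in> fields d N GC"
        using elim(1) chart_carrier unfolding fields_def by (intro restrict_PiE_iff[THEN iffD2]) metis
      from \<delta>(2)[OF this] elim(1,2)
      have "norm (R z) \<le> e' * (\<Sum>l\<in>links d N. norm (\<Delta> l z))"
        by (simp add: R_def \<Delta>_def)
      also have "\<dots> \<le> e' * ((\<Sum>l\<in>links d N. C l) * norm (z - x))"
        using elim(3) e' by (intro mult_left_mono) auto
      also have "\<dots> \<le> e' * ((1 + (\<Sum>l\<in>links d N. C l)) * norm (z - x))"
        using e' by (intro mult_left_mono mult_right_mono) auto
      also have "\<dots> = e * norm (z - x)"
        using C0 by (simp add: e'_def field_simps)
      finally show ?case .
    qed
  qed
  moreover have "((\<lambda>z. \<Sum>l\<in>links d N. D l (\<Delta> l z)) has_derivative (\<lambda>\<xi>. \<Sum>l\<in>links d N. D l (B l \<xi>))) (at x)"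
    by (intro has_derivative_sum bounded_linear.has_derivative[OF D] der)
  ultimately have "((\<lambda>z. S U + (R z + (\<Sum>l\<in>links d N. D l (\<Delta> l z)))) has_derivative
      (\<lambda>\<xi>. 0 + (0 + (\<Sum>l\<in>links d N. D l (B l \<xi>))))) (at x)"
    by (intro has_derivative_add has_derivative_const)
  then show ?thesis by (simp add: R_def)
qed

text \<open>The boundary coefficient of the oriented link at the site: 1 at its end, -1 at its
  origin, 0 for a loop. Summing over sites against it gives the lattice gradient; summing over links
  gives the divergence up to sign.\<close>

definition incidence :: "(nat \<Rightarrow> nat) \<Rightarrow> link \<Rightarrow> site \<Rightarrow> real" where
  "incidence N l y = of_bool (shift N (fst l) (snd l) = y) - of_bool (fst l = y)"

context abelian_complexification
begin

text \<open>The total derivative of \<open>S\<close> along gauge transformations at the single site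
  \<open>y\<close> vanishes. Link \<open>l\<close> moves along a right-invariant field with weight
  \<open>incidence N l y\<close>, so the imaginary part in direction \<open>X a\<close> is the
  claim.\<close>

lemma divergence_drift_J:
  assumes hol: "holomorphic_action d N GC S" and inv: "gauge_invariant d N GC S"
    and U: "U \<in> fields d N GC"
  shows "(\<Sum>l\<in>links d N. incidence N l y * drift_J G GC S X a l U) = 0"
proof -
  have Uc: "U l \<in> carrier GC" if "l \<in> links d N" for l
    using U that by (auto simp: fields_def)
  have "\<exists>c. \<forall>l\<in>links d N. c l \<in> charts (mfd GC) \<and> U l \<in> fst (c l)"
  proof (intro bchoice ballI)
    fix l assume "l \<in> links d N"
    from Uc[OF this] show "\<exists>c. c \<in> charts (mfd GC) \<and> U l \<in> fst c"
      by (rule GC.obtain_chart) blast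
  qed
  then obtain c where c: "\<And>l. l \<in> links d N \<Longrightarrow> c l \<in> charts (mfd GC)"
    "\<And>l. l \<in> links d N \<Longrightarrow> U l \<in> fst (c l)" by blast
  obtain D where lin: "\<And>l. l \<in> links d N \<Longrightarrow> Vector_Spaces.linear (*s) (*) (D l)"
    and eps: "\<And>e. e > 0 \<Longrightarrow> \<exists>\<delta>>0. \<forall>U'\<in>fields d N GC.
            (\<forall>l\<in>links d N. U' l \<in> fst (c l) \<and> norm (snd (c l) (U' l) - snd (c l) (U l)) < \<delta>) \<longrightarrow>
            norm (S U' - S U - (\<Sum>l\<in>links d N. D l (snd (c l) (U' l) - snd (c l) (U l))))
              \<le> e * (\<Sum>l\<in>links d N. norm (snd (c l) (U' l) - snd (c l) (U l)))"
    using hol[unfolded holomorphic_action_def, rule_format, OF U, of c] c by blast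
  have bl: "bounded_linear (D l)" if "l \<in> links d N" for l
    by (rule linear_complex_vec[OF lin[OF that]])
  have chain: "((\<lambda>z. S (\<lambda>l\<in>links d N. H l z)) has_derivative (\<lambda>\<xi>. \<Sum>l\<in>links d N. D l (B l \<xi>))) (at x)"
    if "\<And>l. l \<in> links d N \<Longrightarrow> has_mderiv (mfd GC) (c l) (H l) x (B l)" "\<And>l. l \<in> links d N \<Longrightarrow> H l x = U l"
    for H :: "link \<Rightarrow> complex^'m \<Rightarrow> 'g" and x B
    by (rule holomorphic_action_chain[OF GC.lie_group bl eps U that])
  \<comment> \<open>\<open>A l \<xi>\<close> is the velocity at \<open>U l\<close>, in the chart
    \<open>c l\<close>, of the right-invariant field generated by \<open>tC \<xi>\<close>.\<close>
  define A where "A l \<xi> = mult_deriv GC cC \<one> (c l) (U l) (c l) (\<xi>, 0)" for l \<xi>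
  have A: "has_mderiv (mfd GC) (c l) (\<lambda>z. H z \<otimes> U l) x (\<lambda>\<xi>. A l (E \<xi>))"
    if "has_mderiv (mfd GC) cC H x E" "H x = \<one>" "l \<in> links d N"
    for H :: "'a::real_normed_vector \<Rightarrow> 'g" and x E l
    using GC.has_mderiv_mult_right[OF that(1,2) c[OF that(3)]] by (simp add: A_def)
  have linA: "A l (r *\<^sub>R \<xi>) = r *\<^sub>R A l \<xi>" if l: "l \<in> links d N" for l r \<xi>
    using linear_cmul[OF GC.mult_deriv_linear[OF cC(1) c(1)[OF l] c(1)[OF l] cC(2) c(2)[OF l]], of r "(\<xi>, 0)"]
      c(2)[OF l] Uc[OF l] by (simp add: A_def)
  \<comment> \<open>Varying one link with the others frozen isolates the summand \<open>D l\<close>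
    of the total derivative; \<open>drift_J\<close> is such a partial derivative.\<close>
  have single: "((\<lambda>z. Im (S (U(l := H z)))) has_derivative (\<lambda>\<xi>. Im (D l (E \<xi>)))) (at x)"
    if l: "l \<in> links d N" and H: "has_mderiv (mfd GC) (c l) H x E" "H x = U l"
    for l and H :: "complex^'m \<Rightarrow> 'g" and x E
  proof -
    have "((\<lambda>z. S (\<lambda>l'\<in>links d N. if l' = l then H z else U l')) has_derivative
        (\<lambda>\<xi>. \<Sum>l'\<in>links d N. D l' (if l' = l then E \<xi> else 0))) (at x)"
    proof (rule chain)
      fix l' assume l': "l' \<in> links d N"
      show "has_mderiv (mfd GC) (c l') (\<lambda>z. if l' = l then H z else U l') x (\<lambda>\<xi>. if l' = l then E \<xi> else 0)"
        using H has_mderiv_const[OF c[OF l']] by (cases "l' = l") simp_all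
    qed (use H(2) in auto)
    moreover have "(\<lambda>l'\<in>links d N. if l' = l then H z else U l') = U(l := H z)" for z
      using U l by (auto simp: fields_def PiE_iff extensional_def)
    moreover have "(\<Sum>l'\<in>links d N. D l' (if l' = l then E \<xi> else 0)) = D l (E \<xi>)" for \<xi>
    proof -
      have "(\<Sum>l'\<in>links d N. D l' (if l' = l then E \<xi> else 0)) = (\<Sum>l'\<in>links d N. if l' = l then D l (E \<xi>) else 0)"
        using bl by (intro sum.cong) (auto simp: linear_0 bounded_linear.linear)
      then show ?thesis using l finite_links by simp
    qed
    ultimately have "((\<lambda>z. S (U(l := H z))) has_derivative (\<lambda>\<xi>. D l (E \<xi>))) (at x)"
      by simp
    then show ?thesis by (rule has_derivative_Im)
  qed
  \<comment> \<open>The same function is differentiated in two ways, through \<open>dR\<close> and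
    through \<open>D l\<close>; comparison expresses the drift by the total derivative.\<close>
  have drift: "drift_J G GC S X a l U = - Im (D l (A l \<xi>))"
    if l: "l \<in> links d N" and \<xi>: "\<xi> = incl_deriv (basis_vec a)" for l \<xi>
  proof -
    have "((\<lambda>z. Im (S (U(l := chart_inv (c l) z)))) has_derivative (\<lambda>\<xi>. Im (D l \<xi>))) (at (snd (c l) (U l)))"
      by (rule single[OF l manifold_chart(2,1)[OF GC.manifold c[OF l]]])
    then have "mdifferentiable_at (mfd GC) (U l) (\<lambda>W. Im (S (U(l := W))))"
      unfolding mdifferentiable_at_iff[OF GC.manifold c[OF l]] o_def differentiable_def by blast
    from GC.dR_apply[OF manifold_chart(2,1)[OF GC.manifold cC] Uc[OF l] this]
    have 1: "((\<lambda>z. Im (S (U(l := chart_inv cC z \<otimes> U l)))) has_derivative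
        (\<lambda>\<xi>. dR GC (U l) (tC \<xi>) (\<lambda>W. Im (S (U(l := W)))))) (at (snd cC \<one>))" .
    have 2: "((\<lambda>z. Im (S (U(l := chart_inv cC z \<otimes> U l)))) has_derivative
        (\<lambda>\<xi>. Im (D l (A l \<xi>)))) (at (snd cC \<one>))"
      by (rule single[OF l A[OF manifold_chart(2,1)[OF GC.manifold cC] l]])
        (simp add: manifold_chart(1)[OF GC.manifold cC] Uc[OF l])
    from fun_cong[OF has_derivative_unique[OF 1 2], of \<xi>] show ?thesis
      by (simp add: drift_J_def lie_deriv_def X_eq lie_incl_tangent \<xi>)
  qed
  \<comment> \<open>A gauge transformation supported at the site \<open>y\<close>, its value there
    running through a chart at the identity.\<close>
  define g where "g z x = (if x = y then chart_inv cC z else \<one>)" for z and x :: site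
  define H where "H l z = inv (g z (fst l)) \<otimes> U l \<otimes> g z (shift N (fst l) (snd l))" for l z
  have one: "chart_inv cC (snd cC \<one>) = \<one>"
    by (rule manifold_chart(1)[OF GC.manifold cC])
  have "\<forall>\<^sub>F z in nhds (snd cC \<one>). z \<in> snd cC ` fst cC"
    using eventually_chart[OF GC.is_chart[OF cC(1)] cC(2)] .
  then have ev_g: "\<forall>\<^sub>F z in nhds (snd cC \<one>). \<forall>x. g z x \<in> carrier GC"
    by (rule eventually_mono) (simp add: g_def GC.chart_inv_carrier[OF cC(1)])
  have gd: "has_mderiv (mfd GC) cC (\<lambda>z. g z x) (snd cC \<one>) (\<lambda>\<xi>. of_bool (x = y) *\<^sub>R \<xi>)" for x
    using manifold_chart(2)[OF GC.manifold cC] has_mderiv_const[OF cC]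
    by (cases "x = y") (simp_all add: g_def)
  have g1: "g (snd cC \<one>) x = \<one>" for x
    by (simp add: g_def one)
  \<comment> \<open>By commutativity both gauge factors are collected to one side of
    \<open>U l\<close>; their product passes through the identity with velocity
    \<open>incidence N l y *\<^sub>R \<xi>\<close>, also when the link is a loop.\<close>
  have Hd: "has_mderiv (mfd GC) (c l) (H l) (snd cC \<one>) (\<lambda>\<xi>. incidence N l y *\<^sub>R A l \<xi>)"
    if l: "l \<in> links d N" for l
  proof -
    have "has_mderiv (mfd GC) cC (\<lambda>z. inv (g z (fst l)) \<otimes> g z (shift N (fst l) (snd l))) (snd cC \<one>)
        (\<lambda>\<xi>. - (of_bool (fst l = y) *\<^sub>R \<xi>) + of_bool (shift N (fst l) (snd l) = y) *\<^sub>R \<xi>)"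
      by (rule GC.has_mderiv_mult_one[OF GC.has_mderiv_inv_one[OF gd] gd]) (simp_all add: g1)
    from A[OF this _ l] have "has_mderiv (mfd GC) (c l)
        (\<lambda>z. inv (g z (fst l)) \<otimes> g z (shift N (fst l) (snd l)) \<otimes> U l) (snd cC \<one>)
        (\<lambda>\<xi>. A l (incidence N l y *\<^sub>R \<xi>))"
      by (simp add: g1 incidence_def scaleR_diff_left)
    moreover have "\<forall>\<^sub>F z in nhds (snd cC \<one>).
        inv (g z (fst l)) \<otimes> g z (shift N (fst l) (snd l)) \<otimes> U l = H l z"
      using ev_g by (rule eventually_mono) (simp add: H_def Uc[OF l] GC.m_ac)
    ultimately show ?thesis
      by (simp add: linA[OF l] has_mderiv_cong)
  qed
  have "((\<lambda>z. S (\<lambda>l\<in>links d N. H l z)) has_derivative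
      (\<lambda>\<xi>. \<Sum>l\<in>links d N. D l (incidence N l y *\<^sub>R A l \<xi>))) (at (snd cC \<one>))"
    by (rule chain[OF Hd]) (simp_all add: H_def g1 Uc)
  moreover have "\<forall>\<^sub>F z in nhds (snd cC \<one>). S (\<lambda>l\<in>links d N. H l z) = S U"
    using ev_g
  proof (rule eventually_mono)
    fix z assume "\<forall>x. g z x \<in> carrier GC"
    then have "S (gauge_transform d N GC (g z) U) = S U"
      using inv U by (simp add: gauge_invariant_def Pi_def)
    moreover have "gauge_transform d N GC (g z) U = (\<lambda>l\<in>links d N. H l z)"
      unfolding gauge_transform_def H_def by (intro restrict_ext) auto
    ultimately show "S (\<lambda>l\<in>links d N. H l z) = S U" by simp
  qed
  ultimately have "((\<lambda>z. S U) has_derivative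
      (\<lambda>\<xi>. \<Sum>l\<in>links d N. D l (incidence N l y *\<^sub>R A l \<xi>))) (at (snd cC \<one>))"
    using has_derivative_cong_nhds[of "\<lambda>z. S (\<lambda>l\<in>links d N. H l z)" "\<lambda>z. S U"] by simp
  from has_derivative_unique[OF this has_derivative_const]
  have "(\<Sum>l\<in>links d N. D l (incidence N l y *\<^sub>R A l \<xi>)) = 0" for \<xi>
    by (rule fun_cong)
  then have "0 = Im (\<Sum>l\<in>links d N. D l (incidence N l y *\<^sub>R A l \<xi>))" for \<xi>
    by simp
  also have "Im (\<Sum>l\<in>links d N. D l (incidence N l y *\<^sub>R A l \<xi>)) =
      (\<Sum>l\<in>links d N. incidence N l y * Im (D l (A l \<xi>)))" for \<xi>
    unfolding Im_sum using bl
    by (intro sum.cong refl) (simp add: linear_cmul bounded_linear.linear)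
  finally show ?thesis
    by (simp add: drift[OF _ refl] sum_negf cong: sum.cong)
qed

subsection \<open>Minimizers of the distance function\<close>

lemma shift_sites:
  assumes "x \<in> sites d N" "\<mu> \<le> d" "N \<mu> \<ge> 1"
  shows "shift N x \<mu> \<in> sites d N"
  using assms by (auto simp: sites_def shift_def PiE_iff extensional_def)

lemma gauge_transform_fields:
  assumes "\<And>\<mu>. \<mu> \<le> d \<Longrightarrow> N \<mu> \<ge> 1" "U \<in> fields d N GC" "g \<in> sites d N \<rightarrow> carrier GC"
  shows "gauge_transform d N GC g U \<in> fields d N GC"
  using assms unfolding fields_def gauge_transform_def
  by (auto simp: links_def shift_sites PiE_iff intro!: GC.m_closed GC.inv_closed)

text \<open>Only the endpoints of \<open>l\<close> contribute; spreading them over all sites by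
  \<open>incidence\<close> turns the later summation by parts into an exchange of sums.\<close>

lemma coord_gauge_transform:
  assumes N: "\<And>\<mu>. \<mu> \<le> d \<Longrightarrow> N \<mu> \<ge> 1" and U: "U \<in> fields d N GC" and g: "g \<in> sites d N \<rightarrow> carrier GC"
    and l: "l \<in> links d N"
  shows "coord (gauge_transform d N GC g U l) =
    coord (U l) + (\<Sum>y\<in>sites d N. incidence N l y *\<^sub>R coord (g y))"
proof -
  obtain x \<mu> where lx: "l = (x, \<mu>)" by fastforce
  have x: "x \<in> sites d N" and sx: "shift N x \<mu> \<in> sites d N"
    using l N shift_sites by (auto simp: lx links_def)
  have fin: "finite (sites d N)" by (simp add: sites_def finite_PiE)
  have c: "g x \<in> carrier GC" "g (shift N x \<mu>) \<in> carrier GC" "U l \<in> carrier GC"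
    using g x sx U l by (auto simp: fields_def)
  have "(\<Sum>y\<in>sites d N. incidence N l y *\<^sub>R coord (g y)) =
      (\<Sum>y\<in>sites d N. if y = shift N x \<mu> then coord (g y) else 0) -
      (\<Sum>y\<in>sites d N. if y = x then coord (g y) else 0)"
    unfolding sum_subtractf[symmetric]
    by (intro sum.cong) (auto simp: incidence_def lx)
  also have "\<dots> = coord (g (shift N x \<mu>)) - coord (g x)"
    using x sx fin by simp
  finally show ?thesis
    using c l by (simp add: gauge_transform_def lx coord_mult coord_inv)
qed

lemma dist_fun_eq:
  assumes "U \<in> fields d N GC"
  shows "dist_fun d N G GC \<kappa> U = 1/2 * (\<Sum>l\<in>links d N. coord (U l) \<bullet> coord (U l))"
proof -
  have "(\<Sum>l\<in>links d N. coord (U l) \<bullet> coord (U l)) =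
      (\<Sum>x\<in>sites d N. \<Sum>\<mu>=0..d. coord (U (x, \<mu>)) \<bullet> coord (U (x, \<mu>)))"
    by (simp add: links_def sum.cartesian_product case_prod_beta' atLeast0AtMost)
  also have "\<dots> = (\<Sum>x\<in>sites d N. \<Sum>\<mu>=0..d.
     complexified_inner G GC \<kappa> (polar_part G GC (U (x, \<mu>))) (polar_part G GC (U (x, \<mu>))))"
  proof (intro sum.cong refl)
    fix x \<mu> assume "x \<in> sites d N" "\<mu> \<in> {0..d}"
    then have "U (x, \<mu>) \<in> carrier GC"
      using assms by (auto simp: fields_def links_def)
    then show "coord (U (x, \<mu>)) \<bullet> coord (U (x, \<mu>)) =
        complexified_inner G GC \<kappa> (polar_part G GC (U (x, \<mu>))) (polar_part G GC (U (x, \<mu>)))"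
      by (simp add: polar_part_eq complexified_inner_polar_vec)
  qed
  finally show ?thesis by (simp add: dist_fun_def)
qed

text \<open>Expansion of the square after the shift by \<open>w\<close>. Summation by parts moves
  the linear term to the sites, where it pairs the gauge parameter with the divergence.\<close>

lemma dist_fun_gauge_transform:
  assumes N: "\<And>\<mu>. \<mu> \<le> d \<Longrightarrow> N \<mu> \<ge> 1" and U: "U \<in> fields d N GC" and g: "g \<in> sites d N \<rightarrow> carrier GC"
  defines "w \<equiv> \<lambda>l. \<Sum>y\<in>sites d N. incidence N l y *\<^sub>R coord (g y)"
  shows "dist_fun d N G GC \<kappa> (gauge_transform d N GC g U) = dist_fun d N G GC \<kappa> U +
    (\<Sum>y\<in>sites d N. coord (g y) \<bullet> (\<Sum>l\<in>links d N. incidence N l y *\<^sub>R coord (U l))) +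
    1/2 * (\<Sum>l\<in>links d N. w l \<bullet> w l)"
proof -
  have "(\<Sum>l\<in>links d N. coord (gauge_transform d N GC g U l) \<bullet> coord (gauge_transform d N GC g U l)) =
      (\<Sum>l\<in>links d N. coord (U l) \<bullet> coord (U l) + 2 * (w l \<bullet> coord (U l)) + w l \<bullet> w l)"
    by (intro sum.cong refl)
      (simp add: coord_gauge_transform[OF N U g] w_def inner_add_left inner_add_right inner_commute)
  moreover have "(\<Sum>l\<in>links d N. w l \<bullet> coord (U l)) =
      (\<Sum>y\<in>sites d N. coord (g y) \<bullet> (\<Sum>l\<in>links d N. incidence N l y *\<^sub>R coord (U l)))"
    unfolding w_def inner_sum_left inner_sum_right by (subst sum.swap) simp
  ultimately show ?thesis
    by (simp add: dist_fun_eq U gauge_transform_fields[OF N U g] sum.distrib sum_distrib_left[symmetric])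
qed

text \<open>If the divergence vanishes, only a nonnegative quadratic term is left. Conversely, a
  nonzero divergence \<open>q\<close> at one site allows a descent step at that site.\<close>

lemma gauge_minimal_iff:
  assumes N: "\<And>\<mu>. \<mu> \<le> d \<Longrightarrow> N \<mu> \<ge> 1"
  shows "U \<in> gauge_minimal d N G GC \<kappa> \<longleftrightarrow> U \<in> fields d N GC \<and>
    (\<forall>y\<in>sites d N. (\<Sum>l\<in>links d N. incidence N l y *\<^sub>R coord (U l)) = 0)"
proof (intro iffI conjI ballI)
  assume min: "U \<in> gauge_minimal d N G GC \<kappa>"
  then show U: "U \<in> fields d N GC" by (simp add: gauge_minimal_def)
  fix y0 assume y0: "y0 \<in> sites d N"
  define q where "q = (\<Sum>l\<in>links d N. incidence N l y0 *\<^sub>R coord (U l))"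
  define C where "C = (\<Sum>l\<in>links d N. (incidence N l y0)\<^sup>2)"
  \<comment> \<open>A gauge step \<open>s *\<^sub>R q\<close> at \<open>y0\<close> changes the
    distance function by \<open>(s + C * s^2 / 2) * (q \<bullet> q)\<close>. The factor is negative
    for \<open>s < 0\<close> and \<open>C * s > - 2\<close>; this \<open>s\<close> even has
    \<open>C * s > - 1\<close>, and the 1 in the denominator covers \<open>C = 0\<close>.\<close>
  define s where "s = - 1 / (C + 1)"
  define g where "g y = (if y = y0 then pexp (s *\<^sub>R q) else \<one>)" for y
  have fin: "finite (sites d N)" by (simp add: sites_def finite_PiE)
  have g: "g \<in> sites d N \<rightarrow> carrier GC" by (simp add: g_def pexp_carrier)
  have cg: "coord (g y) = (if y = y0 then s *\<^sub>R q else 0)" for y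
    by (simp add: g_def coord_pexp coord_one)
  have w: "(\<Sum>y\<in>sites d N. incidence N l y *\<^sub>R coord (g y)) = (incidence N l y0 * s) *\<^sub>R q" for l
    using fin y0 by (simp add: cg if_distrib[where f = "\<lambda>x. _ *\<^sub>R x"] cong: if_cong)
  have v: "(\<Sum>y\<in>sites d N. coord (g y) \<bullet> (\<Sum>l\<in>links d N. incidence N l y *\<^sub>R coord (U l))) = s * (q \<bullet> q)"
  proof -
    have "(\<Sum>y\<in>sites d N. coord (g y) \<bullet> (\<Sum>l\<in>links d N. incidence N l y *\<^sub>R coord (U l))) =
        (\<Sum>y\<in>sites d N. if y = y0 then s * (q \<bullet> q) else 0)"
      by (intro sum.cong) (auto simp: cg q_def)
    then show ?thesis using fin y0 by simp
  qed
  have "dist_fun d N G GC \<kappa> U \<le> dist_fun d N G GC \<kappa> (gauge_transform d N GC g U)"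
    using min g by (simp add: gauge_minimal_def)
  also have "\<dots> = dist_fun d N G GC \<kappa> U + s * (q \<bullet> q) + 1/2 * (\<Sum>l\<in>links d N. (incidence N l y0)\<^sup>2 * (s\<^sup>2 * (q \<bullet> q)))"
    using dist_fun_gauge_transform[OF N U g] by (simp add: w v power2_eq_square mult_ac)
  also have "(\<Sum>l\<in>links d N. (incidence N l y0)\<^sup>2 * (s\<^sup>2 * (q \<bullet> q))) = C * (s\<^sup>2 * (q \<bullet> q))"
    by (simp add: C_def sum_distrib_right)
  finally have "0 \<le> (s + C * s\<^sup>2 / 2) * (q \<bullet> q)"
    by (simp add: algebra_simps)
  moreover have "C \<ge> 0" by (simp add: C_def sum_nonneg)
  then have "s < 0" "C * s > - 1"
    by (simp_all add: s_def field_simps)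
  then have "s * (1 + C * s / 2) < 0"
    by (intro mult_neg_pos) simp_all
  then have "s + C * s\<^sup>2 / 2 < 0"
    by (simp add: power2_eq_square algebra_simps)
  ultimately have "q \<bullet> q \<le> 0"
    by (simp add: zero_le_mult_iff)
  then have "q \<bullet> q = 0"
    using inner_ge_zero[of q] by (rule antisym)
  then have "q = 0" by simp
  then show "(\<Sum>l\<in>links d N. incidence N l y0 *\<^sub>R coord (U l)) = 0"
    by (simp add: q_def)
next
  assume *: "U \<in> fields d N GC \<and> (\<forall>y\<in>sites d N. (\<Sum>l\<in>links d N. incidence N l y *\<^sub>R coord (U l)) = 0)"
  then have U: "U \<in> fields d N GC" by simp
  have "dist_fun d N G GC \<kappa> U \<le> dist_fun d N G GC \<kappa> (gauge_transform d N GC g U)"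
    if g: "g \<in> sites d N \<rightarrow> carrier GC" for g
    using * dist_fun_gauge_transform[OF N U g] by (simp add: sum_nonneg)
  then show "U \<in> gauge_minimal d N G GC \<kappa>"
    using U by (simp add: gauge_minimal_def)
qed

end

section \<open>The complex Langevin equation\<close>

text \<open>All trapezoidal sums vanish, whatever the integrator, and a limit in probability of 0 is
  0 almost surely by a countable union over thresholds.\<close>

lemma has_stratonovich_integral_zero:
  assumes "prob_space P" "t \<ge> 0" "has_stratonovich_integral P H w t I"
    and H: "\<And>s \<omega>. 0 \<le> s \<Longrightarrow> \<omega> \<in> space P \<Longrightarrow> H s \<omega> = 0"
  shows "AE \<omega> in P. I \<omega> = 0"
proof -
  interpret prob_space P by (rule assms)
  \<comment> \<open>The integral is a limit along every partition sequence, so one suffices: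
    \<open>Suc n\<close> equal intervals, the successor avoiding a division by 0.\<close>
  define \<pi> :: "nat \<Rightarrow> nat \<Rightarrow> real" where "\<pi> n i = t * (real i / real (Suc n))" for n i
  have step: "\<pi> n (Suc i) - \<pi> n i = t / real (Suc n)" for n i
    by (simp add: \<pi>_def add_divide_distrib distrib_left)
  have \<pi>0: "\<pi> n i \<ge> 0" for n i
    using assms(2) by (simp add: \<pi>_def)
  have part: "partition_seq t Suc \<pi>"
    unfolding partition_seq_def
  proof (intro conjI allI impI)
    show "\<pi> n 0 = 0" "\<pi> n (Suc n) = t" for n
      by (simp_all add: \<pi>_def)
    show "\<pi> n i \<le> \<pi> n (Suc i)" for n i
      using step[of n i] assms(2) by (smt (verit) divide_nonneg_nonneg of_nat_0_le_iff)
    fix e :: real assume "e > 0"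
    have "(\<lambda>n. t / real (Suc n)) \<longlonglongrightarrow> 0"
      using LIMSEQ_Suc[OF lim_const_over_n[of t]] by simp
    from order_tendstoD(2)[OF this \<open>e > 0\<close>]
    show "\<forall>\<^sub>F n in sequentially. \<forall>i<Suc n. \<pi> n (Suc i) - \<pi> n i < e"
      by (rule eventually_mono) (simp add: step del: of_nat_Suc)
  qed
  define Z where "Z n \<omega> = (\<Sum>i<Suc n. (H (\<pi> n i) \<omega> + H (\<pi> n (Suc i)) \<omega>) / 2 *
      (w (\<pi> n (Suc i)) \<omega> - w (\<pi> n i) \<omega>))" for n \<omega>
  have Z0: "Z n \<omega> = 0" if "\<omega> \<in> space P" for n \<omega>
    unfolding Z_def using that by (intro sum.neutral) (simp add: H \<pi>0)
  have conv: "converges_in_probability P Z I"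
    unfolding Z_def[abs_def]
    using assms(3) part unfolding has_stratonovich_integral_def by blast
  have I: "I \<in> borel_measurable P"
    using conv by (simp add: converges_in_probability_def)
  have null: "measure P {\<omega> \<in> space P. \<bar>I \<omega>\<bar> > e} = 0" if "e > 0" for e
  proof -
    have *: "{\<omega> \<in> space P. \<bar>Z n \<omega> - I \<omega>\<bar> > e} = {\<omega> \<in> space P. \<bar>I \<omega>\<bar> > e}" for n
      using Z0 by auto
    have "(\<lambda>n. measure P {\<omega> \<in> space P. \<bar>Z n \<omega> - I \<omega>\<bar> > e}) \<longlonglongrightarrow> 0"
      using conv that by (simp add: converges_in_probability_def)
    then have "(\<lambda>n::nat. measure P {\<omega> \<in> space P. \<bar>I \<omega>\<bar> > e}) \<longlonglongrightarrow> 0"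
      by (simp only: *)
    then show ?thesis by (simp add: LIMSEQ_const_iff)
  qed
  have "AE \<omega> in P. \<bar>I \<omega>\<bar> \<le> 1 / real (Suc n)" for n
  proof (rule AE_I)
    show "{\<omega> \<in> space P. \<not> \<bar>I \<omega>\<bar> \<le> 1 / real (Suc n)} \<subseteq> {\<omega> \<in> space P. \<bar>I \<omega>\<bar> > 1 / real (Suc n)}"
      by auto
    show "emeasure P {\<omega> \<in> space P. \<bar>I \<omega>\<bar> > 1 / real (Suc n)} = 0"
      using null[of "1 / real (Suc n)"] by (simp add: emeasure_eq_measure)
    show "{\<omega> \<in> space P. \<bar>I \<omega>\<bar> > 1 / real (Suc n)} \<in> sets P"
      using I by measurable
  qed
  then have "AE \<omega> in P. \<forall>n. \<bar>I \<omega>\<bar> \<le> 1 / real (Suc n)"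
    by (simp add: AE_all_countable)
  then show ?thesis
  proof (rule AE_mp, intro AE_I2 impI)
    fix \<omega> assume *: "\<forall>n. \<bar>I \<omega>\<bar> \<le> 1 / real (Suc n)"
    show "I \<omega> = 0"
    proof (rule ccontr)
      assume "I \<omega> \<noteq> 0"
      then obtain n where "1 / real (Suc n) < \<bar>I \<omega>\<bar>"
        using nat_approx_posE[of "\<bar>I \<omega>\<bar>"] by auto
      with * show False by (meson not_le)
    qed
  qed
qed

text \<open>Reduces a statement at all times to countably many, which is what almost-sure statements
  allow.\<close>

lemma eq_on_nonneg_rationals:
  fixes f :: "real \<Rightarrow> 'a::t2_space"
  assumes "continuous_on {0..} f" "\<And>q :: rat. q \<ge> 0 \<Longrightarrow> f (of_rat q) = c" "t \<ge> 0"
  shows "f t = c"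
proof -
  \<comment> \<open>Approximation from above keeps the rationals nonnegative, also at
    \<open>t = 0\<close>.\<close>
  have "\<exists>q :: nat \<Rightarrow> rat. \<forall>n. t < of_rat (q n) \<and> of_rat (q n) < t + 1 / real (Suc n)"
    by (intro choice allI of_rat_dense) simp
  then obtain q :: "nat \<Rightarrow> rat" where q: "\<And>n. t < of_rat (q n)" "\<And>n. of_rat (q n) < t + 1 / real (Suc n)"
    by blast
  have "(\<lambda>n. of_rat (q n)) \<longlonglongrightarrow> t"
  proof (rule tendsto_sandwich[of "\<lambda>n. t" _ _ "\<lambda>n. t + 1 / real (Suc n)"])
    show "(\<lambda>n. t + 1 / real (Suc n)) \<longlonglongrightarrow> t"
      using tendsto_add[OF tendsto_const[of t] LIMSEQ_Suc[OF lim_const_over_n[of 1]]] by simp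
  qed (use q in \<open>auto intro!: always_eventually less_imp_le\<close>)
  moreover have pos: "of_rat (q n) \<ge> (0 :: real)" for n
    using q(1)[of n] assms(3) by linarith
  ultimately have "(\<lambda>n. f (of_rat (q n))) \<longlonglongrightarrow> f t"
    using assms(1,3) by (intro continuous_on_tendsto_compose[of "{0..}" f]) auto
  moreover have "f (of_rat (q n)) = c" for n
    using pos[of n] by (intro assms(2)) simp
  ultimately show ?thesis
    by (simp add: LIMSEQ_const_iff)
qed

section \<open>Conservation of the divergence along solutions\<close>

context abelian_complexification
begin

text \<open>The polar coordinates are constant along \<open>G\<close>, which removes the noise and the drift \<open>K\<close>.\<close>

lemma langevin_coord:
  assumes P: "prob_space P" and sol: "langevin_solution d N G GC X S P \<F> w U"
    and l: "l \<in> links d N" and t: "t \<ge> 0"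
  shows "AE \<omega> in P. set_integrable lborel {0..t} (\<lambda>s. drift_J G GC S X b l (U s \<omega>)) \<and>
    coord (U t \<omega> l) $ b - coord (U 0 \<omega> l) $ b = (LINT s:{0..t}|lborel. drift_J G GC S X b l (U s \<omega>))"
proof -
  have Uc: "U s \<omega> l \<in> carrier GC" if "s \<ge> 0" "\<omega> \<in> space P" for s \<omega>
    using sol that l by (auto simp: langevin_solution_def fields_def)
  obtain I where I: "\<And>a. has_stratonovich_integral P
           (\<lambda>s \<omega>. dR GC (U s \<omega> l) (lie_incl G GC (X a)) (\<lambda>W. coord W $ b)) (w l a) t (I a)"
    and eq: "AE \<omega> in P. let \<beta> = (\<lambda>s. \<Sum>a\<in>UNIV.
             drift_K G GC S X a l (U s \<omega>) * dR GC (U s \<omega> l) (lie_incl G GC (X a)) (\<lambda>W. coord W $ b) +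
             drift_J G GC S X a l (U s \<omega>) * dR GC (U s \<omega> l) (lie_I G GC (X a)) (\<lambda>W. coord W $ b)) in
           set_integrable lborel {0..t} \<beta> \<and>
           coord (U t \<omega> l) $ b - coord (U 0 \<omega> l) $ b = (LINT s:{0..t}|lborel. \<beta> s) + (\<Sum>a\<in>UNIV. I a \<omega>)"
    using sol l t coord_smooth_map[of b] unfolding langevin_solution_def by meson
  have "AE \<omega> in P. I a \<omega> = 0" for a
    by (rule has_stratonovich_integral_zero[OF P t I]) (simp add: dR_incl_coord Uc)
  then have I0: "AE \<omega> in P. \<forall>a. I a \<omega> = 0"
    by (simp add: AE_all_countable)
  show ?thesis
    using eq I0 AE_space
  proof eventually_elim
    case (elim \<omega>)
    define \<beta> where "\<beta> s = (\<Sum>a\<in>UNIV.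
             drift_K G GC S X a l (U s \<omega>) * dR GC (U s \<omega> l) (lie_incl G GC (X a)) (\<lambda>W. coord W $ b) +
             drift_J G GC S X a l (U s \<omega>) * dR GC (U s \<omega> l) (lie_I G GC (X a)) (\<lambda>W. coord W $ b))" for s
    have \<beta>: "\<beta> s = drift_J G GC S X b l (U s \<omega>)" if "s \<in> {0..t}" for s
      using that elim(3) Uc[of s \<omega>]
      by (simp add: \<beta>_def dR_incl_coord dR_I_coord if_distrib[where f = "\<lambda>x. _ * x"] cong: if_cong)
    have "set_integrable lborel {0..t} \<beta>"
      "coord (U t \<omega> l) $ b - coord (U 0 \<omega> l) $ b = (LINT s:{0..t}|lborel. \<beta> s)"
      using elim(1,2) by (simp_all add: Let_def \<beta>_def[abs_def])
    moreover have "set_integrable lborel {0..t} \<beta> \<longleftrightarrow>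
        set_integrable lborel {0..t} (\<lambda>s. drift_J G GC S X b l (U s \<omega>))"
      by (rule set_integrable_cong) (auto simp: \<beta>)
    moreover have "(LINT s:{0..t}|lborel. \<beta> s) = (LINT s:{0..t}|lborel. drift_J G GC S X b l (U s \<omega>))"
      by (rule set_lebesgue_integral_cong) (auto simp: \<beta>)
    ultimately show ?case by simp
  qed
qed

text \<open>The weighted sum over links is taken inside the time integral, which uses integrability
  of each drift separately; there gauge invariance makes the integrand vanish pointwise.\<close>

lemma langevin_divergence:
  assumes P: "prob_space P" and sol: "langevin_solution d N G GC X S P \<F> w U"
    and hol: "holomorphic_action d N GC S" and inv: "gauge_invariant d N GC S" and t: "t \<ge> 0"
  shows "AE \<omega> in P. \<forall>y. (\<Sum>l\<in>links d N. incidence N l y *\<^sub>R coord (U t \<omega> l)) =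
    (\<Sum>l\<in>links d N. incidence N l y *\<^sub>R coord (U 0 \<omega> l))"
proof -
  have "AE \<omega> in P. \<forall>l\<in>links d N. \<forall>b. set_integrable lborel {0..t} (\<lambda>s. drift_J G GC S X b l (U s \<omega>)) \<and>
    coord (U t \<omega> l) $ b - coord (U 0 \<omega> l) $ b = (LINT s:{0..t}|lborel. drift_J G GC S X b l (U s \<omega>))"
    using langevin_coord[OF P sol _ t] by (intro AE_finite_allI finite_links) (simp add: AE_all_countable)
  then show ?thesis
    using AE_space
  proof eventually_elim
    case (elim \<omega>)
    show ?case
    proof (intro allI, subst vec_eq_iff, rule allI)
      fix y b
      define J where "J l s = drift_J G GC S X b l (U s \<omega>)" for l s
      have int: "set_integrable lborel {0..t} (\<lambda>s. incidence N l y * J l s)" if "l \<in> links d N" for l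
        using elim(1) that by (simp add: J_def)
      have "(\<Sum>l\<in>links d N. incidence N l y * (coord (U t \<omega> l) $ b - coord (U 0 \<omega> l) $ b)) =
          (\<Sum>l\<in>links d N. incidence N l y * (LINT s:{0..t}|lborel. J l s))"
        using elim(1) by (intro sum.cong) (auto simp: J_def)
      also have "\<dots> = (\<Sum>l\<in>links d N. LINT s:{0..t}|lborel. incidence N l y * J l s)"
        by simp
      also have "\<dots> = (LINT s:{0..t}|lborel. (\<Sum>l\<in>links d N. incidence N l y * J l s))"
        using int unfolding set_lebesgue_integral_def set_integrable_def scaleR_sum_right
        by (rule Bochner_Integration.integral_sum[symmetric])
      also have "\<dots> = (LINT s:{0..t}|lborel. 0)"
      proof (rule set_lebesgue_integral_cong)
        show "\<forall>s. s \<in> {0..t} \<longrightarrow> (\<Sum>l\<in>links d N. incidence N l y * J l s) = 0"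
          using sol elim(2) unfolding J_def
          by (intro allI impI divergence_drift_J[OF hol inv]) (simp add: langevin_solution_def)
      qed simp
      finally show "(\<Sum>l\<in>links d N. incidence N l y *\<^sub>R coord (U t \<omega> l)) $ b =
          (\<Sum>l\<in>links d N. incidence N l y *\<^sub>R coord (U 0 \<omega> l)) $ b"
        by (simp add: right_diff_distrib sum_subtractf)
    qed
  qed
qed

text \<open>The null set in \<open>langevin_divergence\<close> depends on \<open>t\<close>.
  Conservation is therefore collected at rational times and extended by continuity of the polar
  coordinates along paths.\<close>

lemma langevin_gauge_minimal:
  assumes P: "prob_space P" and sol: "langevin_solution d N G GC X S P \<F> w U"
    and hol: "holomorphic_action d N GC S" and inv: "gauge_invariant d N GC S"
    and N: "\<And>\<mu>. \<mu> \<le> d \<Longrightarrow> N \<mu> \<ge> 1" and init: "AE \<omega> in P. U 0 \<omega> \<in> gauge_minimal d N G GC \<kappa>"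
  shows "AE \<omega> in P. \<forall>t\<ge>0. U t \<omega> \<in> gauge_minimal d N G GC \<kappa>"
proof -
  have minimal: "V \<in> gauge_minimal d N G GC \<kappa> \<longleftrightarrow> V \<in> fields d N GC \<and>
    (\<forall>y\<in>sites d N. (\<Sum>l\<in>links d N. incidence N l y *\<^sub>R coord (V l)) = 0)" for V
    by (rule gauge_minimal_iff) (rule N)
  have "AE \<omega> in P. \<forall>q::rat. q \<ge> 0 \<longrightarrow> (\<forall>y. (\<Sum>l\<in>links d N. incidence N l y *\<^sub>R coord (U (of_rat q) \<omega> l)) =
    (\<Sum>l\<in>links d N. incidence N l y *\<^sub>R coord (U 0 \<omega> l)))"
    unfolding AE_all_countable using langevin_divergence[OF P sol hol inv] by auto
  moreover have "AE \<omega> in P. \<forall>l\<in>links d N. continuous_map (top_of_set {0..}) (mtop (mfd GC)) (\<lambda>t. U t \<omega> l)"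
    using sol by (simp add: langevin_solution_def)
  ultimately show ?thesis
    using init AE_space
  proof eventually_elim
    case (elim \<omega>)
    have cont: "continuous_on {0..} (\<lambda>t. coord (U t \<omega> l))" if "l \<in> links d N" for l
      using continuous_map_compose[OF _ coord_continuous_map] elim(2) that by (fastforce simp: o_def)
    show ?case
      unfolding minimal
    proof (intro allI impI conjI ballI)
      fix t :: real assume t: "t \<ge> 0"
      then show "U t \<omega> \<in> fields d N GC"
        using sol elim(4) by (simp add: langevin_solution_def)
      fix y assume y: "y \<in> sites d N"
      have 0: "(\<Sum>l\<in>links d N. incidence N l y *\<^sub>R coord (U 0 \<omega> l)) = 0"
        using elim(3) y unfolding minimal by blast
      show "(\<Sum>l\<in>links d N. incidence N l y *\<^sub>R coord (U t \<omega> l)) = 0"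
        by (rule eq_on_nonneg_rationals[OF _ _ t])
          (use cont elim(1) 0 in \<open>auto intro!: continuous_on_sum continuous_on_scaleR continuous_on_const\<close>)
    qed
  qed
qed

end

theorem theorem4p1:
  fixes G :: "('g, real^'m) lie_grp" and GC :: "('g, complex^'m) lie_grp"
    and \<kappa> :: "'g metric" and X :: "'m \<Rightarrow> 'g tvec"
    and d :: nat and N :: "nat \<Rightarrow> nat"
    and S :: "'g field \<Rightarrow> complex"
    and P :: "'w measure" and \<F> :: "real \<Rightarrow> 'w measure"
    and w :: "link \<Rightarrow> 'm \<Rightarrow> real \<Rightarrow> 'w \<Rightarrow> real"
    and U :: "real \<Rightarrow> 'w \<Rightarrow> 'g field"
  assumes "compact_lie_group G"
    and "bi_invariant_metric G \<kappa>"
    and "complexification G GC"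
    and "orthonormal_lie_basis G \<kappa> X"
    and "\<And>\<mu>. \<mu> \<le> d \<Longrightarrow> N \<mu> \<ge> 1"
    and "holomorphic_action d N GC S"
    and "gauge_invariant d N GC S"
    and "comm_group G"
    and "prob_space P"
    and "filtration (space P) \<F>"
    and "\<And>t. subalgebra P (\<F> t)"
    and "\<And>l a. l \<in> links d N \<Longrightarrow> brownian_motion P \<F> (w l a)"
    and "independent_processes P (links d N \<times> UNIV) (\<lambda>(l, a). w l a)"
    and "langevin_solution d N G GC X S P \<F> w U"
    and "AE \<omega> in P. U 0 \<omega> \<in> gauge_minimal d N G GC \<kappa>"
  shows "AE \<omega> in P. \<forall>t\<ge>0. U t \<omega> \<in> gauge_minimal d N G GC \<kappa>"
proof -
  have "lie_group G" "lie_group GC"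
    using assms(1,3) by (simp_all add: compact_lie_group_def complexification_def complex_lie_group_def)
  then interpret abelian_complexification G GC \<kappa> X
    using assms(2,3,4,8)
    by (simp add: abelian_complexification_def abelian_complexification_axioms_def lie_def lie_axioms_def
        lie_group_def bi_invariant_metric_def)
  show ?thesis
    by (rule langevin_gauge_minimal[OF assms(9,14,6,7,5,15)])
qed

end
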